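(* Let $0<p<q<\infty$, let $g$ be a holomorphic function on $\mathbb{B}_n$, and let $\alpha=n\left(\frac1p-\frac1q\right)$. If $\alpha<1$, then the operator $J_g:H^p\to H^q$ is compact if and only if $g\in\lambda(\alpha)$. If $\alpha=1$, then $J_g:H^p\to H^q$ is compact if and only if $J_g\equiv0$.
   Context: $\mathbb{B}_n$ is the open unit ball of $\mathbb{C}^n$, $\mathbb{S}_n=\partial\mathbb{B}_n$, and $\sigma$ is surface measure on $\mathbb{S}_n$ normalized so that $\sigma(\mathbb{S}_n)=1$. For $g$ holomorphic on $\mathbb{B}_n$, $Rg(z)=\sum_{k=1}^n z_k\frac{\partial g}{\partial z_k}(z)$ is the radial derivative, and for $f$ holomorphic on $\mathbb{B}_n$, $$J_gf(z)=\int_0^1 f(tz)\,Rg(tz)\,\frac{dt}{t},\qquad z\in\mathbb{B}_n.$$ For $0<p<\infty$, $H^p$ is the space of holomorphic $f$ on $\mathbb{B}_n$ with $\|f\|_{H^p}^p=\sup_{0<r<1}\int_{\mathbb{S}_n}|f(r\zeta)|^p\,d\sigma(\zeta)<\infty$. Compactness of $J_g:H^p\to H^q$ is equivalent to: $\|J_gf_k\|_{H^q}\to0$ for every bounded sequence $\{f_k\}$ in $H^p$ converging to zero uniformly on compact subsets of $\mathbb{B}_n$. For $0<\alpha<1$, $\lambda(\alpha)$ is the space of holomorphic $g$ on $\mathbb{B}_n$ with $\lim_{|z|\to1^-}(1-|z|^2)^{1-\alpha}|Rg(z)|=0$. *)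

theory Defs
  imports "HOL-Analysis.Analysis"
begin

text \<open>Holomorphy in several variables: the real Frechet derivative exists and is complex linear.\<close>

definition holomorphic_vec_on :: "(complex ^ 'n \<Rightarrow> complex) \<Rightarrow> (complex ^ 'n) set \<Rightarrow> bool"
    (infixl "holomorphic'_vec'_on" 50) where
  "f holomorphic_vec_on S \<longleftrightarrow>
     (\<forall>z\<in>S. \<exists>D. (f has_derivative D) (at z within S) \<and> (\<forall>c v. D (c *s v) = c * D v))"

definition partial_deriv :: "'n \<Rightarrow> (complex ^ 'n \<Rightarrow> complex) \<Rightarrow> complex ^ 'n \<Rightarrow> complex" where
  "partial_deriv k g z = deriv (\<lambda>w. g (\<chi> j. if j = k then w else z $ j)) (z $ k)"

definition radial_deriv :: "(complex ^ 'n \<Rightarrow> complex) \<Rightarrow> complex ^ 'n \<Rightarrow> complex" where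
  "radial_deriv g z = (\<Sum>k\<in>UNIV. z $ k * partial_deriv k g z)"

text \<open>At \<open>t = 0\<close> the integrand below is \<open>0\<close> by the convention on division by zero; it is
  bounded on \<open>0 < t \<le> 1\<close> since the radial derivative of a holomorphic function is \<open>O(\<bar>z\<bar>)\<close>
  at the origin.\<close>

definition J_op :: "(complex ^ 'n \<Rightarrow> complex) \<Rightarrow> (complex ^ 'n \<Rightarrow> complex) \<Rightarrow> complex ^ 'n \<Rightarrow> complex"
  where
  "J_op g f z = integral {0..1} (\<lambda>t. f (t *\<^sub>R z) * radial_deriv g (t *\<^sub>R z) / of_real t)"

text \<open>Normalized surface measure on the unit sphere, obtained as the image of the normalized volume
  of the unit ball under radial projection. Equivalently, the normalized surface measure of \<open>A\<close> is
  the proportion of the volume of the ball taken up by the cone over \<open>A\<close>, which is the lemma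
  \<open>emeasure_sphere_measure\<close> below. The origin is sent to itself, off the sphere, but has measure
  zero.\<close>

definition sphere_measure :: "(complex ^ 'n) measure" where
  "sphere_measure = restrict_space
     (distr (uniform_measure lborel (ball 0 1)) borel (\<lambda>z. z /\<^sub>R norm z)) (sphere 0 1)"

lemma space_sphere_measure: "space sphere_measure = sphere 0 1"
  by (simp add: sphere_measure_def space_restrict_space)

lemma emeasure_sphere_measure:
  fixes A :: "(complex ^ 'n) set"
  assumes "A \<in> sets borel" "A \<subseteq> sphere 0 1"
  shows "emeasure sphere_measure A =
    emeasure lborel {t *\<^sub>R \<zeta> | t \<zeta>. 0 < t \<and> t < 1 \<and> \<zeta> \<in> A} /
      emeasure lborel (ball (0 :: complex ^ 'n) 1)"
proof -
  let ?p = "\<lambda>z :: complex ^ 'n. z /\<^sub>R norm z"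
  have "ball 0 1 \<inter> ?p -` A = {t *\<^sub>R \<zeta> | t \<zeta>. 0 < t \<and> t < 1 \<and> \<zeta> \<in> A}"
  proof (intro subset_antisym subsetI)
    fix z assume z: "z \<in> ball 0 1 \<inter> ?p -` A"
    then have "z \<noteq> 0"
      using assms(2) by auto
    then have "z = norm z *\<^sub>R ?p z \<and> 0 < norm z"
      by simp
    then show "z \<in> {t *\<^sub>R \<zeta> | t \<zeta>. 0 < t \<and> t < 1 \<and> \<zeta> \<in> A}"
      using z by (intro CollectI exI[of _ "norm z"] exI[of _ "?p z"]) auto
  next
    fix z assume "z \<in> {t *\<^sub>R \<zeta> | t \<zeta>. 0 < t \<and> t < 1 \<and> \<zeta> \<in> A}"
    then obtain t \<zeta> where t: "z = t *\<^sub>R \<zeta>" "0 < t" "t < 1" "\<zeta> \<in> A"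
      by blast
    then have "norm \<zeta> = 1"
      using assms(2) by auto
    then show "z \<in> ball 0 1 \<inter> ?p -` A"
      using t by simp
  qed
  moreover have "?p \<in> borel_measurable borel"
    by measurable
  moreover from this have "?p -` A \<in> sets borel"
    using assms(1) measurable_sets_borel by blast
  ultimately show ?thesis
    using assms unfolding sphere_measure_def
    by (subst emeasure_restrict_space) (auto simp: emeasure_distr)
qed

lemma emeasure_sphere_measure_sphere:
  "emeasure sphere_measure (sphere 0 1 :: (complex ^ 'n) set) = 1"
proof -
  let ?B = "ball 0 1 :: (complex ^ 'n) set"
  have "{t *\<^sub>R \<zeta> | t \<zeta>. 0 < t \<and> t < 1 \<and> \<zeta> \<in> sphere 0 1} = ?B - {0}"
  proof (intro subset_antisym subsetI)
    fix z assume z: "z \<in> ?B - {0}"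
    then have "z = norm z *\<^sub>R (z /\<^sub>R norm z)" "z /\<^sub>R norm z \<in> sphere 0 1" "0 < norm z" "norm z < 1"
      by auto
    then show "z \<in> {t *\<^sub>R \<zeta> | t \<zeta>. 0 < t \<and> t < 1 \<and> \<zeta> \<in> sphere 0 1}"
      by blast
  qed auto
  moreover have "emeasure lborel (?B - {0}) = emeasure lborel ?B"
    by (intro emeasure_Diff_null_set) auto
  moreover have "emeasure lborel ?B \<noteq> 0"
    using content_ball_pos[of 1 "0 :: complex ^ 'n"] by (auto simp: measure_def)
  moreover have "emeasure lborel ?B \<noteq> \<infinity>"
    using emeasure_lborel_ball_finite[of "0 :: complex ^ 'n" 1] by auto
  ultimately show ?thesis
    by (subst emeasure_sphere_measure) (auto intro: ennreal_divide_self simp: top.not_eq_extremum)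
qed

text \<open>The \<open>p\<close>-th power of the Hardy quasi-norm, possibly infinite.\<close>

definition hardy_mean :: "real \<Rightarrow> (complex ^ 'n \<Rightarrow> complex) \<Rightarrow> ennreal" where
  "hardy_mean p f =
     (SUP r\<in>{0<..<1}. \<integral>\<^sup>+ \<zeta>. ennreal (cmod (f (r *\<^sub>R \<zeta>)) powr p) \<partial>sphere_measure)"

definition hardy :: "real \<Rightarrow> (complex ^ 'n \<Rightarrow> complex) set" where
  "hardy p = {f. f holomorphic_vec_on ball 0 1 \<and> hardy_mean p f < \<infinity>}"

text \<open>Meaningful only for members of \<^term>\<open>hardy p\<close>: an infinite mean is sent to \<open>0\<close>.\<close>

definition hardy_norm :: "real \<Rightarrow> (complex ^ 'n \<Rightarrow> complex) \<Rightarrow> real" where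
  "hardy_norm p f = enn2real (hardy_mean p f) powr (1 / p)"

text \<open>\<open>T\<close> maps the \<open>p\<close>-th Hardy space into the \<open>q\<close>-th one and sends bounded sequences to sequences
  with a subsequence converging in the latter. Elements of the Hardy spaces are represented by
  functions on the whole space, whose values outside the ball play no role.\<close>

definition compact_hardy_operator ::
    "real \<Rightarrow> real \<Rightarrow> ((complex ^ 'n \<Rightarrow> complex) \<Rightarrow> complex ^ 'n \<Rightarrow> complex) \<Rightarrow> bool" where
  "compact_hardy_operator p q T \<longleftrightarrow>
     (\<forall>f\<in>hardy p. T f \<in> hardy q) \<and>
     (\<forall>F :: nat \<Rightarrow> complex ^ 'n \<Rightarrow> complex.
        (\<forall>k. F k \<in> hardy p) \<and> (\<exists>C. \<forall>k. hardy_norm p (F k) \<le> C) \<longrightarrow>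
        (\<exists>s h. strict_mono s \<and> h \<in> hardy q \<and>
           (\<lambda>k. hardy_norm q (\<lambda>z. T (F (s k)) z - h z)) \<longlonglongrightarrow> 0))"

definition little_lipschitz :: "real \<Rightarrow> (complex ^ 'n \<Rightarrow> complex) set" where
  "little_lipschitz \<alpha> = {g. g holomorphic_vec_on ball 0 1 \<and>
     ((\<lambda>z. (1 - (norm z)\<^sup>2) powr (1 - \<alpha>) * cmod (radial_deriv g z)) \<longlongrightarrow> 0)
       (filtercomap norm (at_left 1))}"

end

theory Submission
  imports Defs "HOL-Complex_Analysis.Complex_Analysis"
begin

text \<open>Sufficiency rests on a pointwise estimate in the spirit of Hedberg. In the integral defining
  \<open>J_op g f\<close> at \<open>r \<zeta>\<close>, the growth of \<open>radial_deriv g\<close> leaves \<open>\<bar>f\<bar>\<close> against \<open>(1 - t)\<close> to the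
  power \<open>\<alpha> - 1\<close>. Bound \<open>\<bar>f (t \<zeta>)\<bar>\<close> by the radial maximal function \<open>N \<zeta>\<close> for \<open>t\<close> near \<open>1\<close> and by
  a multiple of \<open>(1 - t)\<close> to the power \<open>- n / p\<close> elsewhere; optimising the splitting point leaves
  \<open>N \<zeta>\<close> to the power \<open>p / q\<close>, whose \<open>q\<close>-th power is integrable. The maximal function is bounded
  on every Hardy space because \<open>\<bar>f\<bar>\<close> to the power \<open>p / 2\<close> is dominated on each slice disc by its
  Poisson integral, and the Poisson maximal operator is bounded on square integrable functions by a
  \<open>T T\<^sup>*\<close> argument. Compactness then follows from Montel's theorem, since the little-o condition
  makes the part of the integral near the sphere uniformly small. Conversely, the operator is tested
  on powers of the Szego kernel with pole tending to the sphere, combined with the Cauchy estimate for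
  the radial derivative of \<open>J_op g f\<close>, which is \<open>f\<close> times the radial derivative of \<open>g\<close>.\<close>

subsection \<open>The Poisson integral on the circle\<close>

text \<open>For p < 1 the means are not norms, and no boundary values are used. All estimates
  therefore live on spheres of radius r < 1 with constants independent of r, and rest on one fact
  valid for every exponent: positive powers of the modulus of a holomorphic function are
  subharmonic. That freedom explains the exponent p/2: it turns an H^p bound into an L^2 bound, the
  only case in which a maximal inequality has to be proved. The exponents fit because \<alpha>
  divided by n/p is 1 - p/q, so the optimal splitting point leaves the maximal function with the
  power p/q. The growth rate n/p is essential here; averaging over Euclidean balls of radius
  comparable to the distance to the sphere would only give (2n-1)/p. It comes from ellipsoids of
  size \<delta> in the complex radial direction and sqrt \<delta> in the others. The same geometry
  gives caps of measure of order \<delta>^n, which is what keeps the test functions bounded. For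
  \<alpha> = 1 the weight disappears: the necessity argument says that Rg tends to 0 at the sphere,
  and the maximum principle on slices makes it vanish.\<close>

definition circle_measure :: "complex measure" where
  "circle_measure = distr (restrict_space lborel {0..1}) borel (\<lambda>t. cis (2 * pi * t))"

lemma sets_circle_measure [simp, measurable_cong]: "sets circle_measure = sets borel"
  by (simp add: circle_measure_def)

lemma space_circle_measure [simp]: "space circle_measure = UNIV"
  by (simp add: circle_measure_def)

lemma measurable_cis_2pi [measurable]: "(\<lambda>t. cis (2 * pi * t)) \<in> borel_measurable borel"
  by (intro borel_measurable_continuous_onI continuous_intros)

lemma nn_integral_circle:
  assumes [measurable]: "f \<in> borel_measurable borel"
  shows "nn_integral circle_measure f = (\<integral>\<^sup>+t. f (cis (2 * pi * t)) * indicator {0..1} t \<partial>lborel)"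
  unfolding circle_measure_def
  by (subst nn_integral_distr)
     (auto simp: nn_integral_restrict_space intro!: measurable_restrict_space1)

lemma nn_integral_circle_mono:
  assumes [measurable]: "f \<in> borel_measurable borel" "g \<in> borel_measurable borel"
    and "\<And>y. cmod y = 1 \<Longrightarrow> f y \<le> g y"
  shows "nn_integral circle_measure f \<le> nn_integral circle_measure g"
  unfolding nn_integral_circle[OF assms(1)] nn_integral_circle[OF assms(2)]
  by (intro nn_integral_mono mult_right_mono assms(3)) auto

lemma nn_integral_circle_cong:
  assumes [measurable]: "f \<in> borel_measurable borel" "g \<in> borel_measurable borel"
    and "\<And>y. cmod y = 1 \<Longrightarrow> f y = g y"
  shows "nn_integral circle_measure f = nn_integral circle_measure g"
  by (intro antisym nn_integral_circle_mono assms) (simp_all add: assms(3))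

lemma emeasure_circle_UNIV [simp]: "emeasure circle_measure UNIV = 1"
  unfolding circle_measure_def
  by (subst emeasure_distr)
     (auto simp: emeasure_restrict_space space_restrict_space intro!: measurable_restrict_space1)

interpretation circle: finite_measure circle_measure
  by (rule finite_measureI) simp

text \<open>With \<open>x = cis (2 * pi * b)\<close> the rotation is a shift of the parameter by
  \<open>b\<close>. The part of the shifted interval beyond 1 is brought back by the periodicity of
  \<open>F\<close>; endpoints are null sets.\<close>

lemma nn_integral_circle_rotate:
  assumes [measurable]: "f \<in> borel_measurable borel" and "cmod x = 1"
  shows "(\<integral>\<^sup>+y. f (x * y) \<partial>circle_measure) = nn_integral circle_measure f"
proof -
  obtain a where a: "0 \<le> a" "a < 2 * pi" and xa: "x = cis a"
    using complex_unimodular_polar[OF assms(2)] by (auto simp: cis.code)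
  define b where "b = a / (2 * pi)"
  have b: "0 \<le> b" "b < 1" and xb: "x = cis (2 * pi * b)"
    using a xa by (auto simp: b_def field_simps)
  define F where "F t = f (cis (2 * pi * t))" for t
  have [measurable]: "F \<in> borel_measurable borel"
    unfolding F_def by measurable
  have per: "F (- 1 + t) = F t" for t
  proof -
    have "cis (2 * pi * (- 1 + t)) = cis (2 * pi * t) / cis (2 * pi)"
      by (subst cis_divide) (simp add: algebra_simps)
    then show ?thesis by (simp add: F_def)
  qed
  have "(\<integral>\<^sup>+y. f (x * y) \<partial>circle_measure) = (\<integral>\<^sup>+t. F (b + t) * indicator {0..1} t \<partial>lborel)"
    unfolding F_def xb cis_mult by (subst nn_integral_circle) (simp_all add: cis_mult ring_distribs)
  also have "\<dots> = (\<integral>\<^sup>+t. F t * indicator {b..1 + b} t \<partial>lborel)"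
    by (subst nn_integral_real_affine[of "\<lambda>t. F t * indicator {b..1 + b} t" 1 b])
       (auto simp: indicator_def intro!: nn_integral_cong)
  also have "\<dots> = (\<integral>\<^sup>+t. F t * indicator {b..1} t + F t * indicator {1<..1+b} t \<partial>lborel)"
    using b by (intro nn_integral_cong) (auto simp: indicator_def)
  also have "\<dots> = (\<integral>\<^sup>+t. F t * indicator {b..1} t \<partial>lborel) + (\<integral>\<^sup>+t. F t * indicator {1<..1+b} t \<partial>lborel)"
    by (intro nn_integral_add) auto
  also have "(\<integral>\<^sup>+t. F t * indicator {1<..1+b} t \<partial>lborel) = (\<integral>\<^sup>+t. F t * indicator {0<..b} t \<partial>lborel)"
    using per
    by (subst nn_integral_real_affine[of "\<lambda>t. F t * indicator {0<..b} t" 1 "-1"])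
       (auto simp: indicator_def intro!: nn_integral_cong)
  also have "\<dots> = (\<integral>\<^sup>+t. F t * indicator {0..<b} t \<partial>lborel)"
    using AE_lborel_singleton[of 0] AE_lborel_singleton[of b]
    by (intro nn_integral_cong_AE) (auto simp: indicator_def)
  also have "(\<integral>\<^sup>+t. F t * indicator {b..1} t \<partial>lborel) + \<dots> =
      (\<integral>\<^sup>+t. F t * indicator {b..1} t + F t * indicator {0..<b} t \<partial>lborel)"
    by (intro nn_integral_add[symmetric]) auto
  also have "\<dots> = (\<integral>\<^sup>+t. F t * indicator {0..1} t \<partial>lborel)"
    using b by (intro nn_integral_cong) (auto simp: indicator_def)
  also have "\<dots> = nn_integral circle_measure f"
    unfolding F_def by (subst nn_integral_circle) auto
  finally show ?thesis .
qed

definition poisson :: "complex \<Rightarrow> complex \<Rightarrow> real" where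
  "poisson a y = (1 - (cmod a)\<^sup>2) / (cmod (y - a))\<^sup>2"

lemma measurable_poisson [measurable]: "(\<lambda>(a, y). poisson a y) \<in> borel_measurable (borel \<Otimes>\<^sub>M borel)"
  unfolding poisson_def by measurable

lemma measurable_poisson' [measurable (raw)]:
  assumes [measurable]: "f \<in> borel_measurable M" "g \<in> borel_measurable M"
  shows "(\<lambda>x. poisson (f x) (g x)) \<in> borel_measurable M"
  unfolding poisson_def by measurable

lemma poisson_nonneg: "cmod a < 1 \<Longrightarrow> 0 \<le> poisson a y"
  by (simp add: poisson_def power_le_one abs_square_le_1)

text \<open>Cauchy's formula at \<open>a\<close>, applied to \<open>G\<close> instead of
  \<open>H\<close>: the extra factor is holomorphic on the closed disc, equals 1 at
  \<open>a\<close>, and turns the Cauchy kernel into the Poisson kernel on the circle.\<close>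

lemma has_integral_poisson:
  fixes H :: "complex \<Rightarrow> complex"
  assumes H: "H holomorphic_on cball 0 1" and a: "cmod a < 1"
  shows "((\<lambda>t. poisson a (cis (2 * pi * t)) * H (cis (2 * pi * t))) has_integral H a) {0..1}"
proof -
  define G where "G z = H z * of_real (1 - (cmod a)\<^sup>2) / (1 - cnj a * z)" for z
  have nz: "1 - cnj a * z \<noteq> 0" if "cmod z \<le> 1" for z
  proof
    assume "1 - cnj a * z = 0"
    then have "cmod (cnj a * z) = 1" by (metis eq_iff_diff_eq_0 norm_one)
    moreover have "cmod (cnj a * z) \<le> cmod a * 1"
      unfolding norm_mult using that by (intro mult_mono) auto
    ultimately show False using a by simp
  qed
  have "G holomorphic_on cball 0 1"
    unfolding G_def using nz by (intro holomorphic_intros H) auto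
  then have "((\<lambda>u. G u / (u - a)) has_contour_integral (2 * of_real pi * \<i> * G a)) (circlepath 0 1)"
    using a by (intro Cauchy_integral_circlepath_simple) auto
  then have "((\<lambda>t. G (cis (2 * pi * t)) / (cis (2 * pi * t) - a) * (2 * pi * \<i> * cis (2 * pi * t)))
     has_integral (2 * of_real pi * \<i> * G a)) {0..1}"
    unfolding has_contour_integral_def
    by (rule has_integral_eq[rotated])
       (simp add: vector_derivative_circlepath01, simp add: circlepath cis_conv_exp mult_ac)
  from has_integral_mult_right[OF this, of "1 / (2 * of_real pi * \<i>)"]
  have I: "((\<lambda>t. G (cis (2 * pi * t)) / (cis (2 * pi * t) - a) * cis (2 * pi * t)) has_integral G a) {0..1}"
    by (simp add: field_simps)
  have Ga: "G a = H a"
  proof -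
    have "1 - cnj a * a = of_real (1 - (cmod a)\<^sup>2)"
      using complex_norm_square[of a] by (simp add: mult.commute)
    moreover have "1 - (cmod a)\<^sup>2 \<noteq> 0" using a norm_ge_zero[of a] by (simp add: power2_eq_1_iff del: norm_ge_zero)
    ultimately show ?thesis unfolding G_def by (metis nonzero_mult_div_cancel_right of_real_eq_0_iff)
  qed
  have "G y / (y - a) * y = poisson a y * H y" if y: "cmod y = 1" for y
  proof -
    have ya: "y \<noteq> a" and y0: "y \<noteq> 0" using y a by auto
    have yy: "y * cnj y = 1" using y complex_norm_square[of y] by simp
    have "(1 - cnj a * y) * (y - a) = y * ((y - a) * cnj (y - a))"
      using yy by (simp add: algebra_simps)
    also have "(y - a) * cnj (y - a) = of_real ((cmod (y - a))\<^sup>2)"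
      by (simp only: complex_norm_square)
    finally have e: "(1 - cnj a * y) * (y - a) = y * of_real ((cmod (y - a))\<^sup>2)" .
    have "G y / (y - a) * y = H y * of_real (1 - (cmod a)\<^sup>2) * y / ((1 - cnj a * y) * (y - a))"
      by (simp add: G_def)
    also have "\<dots> = H y * of_real (1 - (cmod a)\<^sup>2) / of_real ((cmod (y - a))\<^sup>2)"
      unfolding e using y0 by simp
    finally show ?thesis by (simp add: poisson_def)
  qed
  then have "((\<lambda>t. poisson a (cis (2 * pi * t)) * H (cis (2 * pi * t))) has_integral G a) {0..1}"
    by (intro has_integral_eq[OF _ I]) simp
  then show ?thesis
    unfolding Ga .
qed

lemma nn_integral_poisson_Re:
  fixes H :: "complex \<Rightarrow> complex" and u :: "complex \<Rightarrow> real"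
  assumes H: "H holomorphic_on cball 0 1" and a: "cmod a < 1"
    and [measurable]: "u \<in> borel_measurable borel"
    and u: "\<And>y. cmod y = 1 \<Longrightarrow> u y = Re (H y)" "\<And>y. cmod y = 1 \<Longrightarrow> 0 \<le> u y"
  shows "(\<integral>\<^sup>+y. ennreal (poisson a y * u y) \<partial>circle_measure) = ennreal (Re (H a))"
proof -
  have "((\<lambda>t. Re (poisson a (cis (2 * pi * t)) * H (cis (2 * pi * t)))) has_integral Re (H a)) {0..1}"
    by (intro has_integral_Re has_integral_poisson assms)
  then have "((\<lambda>t. poisson a (cis (2 * pi * t)) * u (cis (2 * pi * t))) has_integral Re (H a)) {0..1}"
    by (elim has_integral_eq[rotated]) (simp add: u)
  moreover have "0 \<le> poisson a (cis (2 * pi * t)) * u (cis (2 * pi * t))" for t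
    using poisson_nonneg[OF a] u by simp
  ultimately show ?thesis
    by (subst nn_integral_circle) (auto intro!: nn_integral_has_integral_lebesgue')
qed

text \<open>\<open>Re A * Re B\<close> is half the real part of \<open>A * B + cnj A * B\<close>,
  and on the circle \<open>cnj (z ^ j) * z ^ k = z ^ (k - j)\<close> for \<open>j \<le> k\<close>.
  Hence products never leave the real parts of polynomials.\<close>

lemma Re_poly_mult_circle:
  "\<exists>r. \<forall>z. cmod z = 1 \<longrightarrow> Re (poly p z) * Re (poly q z) = Re (poly r z)"
proof -
  let ?V = "{f. \<exists>r. \<forall>z. cmod z = 1 \<longrightarrow> f z = Re (poly r z)} :: (complex \<Rightarrow> real) set"
  have add: "(\<lambda>z. f z + h z) \<in> ?V" if "f \<in> ?V" "h \<in> ?V" for f h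
  proof -
    from that obtain r s where "\<forall>z. cmod z = 1 \<longrightarrow> f z = Re (poly r z)"
      "\<forall>z. cmod z = 1 \<longrightarrow> h z = Re (poly s z)" by auto
    then show ?thesis by (intro CollectI exI[of _ "r + s"]) simp
  qed
  have zero: "(\<lambda>z. 0) \<in> ?V"
    by (intro CollectI exI[of _ 0]) simp
  have sum: "(\<lambda>z. \<Sum>i\<in>A. F i z) \<in> ?V" if "finite A" "\<And>i. F i \<in> ?V" for A :: "nat set" and F
    using that(1)
  proof (induction A rule: finite_induct)
    case empty
    show ?case using zero by simp
  next
    case (insert x A)
    show ?case using add[OF that(2)[of x] insert.IH] insert.hyps by simp
  qed
  have mono: "(\<lambda>z. Re (c * z ^ j) * Re (d * z ^ k)) \<in> ?V" if "j \<le> k" for c d :: complex and j k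
  proof -
    have "Re (c * z ^ j) * Re (d * z ^ k) = Re (poly (monom (c * d / 2) (j + k) + monom (cnj c * d / 2) (k - j)) z)"
      if z: "cmod z = 1" for z
    proof -
      have "cnj z * z = 1" using z complex_norm_square[of z] by (simp add: mult.commute)
      then have "cnj (z ^ j) * z ^ j = 1"
        by (metis complex_cnj_power power_mult_distrib power_one)
      moreover have "z ^ k = z ^ j * z ^ (k - j)"
        using \<open>j \<le> k\<close> by (simp flip: power_add)
      ultimately have zk: "cnj (z ^ j) * z ^ k = z ^ (k - j)"
        by (metis mult.assoc mult_1)
      have "Re A * Re B = Re (A * B / 2 + cnj A * B / 2)" for A B
        by (simp add: field_simps)
      from this[of "c * z ^ j" "d * z ^ k"] have "Re (c * z ^ j) * Re (d * z ^ k)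
          = Re (c * z ^ j * (d * z ^ k) / 2 + cnj c * d * (cnj (z ^ j) * z ^ k) / 2)"
        by (simp only: complex_cnj_mult mult_ac)
      then show ?thesis
        unfolding zk by (simp add: poly_monom power_add mult_ac)
    qed
    then show ?thesis by blast
  qed
  have mono': "(\<lambda>z. Re (c * z ^ j) * Re (d * z ^ k)) \<in> ?V" for c d :: complex and j k
    using mono[of j k c d] mono[of k j d c] by (cases "j \<le> k") (simp_all add: mult.commute)
  have "(\<lambda>z. \<Sum>i\<le>degree p. \<Sum>j\<le>degree q. Re (coeff p i * z ^ i) * Re (coeff q j * z ^ j)) \<in> ?V"
    by (intro sum mono') auto
  moreover have "(\<Sum>i\<le>degree p. \<Sum>j\<le>degree q. Re (coeff p i * z ^ i) * Re (coeff q j * z ^ j)) =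
     Re (poly p z) * Re (poly q z)" for z
    unfolding poly_altdef Re_sum sum_product ..
  ultimately show ?thesis by simp
qed

text \<open>Stone-Weierstrass supplies a real polynomial in the two coordinates; the induction
  rewrites it on the circle as the real part of a complex polynomial, which extends holomorphically
  into the disc.\<close>

lemma dense_Re_poly_circle:
  fixes l :: "complex \<Rightarrow> real"
  assumes "continuous_on (sphere 0 1) l" "0 < e"
  obtains q where "\<And>z. cmod z = 1 \<Longrightarrow> \<bar>l z - Re (poly q z)\<bar> < e"
proof -
  have *: "\<exists>r. \<forall>z. cmod z = 1 \<longrightarrow> g z = Re (poly r z)" if "real_polynomial_function g" for g
    using that
  proof (induction rule: real_polynomial_function.induct)
    case (linear f)
    interpret bounded_linear f by fact
    \<comment> \<open>A real linear form is the real part of multiplication by a complex number; the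
      sign of the imaginary part comes from \<open>\<i> * \<i> = - 1\<close>.\<close>
    have "f z = Re (poly [:0, Complex (f 1) (- f \<i>):] z)" for z
    proof -
      have "f z = f (Re z *\<^sub>R 1 + Im z *\<^sub>R \<i>)"
        by (metis complex_eq mult.commute scaleR_conv_of_real mult.right_neutral)
      also have "\<dots> = Re z * f 1 + Im z * f \<i>"
        by (simp add: add scaleR)
      finally show ?thesis by simp
    qed
    then show ?case by blast
  next
    case (const c)
    show ?case by (intro exI[of _ "[:of_real c:]"]) simp
  next
    case (add f g)
    then obtain r s where "\<forall>z. cmod z = 1 \<longrightarrow> f z = Re (poly r z)"
      "\<forall>z. cmod z = 1 \<longrightarrow> g z = Re (poly s z)" by auto
    then show ?case by (intro exI[of _ "r + s"]) simp
  next
    case (mult f g)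
    then obtain r s where "\<forall>z. cmod z = 1 \<longrightarrow> f z = Re (poly r z)"
      "\<forall>z. cmod z = 1 \<longrightarrow> g z = Re (poly s z)" by auto
    then show ?case using Re_poly_mult_circle[of r s] by simp
  qed
  obtain g where "real_polynomial_function g" "\<And>x. x \<in> sphere 0 1 \<Longrightarrow> \<bar>l x - g x\<bar> < e"
    using Stone_Weierstrass_real_polynomial_function[OF compact_sphere assms] by blast
  moreover from this(1) obtain q where "\<forall>z. cmod z = 1 \<longrightarrow> g z = Re (poly q z)"
    using * by blast
  ultimately show ?thesis by (intro that[of q]) auto
qed

subsection \<open>A maximal inequality\<close>

text \<open>If \<open>a\<close> bounds the squared operator norm, then so does \<open>2 C sqrt a\<close>, by expanding the square of
  the norm of the adjoint; this halves any bound exceeding \<open>16 C\<^sup>2\<close>, and boundedness of the kernel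
  provides a finite bound to start from.\<close>

lemma maximal_operator_bound:
  fixes \<kappa> :: "'a \<Rightarrow> 'a \<Rightarrow> ennreal" and u :: "'a \<Rightarrow> ennreal"
  assumes "finite_measure M"
    and [measurable]: "case_prod \<kappa> \<in> borel_measurable (M \<Otimes>\<^sub>M M)"
    and bnd: "\<And>x y. \<kappa> x y \<le> ennreal B" and C: "0 < C"
    and comp: "\<And>x x'. x \<in> space M \<Longrightarrow> x' \<in> space M \<Longrightarrow>
      (\<integral>\<^sup>+y. \<kappa> x y * \<kappa> x' y \<partial>M) \<le> ennreal C * (\<kappa> x x' + \<kappa> x' x)"
    and u: "u \<in> borel_measurable M"
  shows "(\<integral>\<^sup>+x. (\<integral>\<^sup>+y. \<kappa> x y * u y \<partial>M)\<^sup>2 \<partial>M) \<le> ennreal (16 * C\<^sup>2) * (\<integral>\<^sup>+y. (u y)\<^sup>2 \<partial>M)"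
proof -
  interpret finite_measure M by fact
  interpret P: pair_sigma_finite M M ..
  define T where "T u x = (\<integral>\<^sup>+y. \<kappa> x y * u y \<partial>M)" for u x
  define valid where "valid a \<longleftrightarrow> (\<forall>u :: 'a \<Rightarrow> ennreal. u \<in> borel_measurable M \<longrightarrow>
      (\<integral>\<^sup>+x. (T u x)\<^sup>2 \<partial>M) \<le> ennreal a * (\<integral>\<^sup>+y. (u y)\<^sup>2 \<partial>M))" for a :: real
  have T_meas [measurable]: "T u \<in> borel_measurable M" if [measurable]: "u \<in> borel_measurable M" for u :: "'a \<Rightarrow> ennreal"
    unfolding T_def by measurable
  define m where "m = measure M (space M)"
  have m: "emeasure M (space M) = ennreal m"
    by (simp add: m_def emeasure_eq_measure)
  have mono: "valid b" if "valid a" "a \<le> b" for a b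
    using that unfolding valid_def by (meson order_trans mult_right_mono ennreal_leI zero_le)
  \<comment> \<open>Crude start: \<open>T u\<close> is at most \<open>max B 0\<close> times the
    integral of \<open>u\<close>, and Cauchy-Schwarz on the finite measure bounds its square. This
    value depends on \<open>B\<close>; the limit of the iteration does not.\<close>
  have valid0: "valid (m\<^sup>2 * (max B 0)\<^sup>2)"
    unfolding valid_def
  proof (intro allI impI)
    fix u :: "'a \<Rightarrow> ennreal" assume [measurable]: "u \<in> borel_measurable M"
    let ?B = "max B 0"
    have "T u x \<le> ennreal ?B * (\<integral>\<^sup>+y. u y \<partial>M)" for x
    proof -
      have "T u x \<le> (\<integral>\<^sup>+y. ennreal ?B * u y \<partial>M)"
        unfolding T_def
        by (intro nn_integral_mono mult_right_mono order_trans[OF bnd] ennreal_leI) auto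
      then show ?thesis by (simp add: nn_integral_cmult)
    qed
    then have "(T u x)\<^sup>2 \<le> ennreal (?B\<^sup>2) * (\<integral>\<^sup>+y. u y \<partial>M)\<^sup>2" for x
      using power_mono[of "T u x" "ennreal ?B * (\<integral>\<^sup>+y. u y \<partial>M)" 2]
      by (simp add: power_mult_distrib ennreal_power)
    moreover have "(\<integral>\<^sup>+y. u y \<partial>M)\<^sup>2 \<le> ennreal m * (\<integral>\<^sup>+y. (u y)\<^sup>2 \<partial>M)"
      using Cauchy_Schwarz_nn_integral[of "\<lambda>_. 1" M u] by (simp add: m)
    ultimately have "(T u x)\<^sup>2 \<le> ennreal (?B\<^sup>2) * (ennreal m * (\<integral>\<^sup>+y. (u y)\<^sup>2 \<partial>M))" for x
      by (meson order_trans mult_left_mono zero_le)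
    then have "(\<integral>\<^sup>+x. (T u x)\<^sup>2 \<partial>M) \<le> (\<integral>\<^sup>+x. ennreal (?B\<^sup>2) * (ennreal m * (\<integral>\<^sup>+y. (u y)\<^sup>2 \<partial>M)) \<partial>M)"
      by (intro nn_integral_mono)
    also have "\<dots> = ennreal (m\<^sup>2 * ?B\<^sup>2) * (\<integral>\<^sup>+y. (u y)\<^sup>2 \<partial>M)"
      by (simp add: m m_def ennreal_mult power2_eq_square mult_ac)
    finally show "(\<integral>\<^sup>+x. (T u x)\<^sup>2 \<partial>M) \<le> ennreal (m\<^sup>2 * ?B\<^sup>2) * (\<integral>\<^sup>+y. (u y)\<^sup>2 \<partial>M)" .
  qed
  have step: "valid (2 * C * sqrt a)" if a: "valid a" "0 < a" for a
    unfolding valid_def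
  proof (intro allI impI)
    fix u :: "'a \<Rightarrow> ennreal" assume [measurable]: "u \<in> borel_measurable M"
    define w where "w = T u"
    have [measurable]: "w \<in> borel_measurable M" by (simp add: w_def)
    \<comment> \<open>\<open>S\<close> is the adjoint applied to \<open>w = T u\<close>, so
      \<open>?W\<close> is the pairing of \<open>u\<close> with \<open>S\<close>. The hypothesis
      \<open>comp\<close> bounds the squared norm of \<open>S\<close> by \<open>2 * C * ?Q\<close>,
      where \<open>?Q\<close> pairs \<open>w\<close> with \<open>T w\<close>; the bound
      \<open>a\<close> is then used once more, on \<open>w\<close>.\<close>
    define S where "S y = (\<integral>\<^sup>+x. \<kappa> x y * w x \<partial>M)" for y
    have [measurable]: "S \<in> borel_measurable M" unfolding S_def by measurable
    let ?U = "\<integral>\<^sup>+y. (u y)\<^sup>2 \<partial>M" and ?W = "\<integral>\<^sup>+x. (w x)\<^sup>2 \<partial>M" and ?Q = "\<integral>\<^sup>+x. w x * T w x \<partial>M"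
    have "?W = (\<integral>\<^sup>+x. (\<integral>\<^sup>+y. w x * (\<kappa> x y * u y) \<partial>M) \<partial>M)"
      by (intro nn_integral_cong, subst nn_integral_cmult) (auto simp: power2_eq_square w_def T_def)
    also have "\<dots> = (\<integral>\<^sup>+y. (\<integral>\<^sup>+x. w x * (\<kappa> x y * u y) \<partial>M) \<partial>M)"
      by (rule P.Fubini') measurable
    also have "\<dots> = (\<integral>\<^sup>+y. u y * S y \<partial>M)"
      unfolding S_def
      by (intro nn_integral_cong, subst nn_integral_cmult[symmetric]) (auto simp: mult_ac intro!: nn_integral_cong)
    finally have W1: "?W\<^sup>2 \<le> ?U * (\<integral>\<^sup>+y. (S y)\<^sup>2 \<partial>M)"
      using Cauchy_Schwarz_nn_integral[of u M S] by simp
    have "(\<integral>\<^sup>+y. (S y)\<^sup>2 \<partial>M) = (\<integral>\<^sup>+y. (\<integral>\<^sup>+x. (\<integral>\<^sup>+x'. \<kappa> x y * w x * (\<kappa> x' y * w x') \<partial>M) \<partial>M) \<partial>M)"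
      unfolding S_def power2_eq_square
      by (intro nn_integral_cong)
         (auto simp: nn_integral_multc nn_integral_cmult simp del: nn_integral_const)
    also have "\<dots> = (\<integral>\<^sup>+x. (\<integral>\<^sup>+y. (\<integral>\<^sup>+x'. \<kappa> x y * w x * (\<kappa> x' y * w x') \<partial>M) \<partial>M) \<partial>M)"
      by (rule P.Fubini') measurable
    also have "\<dots> = (\<integral>\<^sup>+x. (\<integral>\<^sup>+x'. (\<integral>\<^sup>+y. \<kappa> x y * w x * (\<kappa> x' y * w x') \<partial>M) \<partial>M) \<partial>M)"
      by (intro nn_integral_cong P.Fubini') measurable
    also have "\<dots> = (\<integral>\<^sup>+x. (\<integral>\<^sup>+x'. w x * w x' * (\<integral>\<^sup>+y. \<kappa> x y * \<kappa> x' y \<partial>M) \<partial>M) \<partial>M)"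
      by (intro nn_integral_cong) (auto simp: mult_ac nn_integral_cmult[symmetric] intro!: nn_integral_cong)
    also have "\<dots> \<le> (\<integral>\<^sup>+x. (\<integral>\<^sup>+x'. w x * w x' * (ennreal C * (\<kappa> x x' + \<kappa> x' x)) \<partial>M) \<partial>M)"
      using comp by (intro nn_integral_mono mult_left_mono) auto
    also have "\<dots> = (\<integral>\<^sup>+x. (\<integral>\<^sup>+x'. ennreal C * (w x * (\<kappa> x x' * w x')) + ennreal C * (w x' * (\<kappa> x' x * w x)) \<partial>M) \<partial>M)"
      by (intro nn_integral_cong) (simp add: algebra_simps)
    also have "\<dots> = (\<integral>\<^sup>+x. (\<integral>\<^sup>+x'. ennreal C * (w x * (\<kappa> x x' * w x')) \<partial>M) \<partial>M)
        + (\<integral>\<^sup>+x. (\<integral>\<^sup>+x'. ennreal C * (w x' * (\<kappa> x' x * w x)) \<partial>M) \<partial>M)"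
      by (subst nn_integral_add[symmetric], measurable, intro nn_integral_cong nn_integral_add) auto
    also have "(\<integral>\<^sup>+x. (\<integral>\<^sup>+x'. ennreal C * (w x' * (\<kappa> x' x * w x)) \<partial>M) \<partial>M) =
        (\<integral>\<^sup>+x'. (\<integral>\<^sup>+x. ennreal C * (w x' * (\<kappa> x' x * w x)) \<partial>M) \<partial>M)"
      by (rule P.Fubini') measurable
    also have "(\<integral>\<^sup>+x. (\<integral>\<^sup>+x'. ennreal C * (w x * (\<kappa> x x' * w x')) \<partial>M) \<partial>M) = ennreal C * ?Q"
      by (subst nn_integral_cmult[symmetric], measurable, intro nn_integral_cong)
         (simp add: nn_integral_cmult T_def)
    finally have S1: "(\<integral>\<^sup>+y. (S y)\<^sup>2 \<partial>M) \<le> ennreal (2 * C) * ?Q"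
      using C by (simp add: ennreal_mult flip: mult_2 mult.assoc)
    have Q1: "?Q\<^sup>2 \<le> ?W * (ennreal a * ?W)"
      using Cauchy_Schwarz_nn_integral[of w M "T w"] a(1) \<open>w \<in> borel_measurable M\<close>
      unfolding valid_def by (meson T_meas mult_left_mono order_trans zero_le)
    show "(\<integral>\<^sup>+x. (T u x)\<^sup>2 \<partial>M) \<le> ennreal (2 * C * sqrt a) * (\<integral>\<^sup>+y. (u y)\<^sup>2 \<partial>M)"
    \<comment> \<open>A finite \<open>?U\<close> makes \<open>?W\<close> and \<open>?Q\<close>
      finite, which permits cancelling a factor \<open>W\<close>; an infinite \<open>?U\<close>
      makes the claim trivial, as \<open>2 * C * sqrt a\<close> is positive.\<close>
    proof (cases "?U = \<infinity>")
      case True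
      then show ?thesis using C a by (simp add: ennreal_mult_top)
    next
      case False
      then obtain U where U: "?U = ennreal U" "0 \<le> U" by (cases ?U) auto
      have "?W \<le> ennreal a * ?U"
        using a(1) unfolding valid_def w_def by auto
      then have "?W \<noteq> \<infinity>"
        using U by (auto simp: top_unique ennreal_mult_eq_top_iff)
      then obtain W where W: "?W = ennreal W" "0 \<le> W" by (cases ?W) auto
      have "?Q\<^sup>2 \<le> ennreal (a * W\<^sup>2)"
        using Q1 W a by (simp add: power2_eq_square mult_ac flip: ennreal_mult)
      then have "?Q\<^sup>2 < \<infinity>"
        using le_less_trans by fastforce
      then obtain Q where Q: "?Q = ennreal Q" "0 \<le> Q"
        by (cases ?Q) (auto simp: power2_eq_square ennreal_mult_top)
      have "Q\<^sup>2 \<le> a * W\<^sup>2"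
        using \<open>?Q\<^sup>2 \<le> ennreal (a * W\<^sup>2)\<close> Q W a by (simp add: ennreal_power)
      then have "Q\<^sup>2 \<le> (sqrt a * W)\<^sup>2"
        using a by (simp add: power_mult_distrib)
      then have QW: "Q \<le> sqrt a * W"
        by (rule power2_le_imp_le) (use a W in auto)
      have "?W\<^sup>2 \<le> ?U * (ennreal (2 * C) * ?Q)"
        using W1 S1 by (meson mult_left_mono order_trans zero_le)
      then have "W\<^sup>2 \<le> U * (2 * C * Q)"
        using C unfolding U Q W by (simp add: U Q W ennreal_power flip: ennreal_mult)
      also have "\<dots> \<le> U * (2 * C * (sqrt a * W))"
        using QW C U by (intro mult_left_mono) auto
      finally have "W * W \<le> W * (2 * C * sqrt a * U)"
        by (simp add: power2_eq_square mult_ac)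
      then have "W \<le> 2 * C * sqrt a * U"
        using W U C a by (cases "W = 0") auto
      then show ?thesis
        using W U C a by (simp add: w_def[symmetric] ennreal_leI flip: ennreal_mult)
    qed
  qed
  have "valid (16 * C\<^sup>2)"
  proof -
    define a0 where "a0 = max 1 (m\<^sup>2 * (max B 0)\<^sup>2)"
    have "valid (max (16 * C\<^sup>2) (a0 / 2 ^ k))" for k
    proof (induction k)
      case 0
      then show ?case using mono[OF valid0] by (simp add: a0_def)
    next
      case (Suc k)
      show ?case
      proof (cases "a0 / 2 ^ k \<le> 16 * C\<^sup>2")
        case True
        then show ?thesis using mono[OF Suc] by simp
      next
        case False
        define a where "a = a0 / 2 ^ k"
        have a: "valid a" "16 * C\<^sup>2 < a" using False Suc by (auto simp: a_def max_def)
        have a0: "0 < a" using a C by (smt (verit) zero_less_power)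
        have "(4 * C)\<^sup>2 \<le> a" using a by (simp add: power_mult_distrib)
        then have "4 * C \<le> sqrt a" using C by (intro real_le_rsqrt)
        then have "4 * C * sqrt a \<le> sqrt a * sqrt a"
          using a0 by (intro mult_right_mono) auto
        then have "2 * C * sqrt a \<le> a / 2" using a0 by simp
        with step[OF a(1) a0] have "valid (a / 2)" using mono by blast
        then show ?thesis by (rule mono) (simp add: a_def)
      qed
    qed
    moreover have "\<exists>k. a0 / 2 ^ k < 16 * C\<^sup>2"
    proof -
      have "(\<lambda>k. a0 / 2 ^ k) \<longlonglongrightarrow> 0" by (rule LIMSEQ_divide_realpow_zero) simp
      then have "eventually (\<lambda>k. a0 / 2 ^ k < 16 * C\<^sup>2) sequentially"
        by (rule order_tendstoD) (use C in auto)
      then show ?thesis by (auto simp: eventually_sequentially)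
    qed
    ultimately show ?thesis by (metis max.absorb1 less_imp_le)
  qed
  then show ?thesis using u by (simp add: valid_def T_def)
qed

text \<open>Two factors of 4. The numerators compare by \<open>1 - t \<le> 2 * (1 - t')\<close>; the
  distances compare up to 2 because \<open>t' - t \<le> 1 - t \<le> ?d\<close>, and they enter
  squared.\<close>

lemma poisson_harnack:
  assumes x: "cmod x = 1" and y: "cmod y = 1" and t: "0 \<le> t" "t \<le> t'" "t' < 1" "1 - t \<le> 2 * (1 - t')"
  shows "poisson (of_real t * x) y \<le> 16 * poisson (of_real t' * x) y"
proof -
  let ?d = "cmod (y - of_real t * x)" and ?d' = "cmod (y - of_real t' * x)"
  have n: "cmod (of_real s * x) = s" if "0 \<le> s" for s
    using that x by (simp add: norm_mult)
  have d: "1 - t \<le> ?d" and d': "1 - t' \<le> ?d'"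
    using norm_triangle_ineq2[of y "of_real t * x"] norm_triangle_ineq2[of y "of_real t' * x"] n t y by auto
  have "?d' \<le> ?d + cmod (of_real (t' - t) * x)"
    using norm_triangle_ineq4[of "y - of_real t * x" "of_real (t' - t) * x"] by (simp add: algebra_simps)
  also have "\<dots> \<le> 2 * ?d"
    using n[of "t' - t"] t d by simp
  finally have "?d'\<^sup>2 \<le> (2 * ?d)\<^sup>2"
    by (rule power_mono) simp
  then have D: "?d'\<^sup>2 \<le> 4 * ?d\<^sup>2"
    by (simp add: power_mult_distrib)
  have "1 - t\<^sup>2 \<le> 2 * (1 - t)"
    using zero_le_power2[of "1 - t"] by (simp add: power2_eq_square algebra_simps)
  also have "\<dots> \<le> 4 * (1 - t')" using t by simp
  also have "\<dots> \<le> 4 * (1 - t'\<^sup>2)"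
    using t mult_left_mono[of t' 1 t'] by (simp add: power2_eq_square)
  finally have N: "1 - t\<^sup>2 \<le> 4 * (1 - t'\<^sup>2)" .
  have pos: "0 < ?d\<^sup>2" "0 < ?d'\<^sup>2" using d d' t by (auto intro: zero_less_power)
  have "(1 - t\<^sup>2) * ?d'\<^sup>2 \<le> (4 * (1 - t'\<^sup>2)) * (4 * ?d\<^sup>2)"
    using N D t by (intro mult_mono) (auto simp: power_le_one)
  then show ?thesis
    unfolding poisson_def n[OF t(1)] n[OF order_trans[OF t(1,2)]]
    using pos by (simp add: field_simps)
qed

text \<open>Semigroup property of the Poisson kernel. On the circle \<open>poisson b\<close> is the
  real part of the Herglotz function \<open>H\<close>, holomorphic on the closed disc, so
  integrating against the other kernel evaluates \<open>Re H\<close> at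
  \<open>r * x\<close>.\<close>

lemma poisson_convolution:
  assumes x: "cmod x = 1" "cmod x' = 1" and r: "0 \<le> r" "r < 1" "0 \<le> r'" "r' < 1"
  shows "(\<integral>\<^sup>+y. ennreal (poisson (of_real r * x) y * poisson (of_real r' * x') y) \<partial>circle_measure)
    = ennreal (poisson (of_real (r * r') * x) x')"
proof -
  define b where "b = of_real r' * x'"
  have b: "cmod b = r'" using x r by (simp add: b_def norm_mult)
  define H where "H y = (1 + cnj b * y) / (1 - cnj b * y)" for y
  have nz: "1 - cnj b * z \<noteq> 0" if "cmod z \<le> 1" for z
  proof
    assume "1 - cnj b * z = 0"
    then have "cmod (cnj b * z) = 1" by (metis eq_iff_diff_eq_0 norm_one)
    moreover have "cmod (cnj b * z) \<le> cmod b * 1"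
      unfolding norm_mult using that by (intro mult_mono) auto
    ultimately show False using b r by simp
  qed
  have ReH: "Re (H z) = (1 - (cmod (b * z))\<^sup>2) / (cmod (1 - cnj b * z))\<^sup>2" for z
  proof -
    define w where "w = cnj b * z"
    have "Re ((1 + w) / (1 - w)) = (1 - (cmod w)\<^sup>2) / (cmod (1 - w))\<^sup>2"
      unfolding complex_div_cnj[of "1 + w"] Re_divide_of_real
      using cmod_power2[of w] by (simp add: power2_eq_square algebra_simps flip: of_real_power)
    moreover have "cmod w = cmod (b * z)" by (simp add: w_def norm_mult)
    ultimately show ?thesis by (simp add: H_def w_def)
  qed
  have "H holomorphic_on cball 0 1"
    unfolding H_def using nz by (intro holomorphic_intros) auto
  then have "(\<integral>\<^sup>+y. ennreal (poisson (of_real r * x) y * poisson b y) \<partial>circle_measure)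
      = ennreal (Re (H (of_real r * x)))"
  proof (rule nn_integral_poisson_Re)
    show "cmod (of_real r * x) < 1" using x r by (simp add: norm_mult)
    show "0 \<le> poisson b y" for y using b r by (intro poisson_nonneg) simp
    fix y assume y: "cmod y = 1"
    have "cmod (1 - cnj b * y) = cmod (cnj (1 - cnj b * y) * y)"
      using y by (simp only: norm_mult complex_mod_cnj)
    also have "cnj (1 - cnj b * y) * y = y - b * (y * cnj y)"
      by (simp add: algebra_simps)
    also have "y * cnj y = 1" using complex_norm_square[of y] y by simp
    finally show "poisson b y = Re (H y)"
      using y unfolding ReH poisson_def by (simp add: norm_mult)
  qed measurable
  also have "Re (H (of_real r * x)) = poisson (of_real (r * r') * x) x'"
  proof -
    let ?w = "1 - cnj b * (of_real r * x)"
    have "cmod ?w = cmod (x' * ?w)" using x by (simp add: norm_mult)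
    also have "x' * ?w = x' - of_real (r * r') * x * (x' * cnj x')"
      by (simp add: b_def algebra_simps)
    also have "x' * cnj x' = 1" using complex_norm_square[of x'] x by simp
    finally show ?thesis
      using x r unfolding ReH poisson_def by (simp add: norm_mult b mult.commute)
  qed
  finally show ?thesis by (simp add: b_def)
qed

text \<open>Choosing a radius at each point linearises the maximal operator. \<open>\<rho>\<close>
  serves to make the kernel bounded and does not enter the constant, which is
  \<open>16 * 16\<^sup>2\<close>.\<close>

lemma circle_selector_bound:
  fixes u :: "complex \<Rightarrow> ennreal" and r :: "complex \<Rightarrow> real"
  assumes [measurable]: "u \<in> borel_measurable borel" "r \<in> borel_measurable borel"
    and r: "\<And>x. 0 \<le> r x" "\<And>x. r x \<le> \<rho>" and "\<rho> < 1"
  shows "(\<integral>\<^sup>+x. (\<integral>\<^sup>+y. ennreal (poisson (of_real (r x) * x) y) * u y \<partial>circle_measure)\<^sup>2 \<partial>circle_measure)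
    \<le> ennreal 4096 * (\<integral>\<^sup>+y. (u y)\<^sup>2 \<partial>circle_measure)"
proof -
  \<comment> \<open>Cut to 0 off the circle because \<open>maximal_operator_bound\<close> asks for
    its hypotheses at every point of the space, here the whole plane.\<close>
  define \<kappa> where "\<kappa> x y = (if cmod x = 1 \<and> cmod y = 1 then ennreal (poisson (of_real (r x) * x) y) else 0)" for x y
  have [measurable]: "case_prod \<kappa> \<in> borel_measurable (borel \<Otimes>\<^sub>M borel)"
    unfolding \<kappa>_def by measurable
  have r1: "r x < 1" for x using r \<open>\<rho> < 1\<close> by (meson le_less_trans)
  have pn: "0 \<le> poisson (of_real (r x) * x) y" if "cmod x = 1" for x y
    using that r r1 by (intro poisson_nonneg) (simp add: norm_mult)
  have "(\<integral>\<^sup>+x. (\<integral>\<^sup>+y. \<kappa> x y * u y \<partial>circle_measure)\<^sup>2 \<partial>circle_measure)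
    \<le> ennreal (16 * 16\<^sup>2) * (\<integral>\<^sup>+y. (u y)\<^sup>2 \<partial>circle_measure)"
  proof (rule maximal_operator_bound)
    show "finite_measure circle_measure" by unfold_locales
    show "case_prod \<kappa> \<in> borel_measurable (circle_measure \<Otimes>\<^sub>M circle_measure)" by measurable
    show "\<kappa> x y \<le> ennreal (1 / (1 - \<rho>)\<^sup>2)" for x y
    proof (cases "cmod x = 1 \<and> cmod y = 1")
      case True
      have "1 - \<rho> \<le> cmod (y - of_real (r x) * x)"
        using norm_triangle_ineq2[of y "of_real (r x) * x"] True r[of x] by (simp add: norm_mult)
      then have "(1 - \<rho>)\<^sup>2 \<le> (cmod (y - of_real (r x) * x))\<^sup>2"
        using \<open>\<rho> < 1\<close> by (intro power_mono) auto
      then have "poisson (of_real (r x) * x) y \<le> 1 / (1 - \<rho>)\<^sup>2"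
        unfolding poisson_def using \<open>\<rho> < 1\<close> by (intro frac_le) auto
      then show ?thesis using True by (simp add: \<kappa>_def ennreal_leI)
    qed (auto simp: \<kappa>_def)
    show "(\<integral>\<^sup>+y. \<kappa> x y * \<kappa> x' y \<partial>circle_measure) \<le> ennreal 16 * (\<kappa> x x' + \<kappa> x' x)" for x x'
    proof (cases "cmod x = 1 \<and> cmod x' = 1")
      case True
      then have x: "cmod x = 1" "cmod x' = 1" by auto
      have "(\<integral>\<^sup>+y. \<kappa> x y * \<kappa> x' y \<partial>circle_measure)
        = (\<integral>\<^sup>+y. ennreal (poisson (of_real (r x) * x) y * poisson (of_real (r x') * x') y) \<partial>circle_measure)"
        using x pn by (intro nn_integral_circle_cong) (auto simp: \<kappa>_def ennreal_mult)
      also have "\<dots> = ennreal (poisson (of_real (r x * r x') * x) x')"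
        using x r r1 by (intro poisson_convolution) auto
      also have "\<dots> \<le> ennreal (16 * (poisson (of_real (r x) * x) x' + poisson (of_real (r x') * x') x))"
      proof (rule ennreal_leI)
        \<comment> \<open>Composition multiplies the radii. If \<open>r x\<close> is the smaller
          one, then \<open>1 - r x * r x' \<le> 1 - r x * r x \<le> 2 * (1 - r x)\<close>, so
          Harnack's inequality compares the radius \<open>r x * r x'\<close> with
          \<open>r x\<close>.\<close>
        have *: "poisson (of_real (r x * r x') * x) x' \<le> 16 * poisson (of_real (r x) * x) x'"
          if "r x \<le> r x'" "cmod x = 1" "cmod x' = 1" for x x'
        proof (rule poisson_harnack)
          show "r x * r x' \<le> r x" using r[of x] r1[of x'] by (simp add: mult_left_le)
          have "r x * r x \<le> r x * r x'" using r[of x] that by (intro mult_left_mono) auto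
          moreover have "1 - r x * r x \<le> 2 * (1 - r x)"
            using zero_le_square[of "1 - r x"] by (simp add: algebra_simps)
          ultimately show "1 - r x * r x' \<le> 2 * (1 - r x)" by simp
        qed (use that r r1 in auto)
        have sym: "poisson (of_real (r x * r x') * x) x' = poisson (of_real (r x' * r x) * x') x"
        proof -
          let ?t = "of_real (r x * r x')"
          have "(cmod (x' - ?t * x))\<^sup>2 = (cmod (x - ?t * x'))\<^sup>2"
          proof -
            have "(cmod (A - of_real t * B))\<^sup>2 = (cmod A)\<^sup>2 - 2 * t * (Re A * Re B + Im A * Im B) + t\<^sup>2 * (cmod B)\<^sup>2"
              for A B :: complex and t
              unfolding cmod_power2 by (simp add: power2_eq_square algebra_simps)
            then show ?thesis using x by (simp only:) (simp add: algebra_simps)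
          qed
          then show ?thesis using x by (simp add: poisson_def norm_mult mult.commute)
        qed
        show "poisson (of_real (r x * r x') * x) x' \<le>
          16 * (poisson (of_real (r x) * x) x' + poisson (of_real (r x') * x') x)"
        proof (cases "r x \<le> r x'")
          case True
          then show ?thesis using *[OF _ x] pn[of x' x] x by fastforce
        next
          case False
          then show ?thesis using *[of x' x] pn[of x x'] x unfolding sym by fastforce
        qed
      qed
      also have "\<dots> = ennreal 16 * (\<kappa> x x' + \<kappa> x' x)"
        using x pn by (simp add: \<kappa>_def ennreal_mult)
      finally show ?thesis .
    next
      case False
      then have "(\<lambda>y. \<kappa> x y * \<kappa> x' y) = (\<lambda>_. 0)" by (auto simp: \<kappa>_def)
      then show ?thesis by simp
    qed
  qed simp_all
  moreover have "(\<integral>\<^sup>+x. (\<integral>\<^sup>+y. \<kappa> x y * u y \<partial>circle_measure)\<^sup>2 \<partial>circle_measure) =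
    (\<integral>\<^sup>+x. (\<integral>\<^sup>+y. ennreal (poisson (of_real (r x) * x) y) * u y \<partial>circle_measure)\<^sup>2 \<partial>circle_measure)"
    by (intro nn_integral_circle_cong arg_cong2[of _ _ _ _ power]) (auto simp: \<kappa>_def intro!: nn_integral_circle_cong)
  ultimately show ?thesis by simp
qed

text \<open>The radial Poisson maximal function, restricted to finitely many dyadic radii so that
  the maximum is attained and the radius can be selected measurably. Harnack's inequality covers the
  radii in between.\<close>

definition poisson_max :: "nat \<Rightarrow> (complex \<Rightarrow> ennreal) \<Rightarrow> complex \<Rightarrow> ennreal" where
  "poisson_max J u x = Max ((\<lambda>j. \<integral>\<^sup>+y. ennreal (poisson (of_real (1 - 1 / 2 ^ j) * x) y) * u y \<partial>circle_measure) ` {..J})"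

text \<open>The least index attaining the maximum is a measurable selector, with radii at most
  \<open>1 - 1 / 2 ^ J\<close>. Since the selector bound ignores that maximal radius, the constant
  is the same for every \<open>J\<close>.\<close>

theorem circle_maximal:
  fixes u :: "complex \<Rightarrow> ennreal"
  assumes [measurable]: "u \<in> borel_measurable borel"
  shows "(\<integral>\<^sup>+x. (poisson_max J u x)\<^sup>2 \<partial>circle_measure) \<le> ennreal 4096 * (\<integral>\<^sup>+y. (u y)\<^sup>2 \<partial>circle_measure)"
proof -
  define v where "v j x = (\<integral>\<^sup>+y. ennreal (poisson (of_real (1 - 1 / 2 ^ j) * x) y) * u y \<partial>circle_measure)" for j :: nat and x :: complex
  have [measurable]: "v j \<in> borel_measurable borel" for j
    unfolding v_def by measurable
  have pm: "poisson_max J u x = Max ((\<lambda>j. v j x) ` {..J})" for x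
    by (simp add: poisson_max_def v_def)
  have [measurable]: "poisson_max J u \<in> borel_measurable borel"
    unfolding pm by measurable
  define j where "j x = (LEAST j. v j x = poisson_max J u x)" for x
  have ex: "\<exists>j\<le>J. v j x = poisson_max J u x" for x
  proof -
    have "Max ((\<lambda>j. v j x) ` {..J}) \<in> (\<lambda>j. v j x) ` {..J}"
      by (intro Max_in) auto
    then obtain i where "i \<le> J" "Max ((\<lambda>j. v j x) ` {..J}) = v i x" by (elim imageE) auto
    then show ?thesis unfolding pm by metis
  qed
  have j: "v (j x) x = poisson_max J u x" "j x \<le> J" for x
    unfolding j_def using ex[of x] by (auto intro: LeastI Least_le[THEN order_trans])
  have [measurable]: "j \<in> measurable borel (count_space UNIV)"
    unfolding j_def by measurable
  define r :: "complex \<Rightarrow> real" where "r x = 1 - 1 / 2 ^ j x" for x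
  have "(\<integral>\<^sup>+x. (\<integral>\<^sup>+y. ennreal (poisson (of_real (r x) * x) y) * u y \<partial>circle_measure)\<^sup>2 \<partial>circle_measure)
    \<le> ennreal 4096 * (\<integral>\<^sup>+y. (u y)\<^sup>2 \<partial>circle_measure)"
  proof (rule circle_selector_bound[where \<rho> = "1 - 1 / 2 ^ J"])
    show "r \<in> borel_measurable borel" unfolding r_def by measurable
    show "0 \<le> r x" "r x \<le> 1 - 1 / 2 ^ J" for x
      using j(2)[of x] by (auto simp: r_def field_simps power_increasing)
  qed simp_all
  then show ?thesis
    unfolding r_def v_def[symmetric] j(1) .
qed

text \<open>Zeros of \<open>h\<close> need not be divided out: approximate \<open>ln (\<bar>h\<bar> + e)\<close> on the circle by the real part
  of a polynomial \<open>q\<close>, apply the maximum principle to \<open>h exp (- q)\<close> and the Poisson formula to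
  \<open>exp (s q)\<close>.\<close>

theorem holomorphic_powr_le_poisson:
  assumes h: "h holomorphic_on cball 0 1" and s: "0 < s" and a: "cmod a < 1"
    and [measurable]: "u \<in> borel_measurable borel"
    and u: "\<And>y. cmod y = 1 \<Longrightarrow> u y = ennreal (cmod (h y) powr s)"
  shows "ennreal (cmod (h a) powr s) \<le> (\<integral>\<^sup>+y. ennreal (poisson a y) * u y \<partial>circle_measure)"
proof -
  define c where "c t = cis (2 * pi * t)" for t
  have c [simp]: "cmod (c t) = 1" for t by (simp add: c_def)
  have cont_c: "continuous_on A c" for A
    unfolding c_def by (intro continuous_intros)
  have cont_h: "continuous_on (cball 0 1) h"
    using h by (rule holomorphic_on_imp_continuous_on)
  have cont_hc: "continuous_on A (\<lambda>t. h (c t))" for A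
    using cont_c by (intro continuous_on_compose2[OF cont_h]) auto
  have ya: "y \<noteq> a" if "cmod y = 1" for y using that a by auto
  have cont_p: "continuous_on A (\<lambda>t. poisson a (c t))" for A
    unfolding poisson_def using ya cont_c by (intro continuous_intros) auto
  \<comment> \<open>\<open>I\<close> is continuous up to \<open>e = 0\<close>, where it becomes the
    Poisson integral of \<open>|h| powr s\<close>; the proof ends by letting \<open>e\<close>
    decrease to 0.\<close>
  define I where "I e = integral (cbox 0 1) (\<lambda>t. poisson a (c t) * (cmod (h (c t)) + e) powr s)" for e
  have cont2: "continuous_on ({0..1} \<times> cbox 0 1) (\<lambda>(e, t). poisson a (c t) * (cmod (h (c t)) + e) powr s)"
    unfolding split_beta
    using s by (intro continuous_intros continuous_on_powr' continuous_on_compose2[OF cont_p]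
      continuous_on_compose2[OF cont_hc]) (auto intro: continuous_on_fst continuous_on_snd)
  have cont_I: "continuous_on {0..1} I"
    unfolding I_def by (rule integral_continuous_on_param[OF cont2])
  \<comment> \<open>Each factor \<open>exp (s * e)\<close> pays for one use of \<open>q\<close>: in
    the maximum principle for \<open>h * exp (- q)\<close>, and in returning from
    \<open>exp (s * Re q)\<close> to \<open>(|h| + e) powr s\<close> on the circle.\<close>
  have key: "cmod (h a) powr s \<le> exp (2 * s * e) * I e" if e: "0 < e" "e \<le> 1" for e
  proof -
    have pos: "0 < cmod (h y) + e" for y using e by (simp add: add_nonneg_pos)
    then have ne: "cmod (h y) + e \<noteq> 0" for y by (metis less_irrefl)
    have "continuous_on (sphere 0 1) (\<lambda>y. ln (cmod (h y) + e))"
      using e by (intro continuous_intros continuous_on_subset[OF cont_h]) (auto simp: ne)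
    then obtain q where q: "\<And>y. cmod y = 1 \<Longrightarrow> \<bar>ln (cmod (h y) + e) - Re (poly q y)\<bar> < e"
      using dense_Re_poly_circle e(1) by metis
    have "cmod (h a * exp (- poly q a)) \<le> exp e"
    proof (rule maximum_modulus_frontier[where S = "cball 0 1" and f = "\<lambda>a. h a * exp (- poly q a)" and \<xi> = a])
      show "(\<lambda>a. h a * exp (- poly q a)) holomorphic_on interior (cball 0 1)"
        by (intro holomorphic_intros holomorphic_on_subset[OF h]) auto
      show "continuous_on (closure (cball 0 1)) (\<lambda>a. h a * exp (- poly q a))"
        by (simp, intro continuous_intros cont_h)
      fix z :: complex assume "z \<in> frontier (cball 0 1)"
      then have z: "cmod z = 1" by simp
      have "cmod (h z * exp (- poly q z)) \<le> (cmod (h z) + e) * exp (- Re (poly q z))"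
        using e by (simp add: norm_mult)
      also have "\<dots> = exp (ln (cmod (h z) + e) - Re (poly q z))"
        using pos[of z] by (simp add: exp_diff exp_minus divide_inverse)
      also have "\<dots> \<le> exp e" using q[OF z] by simp
      finally show "cmod (h z * exp (- poly q z)) \<le> exp e" .
    qed (use a in auto)
    then have "cmod (h a) \<le> exp e * exp (Re (poly q a))"
      by (simp add: exp_minus norm_divide field_simps)
    then have "cmod (h a) powr s \<le> (exp e * exp (Re (poly q a))) powr s"
      using s by (intro powr_mono2) auto
    also have "\<dots> = exp (s * e) * cmod (exp (s * poly q a))"
      by (simp add: powr_def algebra_simps flip: exp_add)
    finally have 1: "cmod (h a) powr s \<le> exp (s * e) * cmod (exp (s * poly q a))" .
    have hi: "((\<lambda>t. poisson a (c t) * exp (s * poly q (c t))) has_integral exp (s * poly q a)) {0..1}"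
      unfolding c_def by (rule has_integral_poisson[OF _ a]) (intro holomorphic_intros)
    have "cmod (integral {0..1} (\<lambda>t. poisson a (c t) * exp (s * poly q (c t)))) \<le>
      integral {0..1} (\<lambda>t. exp (s * e) * (poisson a (c t) * (cmod (h (c t)) + e) powr s))"
    proof (rule integral_norm_bound_integral)
      show "(\<lambda>t. poisson a (c t) * exp (s * poly q (c t))) integrable_on {0..1}"
        using hi by blast
      show "(\<lambda>t. exp (s * e) * (poisson a (c t) * (cmod (h (c t)) + e) powr s)) integrable_on {0..1}"
        using ne by (intro integrable_continuous_interval continuous_intros cont_p cont_hc) auto
      fix t :: real
      have "exp (s * Re (poly q (c t))) \<le> exp (s * (e + ln (cmod (h (c t)) + e)))"
        using q[of "c t"] s by simp
      also have "\<dots> = exp (s * e) * (cmod (h (c t)) + e) powr s"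
        using pos[of "c t"] by (simp add: powr_def exp_add algebra_simps)
      finally have "poisson a (c t) * exp (s * Re (poly q (c t))) \<le>
          poisson a (c t) * (exp (s * e) * (cmod (h (c t)) + e) powr s)"
        by (intro mult_left_mono poisson_nonneg a)
      then show "cmod (poisson a (c t) * exp (s * poly q (c t))) \<le>
          exp (s * e) * (poisson a (c t) * (cmod (h (c t)) + e) powr s)"
        using poisson_nonneg[OF a, of "c t"] by (simp add: norm_mult mult_ac)
    qed
    then have 2: "cmod (exp (s * poly q a)) \<le> exp (s * e) * I e"
      unfolding integral_unique[OF hi] I_def by simp
    have "cmod (h a) powr s \<le> exp (s * e) * (exp (s * e) * I e)"
      using 1 2 by (meson exp_ge_zero mult_left_mono order_trans)
    then show ?thesis by (simp add: exp_add[symmetric] mult.assoc[symmetric] mult.commute[of e s])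
  qed
  have "((\<lambda>e. exp (2 * s * e) * I e) \<longlongrightarrow> exp (2 * s * 0) * I 0) (at 0 within {0..1})"
    using cont_I by (intro tendsto_intros) (auto simp: continuous_on_def)
  moreover have "eventually (\<lambda>e. cmod (h a) powr s \<le> exp (2 * s * e) * I e) (at 0 within {0..1})"
    using key by (auto simp: eventually_at_filter intro!: always_eventually)
  moreover have "at (0::real) within {0..1} \<noteq> bot"
    by (simp add: trivial_limit_within islimpt_Icc)
  ultimately have "cmod (h a) powr s \<le> I 0"
    using tendsto_lowerbound by fastforce
  moreover have "(\<integral>\<^sup>+y. ennreal (poisson a y) * u y \<partial>circle_measure) = ennreal (I 0)"
  proof -
    have "(\<integral>\<^sup>+y. ennreal (poisson a y) * u y \<partial>circle_measure) =
      (\<integral>\<^sup>+t. ennreal (poisson a (c t) * cmod (h (c t)) powr s) * indicator {0..1} t \<partial>lborel)"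
      using poisson_nonneg[OF a] unfolding c_def
      by (subst nn_integral_circle) (auto simp: u ennreal_mult intro!: nn_integral_cong)
    also have "\<dots> = ennreal (I 0)"
    proof (rule nn_integral_has_integral_lebesgue')
      show "0 \<le> poisson a (c t) * cmod (h (c t)) powr s" for t
        using poisson_nonneg[OF a] by simp
      have "(\<lambda>t. poisson a (c t) * cmod (h (c t)) powr s) integrable_on {0..1}"
        using s by (intro integrable_continuous_interval continuous_intros cont_p continuous_on_powr' cont_hc) auto
      then show "((\<lambda>t. poisson a (c t) * cmod (h (c t)) powr s) has_integral I 0) {0..1}"
        unfolding I_def by (simp add: has_integral_integral)
    qed
    finally show ?thesis .
  qed
  ultimately show ?thesis by (simp add: ennreal_leI)
qed

text \<open>Let \<open>j\<close> be the least index with \<open>t \<le> 1 - 1 / 2 ^ j\<close>.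
  Minimality says that \<open>1 - t\<close> is at most twice \<open>1 / 2 ^ j\<close>, so the
  Poisson kernel at \<open>t\<close> costs a factor 16 over the one at the dyadic radius.\<close>

lemma holomorphic_powr_le_poisson_max:
  assumes h: "h holomorphic_on cball 0 1" and s: "0 < s" and x: "cmod x = 1"
    and t: "0 \<le> t" "t \<le> 1 - 1 / 2 ^ J"
    and [measurable]: "u \<in> borel_measurable borel"
    and u: "\<And>y. cmod y = 1 \<Longrightarrow> u y = ennreal (cmod (h y) powr s)"
  shows "ennreal (cmod (h (of_real t * x)) powr s) \<le> 16 * poisson_max J u x"
proof -
  define j where "j = (LEAST j. t \<le> 1 - 1 / 2 ^ j)"
  have j: "t \<le> 1 - 1 / 2 ^ j" unfolding j_def using t(2) by (rule LeastI)
  have "j \<le> J" unfolding j_def using t(2) by (rule Least_le)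
  have j2: "1 - t \<le> 2 * (1 - (1 - 1 / 2 ^ j))"
  proof (cases j)
    case 0
    then show ?thesis using t by simp
  next
    case (Suc i)
    then have "\<not> t \<le> 1 - 1 / 2 ^ i"
      using not_less_Least[of i "\<lambda>j. t \<le> 1 - 1 / 2 ^ j"] unfolding j_def by simp
    then show ?thesis using Suc by simp
  qed
  have t1: "t < 1" using j by (smt (verit) divide_pos_pos zero_less_power)
  have "ennreal (cmod (h (of_real t * x)) powr s) \<le>
      (\<integral>\<^sup>+y. ennreal (poisson (of_real t * x) y) * u y \<partial>circle_measure)"
    using x t t1 by (intro holomorphic_powr_le_poisson h s u) (auto simp: norm_mult)
  also have "\<dots> \<le> (\<integral>\<^sup>+y. 16 * (ennreal (poisson (of_real (1 - 1 / 2 ^ j) * x) y) * u y) \<partial>circle_measure)"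
  proof (rule nn_integral_circle_mono)
    fix y :: complex assume y: "cmod y = 1"
    have "poisson (of_real t * x) y \<le> 16 * poisson (of_real (1 - 1 / 2 ^ j) * x) y"
      using x y t j j2 by (intro poisson_harnack) auto
    then have "ennreal (poisson (of_real t * x) y) \<le> 16 * ennreal (poisson (of_real (1 - 1 / 2 ^ j) * x) y)"
      by (metis ennreal_leI ennreal_mult' ennreal_numeral zero_le_numeral)
    then show "ennreal (poisson (of_real t * x) y) * u y \<le> 16 * (ennreal (poisson (of_real (1 - 1 / 2 ^ j) * x) y) * u y)"
      by (metis mult.assoc mult_right_mono zero_le)
  qed measurable
  also have "\<dots> = 16 * (\<integral>\<^sup>+y. ennreal (poisson (of_real (1 - 1 / 2 ^ j) * x) y) * u y \<partial>circle_measure)"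
    by (rule nn_integral_cmult) measurable
  also have "\<dots> \<le> 16 * poisson_max J u x"
    unfolding poisson_max_def using \<open>j \<le> J\<close> by (intro mult_left_mono Max_ge) auto
  finally show ?thesis .
qed

subsection \<open>Holomorphic functions of several variables\<close>

lemma norm_vec_mono:
  fixes x :: "'a::real_normed_vector ^ 'n" and y :: "'b::real_normed_vector ^ 'n"
  assumes "\<And>i. norm (x $ i) \<le> norm (y $ i)"
  shows "norm x \<le> norm y"
  unfolding norm_vec_def by (intro L2_set_mono assms) simp

lemma norm_axis [simp]: "norm (axis k w :: 'a::real_normed_vector ^ 'n) = norm w"
proof -
  have "L2_set (\<lambda>i. norm (axis k w $ i)) UNIV = sqrt ((norm w)\<^sup>2)"
    unfolding L2_set_def axis_def
    by (simp add: if_distrib[of norm] if_distrib[of "\<lambda>x. x\<^sup>2"] cong: if_cong)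
  then show ?thesis by (simp add: norm_vec_def)
qed

lemma norm_vector_smult_complex [simp]: "norm (c *s (v :: complex ^ 'n)) = cmod c * norm v"
  unfolding norm_vec_def by (simp add: norm_mult L2_set_right_distrib)

lemma bounded_linear_axis: "bounded_linear (axis k :: 'a::real_normed_vector \<Rightarrow> 'a ^ 'n)"
  by (intro bounded_linear_intro[where K = 1]) (simp_all add: vec_eq_iff, simp_all add: axis_def)

lemma bounded_linear_smult_left: "bounded_linear (\<lambda>c :: complex. c *s (v :: complex ^ 'n))"
  by (intro bounded_linear_intro[where K = "norm v"]) (auto simp: vec_eq_iff algebra_simps)

lemma vec_expansion_axis: "(v :: complex ^ 'n) = (\<Sum>k\<in>UNIV. v $ k *s axis k 1)"
  by (simp add: vec_eq_iff axis_def if_distrib cong: if_cong)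

lemma axis_eq_smult: "(axis k w :: complex ^ 'n) = w *s axis k 1"
  by (simp add: vec_eq_iff axis_def)

lemma scaleR_eq_smult: "r *\<^sub>R (v :: complex ^ 'n) = of_real r *s v"
  by (simp add: vec_eq_iff) (simp add: scaleR_conv_of_real)

lemma holomorphic_vec_iff_at:
  assumes "open S"
  shows "f holomorphic_vec_on S \<longleftrightarrow>
    (\<forall>z\<in>S. \<exists>D. (f has_derivative D) (at z) \<and> (\<forall>c v. D (c *s v) = c * D v))"
  unfolding holomorphic_vec_on_def
  by (intro ball_cong refl) (simp add: at_within_open[OF _ assms])

lemma holomorphic_vec_imp_continuous_on: "f holomorphic_vec_on S \<Longrightarrow> continuous_on S f"
  unfolding holomorphic_vec_on_def continuous_on_eq_continuous_within
  using has_derivative_continuous by blast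

lemma holomorphic_vec_cong: "(\<And>z. z \<in> S \<Longrightarrow> f z = g z) \<Longrightarrow> f holomorphic_vec_on S \<longleftrightarrow> g holomorphic_vec_on S"
  unfolding holomorphic_vec_on_def
  by (intro ball_cong refl) (metis (mono_tags, lifting) has_derivative_transform)

lemma holomorphic_vec_local:
  assumes "open S" and "\<And>z. z \<in> S \<Longrightarrow> \<exists>T. open T \<and> z \<in> T \<and> f holomorphic_vec_on T"
  shows "f holomorphic_vec_on S"
  unfolding holomorphic_vec_iff_at[OF assms(1)] using assms(2) holomorphic_vec_iff_at by metis

section \<open>Closure properties of holomorphy\<close>

lemma holomorphic_vec_const: "(\<lambda>z. c) holomorphic_vec_on S"
  unfolding holomorphic_vec_on_def by (auto intro!: exI[of _ "\<lambda>_. 0"])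

lemma holomorphic_vec_component: "(\<lambda>z. z $ k) holomorphic_vec_on S"
  unfolding holomorphic_vec_on_def
  by (intro ballI exI[of _ "\<lambda>z. z $ k"]) (auto intro!: bounded_linear_imp_has_derivative bounded_linear_vec_nth)

lemma holomorphic_vec_add:
  assumes "f holomorphic_vec_on S" "g holomorphic_vec_on S"
  shows "(\<lambda>z. f z + g z) holomorphic_vec_on S"
  unfolding holomorphic_vec_on_def
proof
  fix z assume "z \<in> S"
  with assms obtain D E where "(f has_derivative D) (at z within S)" "(g has_derivative E) (at z within S)"
    and "\<And>c v. D (c *s v) = c * D v" "\<And>c v. E (c *s v) = c * E v"
    unfolding holomorphic_vec_on_def by meson
  then show "\<exists>D. ((\<lambda>z. f z + g z) has_derivative D) (at z within S) \<and> (\<forall>c v. D (c *s v) = c * D v)"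
    by (intro exI[of _ "\<lambda>v. D v + E v"]) (auto intro: has_derivative_add simp: distrib_left)
qed

lemma holomorphic_vec_mult:
  assumes "f holomorphic_vec_on S" "g holomorphic_vec_on S"
  shows "(\<lambda>z. f z * g z) holomorphic_vec_on S"
  unfolding holomorphic_vec_on_def
proof
  fix z assume "z \<in> S"
  with assms obtain D E where "(f has_derivative D) (at z within S)" "(g has_derivative E) (at z within S)"
    and "\<And>c v. D (c *s v) = c * D v" "\<And>c v. E (c *s v) = c * E v"
    unfolding holomorphic_vec_on_def by meson
  then show "\<exists>D. ((\<lambda>z. f z * g z) has_derivative D) (at z within S) \<and> (\<forall>c v. D (c *s v) = c * D v)"
    by (intro exI[of _ "\<lambda>v. f z * E v + D v * g z"] conjI has_derivative_mult) (auto simp: algebra_simps)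
qed

lemma holomorphic_vec_diff:
  assumes "f holomorphic_vec_on S" "g holomorphic_vec_on S"
  shows "(\<lambda>z. f z - g z) holomorphic_vec_on S"
  using holomorphic_vec_add[OF assms(1) holomorphic_vec_mult[OF holomorphic_vec_const[of "-1"] assms(2)]] by simp

lemma holomorphic_vec_sum:
  assumes "\<And>k. k \<in> A \<Longrightarrow> f k holomorphic_vec_on S"
  shows "(\<lambda>z. \<Sum>k\<in>A. f k z) holomorphic_vec_on S"
  using assms by (induction A rule: infinite_finite_induct) (auto intro: holomorphic_vec_const holomorphic_vec_add)

lemma holomorphic_vec_compose_holomorphic:
  assumes "f holomorphic_vec_on S" "\<phi> holomorphic_on T" "open T" "f ` S \<subseteq> T"
  shows "(\<lambda>z. \<phi> (f z)) holomorphic_vec_on S"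
  unfolding holomorphic_vec_on_def
proof
  fix z assume z: "z \<in> S"
  with assms obtain D where D: "(f has_derivative D) (at z within S)" "\<And>c v. D (c *s v) = c * D v"
    unfolding holomorphic_vec_on_def by meson
  have "(\<phi> has_field_derivative deriv \<phi> (f z)) (at (f z))"
    using assms z by (intro holomorphic_derivI[where S = T]) auto
  then have "((\<lambda>z. \<phi> (f z)) has_derivative (\<lambda>v. deriv \<phi> (f z) * D v)) (at z within S)"
    using D(1) unfolding has_field_derivative_def by (rule has_derivative_compose[rotated])
  then show "\<exists>D. ((\<lambda>z. \<phi> (f z)) has_derivative D) (at z within S) \<and> (\<forall>c v. D (c *s v) = c * D v)"
    using D(2) by (intro exI[of _ "\<lambda>v. deriv \<phi> (f z) * D v"]) (auto simp: algebra_simps)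
qed

lemma holomorphic_vec_compose_linear:
  assumes "f holomorphic_vec_on S" and L: "bounded_linear L" "\<And>c v. L (c *s v) = c *s L v"
    and "(\<lambda>z. a + L z) ` T \<subseteq> S"
  shows "(\<lambda>z. f (a + L z)) holomorphic_vec_on T"
  unfolding holomorphic_vec_on_def
proof
  fix z assume z: "z \<in> T"
  then have "a + L z \<in> S" using assms(4) by auto
  with assms(1) obtain D where D: "(f has_derivative D) (at (a + L z) within S)" "\<And>c v. D (c *s v) = c * D v"
    unfolding holomorphic_vec_on_def by blast
  have "((\<lambda>z. a + L z) has_derivative (\<lambda>v. 0 + L v)) (at z within T)"
    by (intro has_derivative_add has_derivative_const bounded_linear_imp_has_derivative L)
  from diff_chain_within[OF this has_derivative_subset[OF D(1) assms(4)]]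
  have "((\<lambda>z. f (a + L z)) has_derivative (\<lambda>v. D (L v))) (at z within T)"
    by (simp add: o_def)
  then show "\<exists>D. ((\<lambda>z. f (a + L z)) has_derivative D) (at z within T) \<and> (\<forall>c v. D (c *s v) = c * D v)"
    using D(2) L(2) by (intro exI[of _ "\<lambda>v. D (L v)"]) auto
qed

section \<open>Partial derivatives and restriction to complex lines\<close>

lemma holomorphic_vec_has_derivative:
  assumes "f holomorphic_vec_on S" "open S" "z \<in> S"
  shows "(f has_derivative (\<lambda>v. \<Sum>k\<in>UNIV. v $ k * partial_deriv k f z)) (at z)"
proof -
  obtain D where D: "(f has_derivative D) (at z)" "\<And>c v. D (c *s v) = c * D v"
    using assms holomorphic_vec_iff_at by blast
  interpret D: bounded_linear D using D(1) by (rule has_derivative_bounded_linear)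
  \<comment> \<open>Complex linearity determines \<open>D\<close> by its values on the unit vectors,
    and these are one-variable derivatives along coordinate lines.\<close>
  have "D (axis k 1) = partial_deriv k f z" for k
  proof -
    have e: "(\<chi> j. if j = k then w else z $ j) = z + axis k (w - z $ k)" for w
      by (simp add: vec_eq_iff axis_def)
    have "((\<lambda>w. z + axis k (w - z $ k)) has_derivative (\<lambda>w. 0 + axis k (w - 0))) (at (z $ k))"
      by (intro has_derivative_add has_derivative_const has_derivative_diff has_derivative_ident
          bounded_linear.has_derivative[OF bounded_linear_axis])
    moreover have "(f has_derivative D) (at (z + axis k (z $ k - z $ k)))"
      using D(1) by (simp add: axis_def zero_vec_def[symmetric] cong: if_cong)
    ultimately have "((\<lambda>w. f (z + axis k (w - z $ k))) has_derivative (\<lambda>w. D (0 + axis k (w - 0)))) (at (z $ k))"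
      using has_derivative_compose by blast
    moreover have "(\<lambda>w. D (0 + axis k (w - 0))) = (*) (D (axis k 1))"
    proof
      show "D (0 + axis k (w - 0)) = D (axis k 1) * w" for w
        using D(2)[of w "axis k 1"] axis_eq_smult[of k w] by simp
    qed
    ultimately have "((\<lambda>w. f (z + axis k (w - z $ k))) has_field_derivative D (axis k 1)) (at (z $ k))"
      by (simp only: has_field_derivative_def)
    then show ?thesis
      unfolding partial_deriv_def e by (simp add: DERIV_imp_deriv)
  qed
  then have "D v = (\<Sum>k\<in>UNIV. v $ k * partial_deriv k f z)" for v
    using arg_cong[OF vec_expansion_axis[of v], of D] by (simp add: D.sum D(2))
  then have "D = (\<lambda>v. \<Sum>k\<in>UNIV. v $ k * partial_deriv k f z)" by auto
  with D(1) show ?thesis by simp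
qed

text \<open>The bridge to one-variable theory: along complex lines Cauchy estimates, the maximum
  principle and the Poisson inequality become available.\<close>

lemma holomorphic_vec_line_derivative:
  assumes "f holomorphic_vec_on S" "open S" "a + w *s v \<in> S"
  shows "((\<lambda>w. f (a + w *s v)) has_field_derivative (\<Sum>k\<in>UNIV. v $ k * partial_deriv k f (a + w *s v))) (at w)"
proof -
  have "((\<lambda>w. a + w *s v) has_derivative (\<lambda>w. 0 + w *s v)) (at w)"
    by (intro has_derivative_add has_derivative_const bounded_linear_imp_has_derivative bounded_linear_smult_left)
  from has_derivative_compose[OF this holomorphic_vec_has_derivative[OF assms]]
  have "((\<lambda>w. f (a + w *s v)) has_derivative
      (\<lambda>u. u * (\<Sum>k\<in>UNIV. v $ k * partial_deriv k f (a + w *s v)))) (at w)"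
    by (simp add: sum_distrib_left mult.assoc)
  then show ?thesis
    by (simp add: has_field_derivative_def mult_commute_abs)
qed

lemma holomorphic_vec_line_holomorphic:
  assumes "f holomorphic_vec_on S" "open S" "\<And>w. w \<in> T \<Longrightarrow> a + w *s v \<in> S"
  shows "(\<lambda>w. f (a + w *s v)) holomorphic_on T"
  unfolding holomorphic_on_def field_differentiable_def
  using holomorphic_vec_line_derivative[OF assms(1,2)] assms(3) by (meson has_field_derivative_at_within)

lemma holomorphic_vec_axis_holomorphic:
  assumes "f holomorphic_vec_on S" "open S" "\<And>w. w \<in> T \<Longrightarrow> a + axis k w \<in> S"
  shows "(\<lambda>w. f (a + axis k w)) holomorphic_on T"
  using holomorphic_vec_line_holomorphic[OF assms(1,2), of T a "axis k 1"] assms(3) by (simp flip: axis_eq_smult)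

lemma partial_deriv_eq_deriv:
  assumes "f holomorphic_vec_on S" "open S" "z \<in> S"
  shows "partial_deriv k f z = deriv (\<lambda>w. f (z + axis k w)) 0"
proof -
  have "((\<lambda>w. f (z + w *s axis k 1)) has_field_derivative
      (\<Sum>j\<in>UNIV. axis k 1 $ j * partial_deriv j f (z + 0 *s axis k 1))) (at 0)"
    using assms by (intro holomorphic_vec_line_derivative) auto
  moreover have "(\<Sum>j\<in>UNIV. axis k 1 $ j * partial_deriv j f (z + 0 *s axis k 1)) = partial_deriv k f z"
    by (simp add: axis_def if_distrib[of "\<lambda>x. x * _"] cong: if_cong)
  ultimately show ?thesis by (simp add: DERIV_imp_deriv flip: axis_eq_smult)
qed

text \<open>On a compact disc about \<open>w0\<close>, \<open>F x\<close> is uniformly close to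
  \<open>F x0\<close> for \<open>x\<close> near \<open>x0\<close>; Cauchy's estimate passes this on
  to the derivatives. Halving the radius keeps the Cauchy circles about nearby \<open>w\<close>
  inside that disc.\<close>

lemma continuous_on_deriv_param:
  fixes F :: "'a::metric_space \<Rightarrow> complex \<Rightarrow> complex"
  assumes cont: "continuous_on (A \<times> B) (\<lambda>(x, w). F x w)" and "open B"
    and hol: "\<And>x. x \<in> A \<Longrightarrow> F x holomorphic_on B"
  shows "continuous_on (A \<times> B) (\<lambda>(x, w). deriv (F x) w)"
  unfolding continuous_on_iff
proof (clarsimp)
  fix x0 w0 and e :: real assume x0: "x0 \<in> A" and w0: "w0 \<in> B" and e: "0 < e"
  obtain r where r: "0 < r" "cball w0 r \<subseteq> B"
    using \<open>open B\<close> w0 open_contains_cball by blast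
  define s where "s = r / 2"
  have s: "0 < s" "2 * s = r" using r by (auto simp: s_def)
  have "continuous_on (A \<times> cball w0 r) (\<lambda>(x, w). F x w)"
    using cont by (rule continuous_on_subset) (use r in auto)
  then obtain X0 where X0: "x0 \<in> X0" "open X0"
    "\<forall>x\<in>X0 \<inter> A. \<forall>t\<in>cball w0 r. dist (F x t) (F x0 t) \<le> e / 2 * s / 2"
    using continuous_on_prod_compactE[of A "cball w0 r" "\<lambda>(x, w). F x w" x0 "e / 2 * s / 2"] x0 e s
    by (auto simp: compact_cball)
  obtain d1 where d1: "0 < d1" "ball x0 d1 \<subseteq> X0"
    using X0 open_contains_ball by blast
  have "continuous_on B (deriv (F x0))"
    using hol[OF x0] \<open>open B\<close> holomorphic_deriv holomorphic_on_imp_continuous_on by blast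
  then obtain d2 where d2: "0 < d2" "\<And>w. w \<in> B \<Longrightarrow> dist w w0 < d2 \<Longrightarrow> dist (deriv (F x0) w) (deriv (F x0) w0) < e / 2"
    using w0 e unfolding continuous_on_iff by (metis half_gt_zero)
  have "dist (deriv (F x) w) (deriv (F x0) w0) < e"
    if x: "x \<in> A" "dist x x0 < d1" and w: "w \<in> B" "dist w w0 < d2" "dist w w0 < s" for x w
  proof -
    have sub: "cball w s \<subseteq> cball w0 r"
    proof
      fix u assume "u \<in> cball w s"
      then show "u \<in> cball w0 r"
        using dist_triangle[of w0 u w] w(3) s by (simp add: dist_commute)
    qed
    then have subB: "cball w s \<subseteq> B" using r by auto
    have h1: "F x holomorphic_on B" "F x0 holomorphic_on B" using hol x x0 by auto
    have "norm ((deriv ^^ 1) (\<lambda>u. F x u - F x0 u) w) \<le> fact 1 * (e / 2 * s / 2) / s ^ 1"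
    proof (rule Cauchy_inequality)
      show "(\<lambda>u. F x u - F x0 u) holomorphic_on ball w s"
        using subB by (intro holomorphic_on_diff holomorphic_on_subset[OF h1(1)] holomorphic_on_subset[OF h1(2)])
          (auto simp: subset_iff)
      show "continuous_on (cball w s) (\<lambda>u. F x u - F x0 u)"
        using subB by (intro continuous_on_diff holomorphic_on_imp_continuous_on
          holomorphic_on_subset[OF h1(1)] holomorphic_on_subset[OF h1(2)])
      show "0 < s" by fact
      fix u assume "cmod (w - u) = s"
      then have "u \<in> cball w0 r" using sub by (auto simp: dist_norm)
      moreover have "x \<in> X0 \<inter> A" using x d1 by (auto simp: dist_commute)
      ultimately show "cmod (F x u - F x0 u) \<le> e / 2 * s / 2"
        using X0(3) by (auto simp: dist_norm)
    qed
    moreover have "deriv (\<lambda>u. F x u - F x0 u) w = deriv (F x) w - deriv (F x0) w"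
      using h1 w \<open>open B\<close> by (intro deriv_diff) (auto simp: holomorphic_on_imp_differentiable_at)
    ultimately have "dist (deriv (F x) w) (deriv (F x0) w) \<le> e / 4"
      using s by (simp add: dist_norm)
    with d2(2)[OF w(1,2)] show ?thesis
      using dist_triangle[of "deriv (F x) w" "deriv (F x0) w0" "deriv (F x0) w"] e by linarith
  qed
  note * = this
  show "\<exists>d>0. \<forall>x\<in>A. \<forall>w\<in>B. dist (x, w) (x0, w0) < d \<longrightarrow> dist (deriv (F x) w) (deriv (F x0) w0) < e"
  proof (intro exI[of _ "min d1 (min d2 s)"] conjI ballI impI)
    show "0 < min d1 (min d2 s)" using d1 d2 s by simp
    fix x w assume "x \<in> A" "w \<in> B" "dist (x, w) (x0, w0) < min d1 (min d2 s)"
    then show "dist (deriv (F x) w) (deriv (F x0) w0) < e"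
      using dist_fst_le[of "(x, w)" "(x0, w0)"] dist_snd_le[of "(x, w)" "(x0, w0)"]
      by (intro *) auto
  qed
qed

section \<open>Osgood's lemma and its consequences\<close>

lemma axis_add_in_ball:
  fixes z :: "complex ^ 'n"
  assumes "z \<in> ball z0 r" "cmod w < s" "r + s \<le> t"
  shows "z + axis k w \<in> ball z0 t"
proof -
  have "dist z0 (z + axis k w) \<le> dist z0 z + norm (axis k w :: complex ^ 'n)"
    using dist_triangle[of z0 "z + axis k w" z] by (simp add: dist_norm)
  then show ?thesis using assms by simp
qed

text \<open>Joint continuity makes the partial derivatives continuous through
  \<open>continuous_on_deriv_param\<close>. The increment is then telescoped one coordinate at a
  time. This allows holomorphy of integrals and limits to be checked on coordinate slices.\<close>

theorem osgood:
  fixes f :: "complex ^ 'n \<Rightarrow> complex"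
  assumes "open S" and cont: "continuous_on S f"
    and hol: "\<And>z k. z \<in> S \<Longrightarrow> \<exists>r>0. (\<lambda>w. f (z + axis k w)) holomorphic_on ball 0 r"
  shows "f holomorphic_vec_on S"
  unfolding holomorphic_vec_iff_at[OF \<open>open S\<close>]
proof
  fix z0 assume "z0 \<in> S"
  then obtain R where R: "0 < R" "ball z0 R \<subseteq> S"
    using \<open>open S\<close> open_contains_ball by blast
  define r where "r = R / 2"
  have r: "0 < r" "r + r \<le> R" using R by (auto simp: r_def)
  have in_S: "z + axis k w \<in> S" if "z \<in> ball z0 r" "w \<in> ball 0 r" for z w k
    using axis_add_in_ball[of z z0 r w r R k] that r R by auto
  have slice: "(\<lambda>w. f (z + axis k w)) holomorphic_on ball 0 r" if z: "z \<in> ball z0 r" for z k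
  proof -
    have "(\<lambda>w. f (z + axis k w)) field_differentiable at w" if w: "w \<in> ball 0 r" for w
    proof -
      obtain d where d: "0 < d" "(\<lambda>u. f (z + axis k w + axis k u)) holomorphic_on ball 0 d"
        using hol[OF in_S[OF z w]] by blast
      have ax: "z + axis k (u + w) = z + axis k w + axis k u" for u
        by (simp add: vec_eq_iff axis_def)
      have "(\<lambda>u. f (z + axis k w + axis k u)) field_differentiable at 0"
        using d by (intro holomorphic_on_imp_differentiable_at[where s = "ball 0 d"]) auto
      then obtain D where "((\<lambda>u. f (z + axis k (u + w))) has_field_derivative D) (at 0)"
        unfolding ax field_differentiable_def by blast
      then have "((\<lambda>u. f (z + axis k u)) has_field_derivative D) (at (0 + w))"
        by (subst DERIV_shift)
      then show ?thesis unfolding field_differentiable_def by auto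
    qed
    then show ?thesis
      unfolding holomorphic_on_def using field_differentiable_at_within by blast
  qed
  define g where "g k z = deriv (\<lambda>w. f (z + axis k w)) 0" for k z
  have deriv_g: "((\<lambda>w. f (z + axis k w)) has_field_derivative g k (z + axis k w)) (at w)"
    if "z + axis k w \<in> ball z0 r" for z k w
  proof -
    have ax: "z + axis k (u + w) = z + axis k w + axis k u" for u
      by (simp add: vec_eq_iff axis_def)
    have "((\<lambda>u. f (z + axis k w + axis k u)) has_field_derivative g k (z + axis k w)) (at 0)"
      unfolding g_def using slice[OF that, of k] r by (intro holomorphic_derivI[where S = "ball 0 r"]) auto
    then have "((\<lambda>w. f (z + axis k w)) has_field_derivative g k (z + axis k w)) (at (0 + w))"
      by (subst DERIV_shift) (simp only: ax)
    then show ?thesis by simp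
  qed
  have cont_g: "continuous_on (ball z0 r) (g k)" for k
  proof -
    have "continuous_on (ball z0 r \<times> ball 0 r) (\<lambda>(z, w). deriv (\<lambda>w. f (z + axis k w)) w)"
    proof (rule continuous_on_deriv_param)
      show "continuous_on (ball z0 r \<times> ball 0 r) (\<lambda>(z, w). f (z + axis k w))"
        unfolding split_beta
        by (intro continuous_on_compose2[OF cont] continuous_intros
            bounded_linear.continuous_on[OF bounded_linear_axis]) (use in_S in auto)
    qed (use slice in auto)
    then have "continuous_on (ball z0 r) (\<lambda>z. case (z, 0) of (z, w) \<Rightarrow> deriv (\<lambda>w. f (z + axis k w)) w)"
      by (rule continuous_on_compose2) (use r in \<open>auto intro!: continuous_intros\<close>)
    then show ?thesis by (simp add: g_def[abs_def])
  qed
  define D where "D h = (\<Sum>k\<in>UNIV. h $ k * g k z0)" for h :: "complex ^ 'n"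
  have D_lin: "bounded_linear D"
    unfolding D_def
    by (intro bounded_linear_sum bounded_linear_mult_left[THEN bounded_linear_compose] bounded_linear_vec_nth)
  have "(f has_derivative D) (at z0)"
    unfolding has_derivative_at_alt
  proof (intro conjI D_lin allI impI)
    fix e :: real assume e: "0 < e"
    \<comment> \<open>Each of the \<open>CARD('n)\<close> coordinate steps contributes at most
      \<open>e' * norm h\<close>.\<close>
    define e' where "e' = e / real CARD('n)"
    have e': "0 < e'" using e by (simp add: e'_def)
    have "eventually (\<lambda>z. \<forall>k\<in>UNIV. dist (g k z) (g k z0) < e') (at z0)"
    proof (intro eventually_ball_finite ballI)
      fix k
      have "isCont (g k) z0"
        using cont_g r by (simp add: continuous_on_eq_continuous_at)
      then show "eventually (\<lambda>z. dist (g k z) (g k z0) < e') (at z0)"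
        using e' unfolding isCont_def by (rule tendstoD)
    qed simp
    then obtain d0 where d0: "0 < d0" "\<And>z k. z \<noteq> z0 \<Longrightarrow> dist z z0 < d0 \<Longrightarrow> dist (g k z) (g k z0) < e'"
      unfolding eventually_at by auto
    define d where "d = min d0 r"
    have d: "0 < d" using d0 r by (simp add: d_def)
    have g_close: "cmod (g k z - g k z0) \<le> e'" if "dist z z0 < d" for z k
      using d0(2)[of z k] that e' by (cases "z = z0") (auto simp: d_def dist_norm)
    show "\<exists>d>0. \<forall>y. norm (y - z0) < d \<longrightarrow> norm (f y - f z0 - D (y - z0)) \<le> e * norm (y - z0)"
    proof (intro exI[of _ d] conjI d allI impI)
      fix y assume y: "norm (y - z0) < d"
      define h where "h = y - z0"
      \<comment> \<open>Partial increments: the path from \<open>z0\<close> to \<open>y\<close>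
        changes one coordinate at a time. Dropping or shrinking coordinates does not increase the
        norm, so the whole path stays within distance \<open>d\<close> of \<open>z0\<close>.\<close>
      define hK where "hK K = (\<chi> j. if j \<in> K then h $ j else 0)" for K
      have claim: "cmod (f (z0 + hK K) - f z0 - (\<Sum>k\<in>K. h $ k * g k z0)) \<le> (\<Sum>k\<in>K. e' * cmod (h $ k))"
        if "finite K" for K
        using that
      proof (induction K rule: finite_induct)
        case empty
        have "hK {} = 0" by (simp add: hK_def vec_eq_iff)
        then show ?case by simp
      next
        case (insert k K)
        have hk: "hK (insert k K) = hK K + axis k (h $ k)"
          using insert by (auto simp: hK_def vec_eq_iff axis_def)
        \<comment> \<open>Subtracting the expected linear part leaves a function whose derivative
          \<open>g k - g k z0\<close> is small, so the mean value inequality bounds the error of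
          this step.\<close>
        define \<phi> where "\<phi> w = f (z0 + hK K + axis k w) - w * g k z0" for w :: complex
        have near: "dist (z0 + hK K + axis k w) z0 < d" if "cmod w \<le> cmod (h $ k)" for w :: complex
        proof -
          have "norm (hK K + axis k w) \<le> norm h"
            using that insert by (intro norm_vec_mono) (auto simp: hK_def axis_def)
          then show ?thesis using y by (simp add: dist_norm h_def add.assoc)
        qed
        have "cmod (\<phi> (h $ k) - \<phi> 0) \<le> e' * cmod (h $ k - 0)"
        proof (rule field_differentiable_bound[where S = "cball 0 (cmod (h $ k))"])
          fix w :: complex assume "w \<in> cball 0 (cmod (h $ k))"
          then have w: "dist (z0 + hK K + axis k w) z0 < d" by (intro near) simp
          then have "z0 + hK K + axis k w \<in> ball z0 r" by (simp add: d_def dist_commute)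
          from deriv_g[OF this]
          have "(\<phi> has_field_derivative g k (z0 + hK K + axis k w) - 1 * g k z0) (at w)"
            unfolding \<phi>_def by (intro derivative_intros DERIV_cmult_right DERIV_ident)
          then show "(\<phi> has_field_derivative g k (z0 + hK K + axis k w) - g k z0) (at w within cball 0 (cmod (h $ k)))"
            by (simp add: has_field_derivative_at_within)
          show "cmod (g k (z0 + hK K + axis k w) - g k z0) \<le> e'"
            using g_close[OF w] .
        qed auto
        moreover have "axis k 0 = (0 :: complex ^ 'n)" by (simp add: vec_eq_iff axis_def)
        ultimately have "cmod (f (z0 + hK (insert k K)) - f (z0 + hK K) - h $ k * g k z0) \<le> e' * cmod (h $ k)"
          by (simp add: \<phi>_def hk add.assoc algebra_simps)
        moreover have "f (z0 + hK (insert k K)) - f z0 - (\<Sum>j\<in>insert k K. h $ j * g j z0) =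
          (f (z0 + hK (insert k K)) - f (z0 + hK K) - h $ k * g k z0) +
          (f (z0 + hK K) - f z0 - (\<Sum>j\<in>K. h $ j * g j z0))"
          using insert by simp
        ultimately show ?case
          using insert norm_triangle_ineq
          by (smt (verit) sum.insert)
      qed
      have "hK UNIV = h" by (simp add: hK_def vec_eq_iff)
      with claim[of UNIV] have "cmod (f y - f z0 - D h) \<le> (\<Sum>k\<in>UNIV. e' * cmod (h $ k))"
        by (simp add: D_def h_def)
      also have "\<dots> \<le> (\<Sum>k\<in>(UNIV :: 'n set). e' * norm h)"
        using e' by (intro sum_mono mult_left_mono) (auto intro: Finite_Cartesian_Product.norm_nth_le)
      also have "\<dots> = e * norm h" by (simp add: e'_def)
      finally show "norm (f y - f z0 - D (y - z0)) \<le> e * norm (y - z0)"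
        by (simp add: h_def)
    qed
  qed
  moreover have "D (c *s v) = c * D v" for c v
    by (simp add: D_def sum_distrib_left mult.assoc)
  ultimately show "\<exists>D. (f has_derivative D) (at z0) \<and> (\<forall>c v. D (c *s v) = c * D v)"
    by blast
qed

text \<open>Osgood's lemma reduces the claim to differentiation under the integral in one complex
  variable; joint continuity of that derivative comes from
  \<open>continuous_on_deriv_param\<close>.\<close>

lemma holomorphic_vec_integral:
  fixes \<Phi> :: "complex ^ 'n \<Rightarrow> real \<Rightarrow> complex"
  assumes "open S" and cont: "continuous_on (S \<times> {0..1}) (\<lambda>(z, t). \<Phi> z t)"
    and hv: "\<And>t. t \<in> {0..1} \<Longrightarrow> (\<lambda>z. \<Phi> z t) holomorphic_vec_on S"
  shows "(\<lambda>z. integral {0..1} (\<Phi> z)) holomorphic_vec_on S"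
proof (rule osgood[OF \<open>open S\<close>])
  show "continuous_on S (\<lambda>z. integral {0..1} (\<Phi> z))"
    using integral_continuous_on_param[of S 0 1 \<Phi>] cont by simp
  fix z k assume "z \<in> S"
  then obtain r where r: "0 < r" "ball z r \<subseteq> S"
    using \<open>open S\<close> open_contains_ball by blast
  have in_S: "z + axis k w \<in> S" if "w \<in> ball 0 r" for w
    using that r by (auto simp: dist_norm)
  have hol: "(\<lambda>w. \<Phi> (z + axis k w) t) holomorphic_on ball 0 r" if "t \<in> {0..1}" for t
    using holomorphic_vec_axis_holomorphic[OF hv[OF that] \<open>open S\<close>, of "ball 0 r" z k] in_S by blast
  have cont': "continuous_on ({0..1} \<times> ball 0 r) (\<lambda>(t, w). \<Phi> (z + axis k w) t)"
  proof -
    have "continuous_on ({0..1} \<times> ball 0 r) (\<lambda>p. (case (z + axis k (snd p), fst p) of (z, t) \<Rightarrow> \<Phi> z t))"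
      by (intro continuous_on_compose2[OF cont] continuous_intros
          bounded_linear.continuous_on[OF bounded_linear_axis]) (use in_S in auto)
    then show ?thesis by (simp add: split_beta)
  qed
  have "(\<lambda>w. integral (cbox 0 1) (\<Phi> (z + axis k w))) holomorphic_on ball 0 r"
  proof (rule leibniz_rule_holomorphic[where f = "\<lambda>w. \<Phi> (z + axis k w)" and
        fx = "\<lambda>w t. deriv (\<lambda>w. \<Phi> (z + axis k w) t) w"])
    show "((\<lambda>w. \<Phi> (z + axis k w) t) has_field_derivative deriv (\<lambda>w. \<Phi> (z + axis k w) t) w) (at w within ball 0 r)"
      if "w \<in> ball 0 r" "t \<in> cbox 0 1" for w t
    proof -
      have "t \<in> {0..1}" using that by simp
      from holomorphic_derivI[OF hol[OF this] open_ball that(1)]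
      show ?thesis by (rule has_field_derivative_at_within)
    qed
    show "\<Phi> (z + axis k w) integrable_on cbox 0 1" if "w \<in> ball 0 r" for w
    proof -
      have "continuous_on {0..1} (\<lambda>t. case (z + axis k w, t) of (z, t) \<Rightarrow> \<Phi> z t)"
        by (rule continuous_on_compose2[OF cont]) (use in_S[OF that] in \<open>auto intro!: continuous_intros\<close>)
      then show ?thesis by (simp add: integrable_continuous_interval)
    qed
    have "continuous_on ({0..1} \<times> ball 0 r) (\<lambda>(t, w). deriv (\<lambda>w. \<Phi> (z + axis k w) t) w)"
      using hol by (intro continuous_on_deriv_param cont') auto
    then have "continuous_on (ball 0 r \<times> cbox 0 1)
        (\<lambda>p. case (snd p, fst p) of (t, w) \<Rightarrow> deriv (\<lambda>w. \<Phi> (z + axis k w) t) w)"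
      by (rule continuous_on_compose2) (auto intro!: continuous_intros)
    then show "continuous_on (ball 0 r \<times> cbox 0 1) (\<lambda>(w, t). deriv (\<lambda>w. \<Phi> (z + axis k w) t) w)"
      by (simp add: split_beta)
  qed auto
  then show "\<exists>r>0. (\<lambda>w. integral {0..1} (\<Phi> (z + axis k w))) holomorphic_on ball 0 r"
    using r by auto
qed

text \<open>Weierstrass' theorem on the coordinate slices, assembled by Osgood's lemma.\<close>

lemma holomorphic_vec_uniform_limit:
  fixes f :: "nat \<Rightarrow> complex ^ 'n \<Rightarrow> complex"
  assumes "open S" and hv: "\<And>i. f i holomorphic_vec_on S"
    and lim: "\<And>z. z \<in> S \<Longrightarrow> \<exists>d>0. cball z d \<subseteq> S \<and> uniform_limit (cball z d) f g sequentially"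
  shows "g holomorphic_vec_on S"
proof (rule osgood[OF \<open>open S\<close>])
  have "isCont g z" if zS: "z \<in> S" for z
  proof -
    obtain d where d: "d > 0" "cball z d \<subseteq> S" "uniform_limit (cball z d) f g sequentially"
      using lim[OF zS] by blast
    have "continuous_on (cball z d) g"
      using d hv by (intro uniform_limit_theorem[OF _ d(3)])
        (auto intro!: always_eventually continuous_on_subset[OF holomorphic_vec_imp_continuous_on])
    then show ?thesis
      using d by (intro continuous_on_interior[of "cball z d"]) auto
  qed
  then show "continuous_on S g" by (simp add: continuous_at_imp_continuous_on)
  fix z k assume "z \<in> S"
  then obtain d where d: "d > 0" "cball z d \<subseteq> S" "uniform_limit (cball z d) f g sequentially"
    using lim by blast
  have in_d: "z + axis k w \<in> cball z d" if "w \<in> cball 0 d" for w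
    using that by (auto simp: dist_norm)
  have ul: "uniform_limit (cball 0 d) (\<lambda>i w. f i (z + axis k w)) (\<lambda>w. g (z + axis k w)) sequentially"
    using d(3) in_d unfolding uniform_limit_iff by (fastforce elim: eventually_mono)
  have "(\<lambda>w. f i (z + axis k w)) holomorphic_on cball 0 d" for i
    using holomorphic_vec_axis_holomorphic[OF hv \<open>open S\<close>] in_d d by blast
  then have "eventually (\<lambda>i. continuous_on (cball 0 d) (\<lambda>w. f i (z + axis k w)) \<and>
      (\<lambda>w. f i (z + axis k w)) holomorphic_on ball 0 d) sequentially"
    by (intro always_eventually allI conjI holomorphic_on_imp_continuous_on
        holomorphic_on_subset[OF _ ball_subset_cball])
  with ul have "(\<lambda>w. g (z + axis k w)) holomorphic_on ball 0 d"
    using holomorphic_uniform_limit[of 0 d "\<lambda>i w. f i (z + axis k w)" sequentially "\<lambda>w. g (z + axis k w)"]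
      trivial_limit_sequentially by blast
  then show "\<exists>r>0. (\<lambda>w. g (z + axis k w)) holomorphic_on ball 0 r"
    using d by blast
qed

text \<open>Cauchy's formula writes the partial derivative as a parameter integral of
  \<open>f\<close> over a circle in the \<open>k\<close>-th direction, and the integrand is
  holomorphic in the base point.\<close>

lemma holomorphic_vec_partial_deriv:
  fixes f :: "complex ^ 'n \<Rightarrow> complex"
  assumes f: "f holomorphic_vec_on S" and "open S"
  shows "partial_deriv k f holomorphic_vec_on S"
proof (rule holomorphic_vec_local[OF \<open>open S\<close>])
  fix z0 assume "z0 \<in> S"
  then obtain R where R: "0 < R" "ball z0 R \<subseteq> S"
    using \<open>open S\<close> open_contains_ball by blast
  \<comment> \<open>Room for two steps, from \<open>z0\<close> to \<open>z\<close> and from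
    \<open>z\<close> to the circle of radius \<open>r\<close>, with total length below
    \<open>R\<close>.\<close>
  define r where "r = R / 3"
  have r: "0 < r" using R by (simp add: r_def)
  define c where "c t = of_real r * cis (2 * pi * t)" for t
  have c: "cmod (c t) = r" "c t \<noteq> 0" for t using r by (auto simp: c_def norm_mult)
  have in_S: "z + axis k w \<in> S" if "z \<in> ball z0 r" "cmod w \<le> r" for z w
    using axis_add_in_ball[of z z0 r w "2 * r" R k] that r R by (auto simp: r_def)
  define \<Phi> where "\<Phi> z t = f (z + axis k (c t)) * inverse (c t)" for z t
  have eq: "partial_deriv k f z = integral {0..1} (\<Phi> z)" if z: "z \<in> ball z0 r" for z
  proof -
    have zS: "z \<in> S" using in_S[OF z, of 0] r by (simp add: axis_def zero_vec_def[symmetric])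
    have hol: "(\<lambda>w. f (z + axis k w)) holomorphic_on cball 0 r"
      using in_S[OF z] by (intro holomorphic_vec_axis_holomorphic[OF f \<open>open S\<close>]) auto
    have "((\<lambda>u. f (z + axis k u) / (u - 0) ^ Suc 1) has_contour_integral
       (2 * pi) * \<i> / fact 1 * (deriv ^^ 1) (\<lambda>w. f (z + axis k w)) 0) (circlepath 0 r)"
      using r hol by (intro Cauchy_has_contour_integral_higher_derivative_circlepath
        holomorphic_on_imp_continuous_on holomorphic_on_subset[OF hol]) auto
    then have "((\<lambda>t. f (z + axis k (c t)) / (c t)\<^sup>2 * (2 * pi * \<i> * c t)) has_integral
        (2 * pi) * \<i> / fact 1 * (deriv ^^ 1) (\<lambda>w. f (z + axis k w)) 0) {0..1}"
      unfolding has_contour_integral_def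
      by (elim has_integral_eq[rotated])
         (simp add: vector_derivative_circlepath01, simp add: circlepath c_def cis_conv_exp mult_ac numeral_2_eq_2)
    note I = has_integral_mult_right[OF this, of "1 / (2 * of_real pi * \<i>)"]
    have alg: "1 / (2 * of_real pi * \<i>) * (A / x\<^sup>2 * (of_real (2 * pi) * \<i> * x)) = A * inverse x"
      if "x \<noteq> 0" for A x :: complex
      using that by (simp add: power2_eq_square field_simps)
    have "(\<Phi> z has_integral (1 / (2 * of_real pi * \<i>) * ((2 * pi) * \<i> / fact 1 * (deriv ^^ 1) (\<lambda>w. f (z + axis k w)) 0))) {0..1}"
      using I unfolding alg[OF c(2)] \<Phi>_def .
    then have "integral {0..1} (\<Phi> z) = deriv (\<lambda>w. f (z + axis k w)) 0"
      by (simp add: integral_unique)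
    then show ?thesis
      using partial_deriv_eq_deriv[OF f \<open>open S\<close> zS] by simp
  qed
  have "(\<lambda>z. integral {0..1} (\<Phi> z)) holomorphic_vec_on ball z0 r"
  proof (rule holomorphic_vec_integral)
    have cc: "continuous_on A c" for A unfolding c_def by (intro continuous_intros)
    show "continuous_on (ball z0 r \<times> {0..1}) (\<lambda>(z, t). \<Phi> z t)"
      unfolding \<Phi>_def split_beta using in_S c
      by (intro continuous_on_mult continuous_on_inverse continuous_on_compose2[OF holomorphic_vec_imp_continuous_on[OF f]]
          continuous_on_add continuous_on_compose2[OF cc] bounded_linear.continuous_on[OF bounded_linear_axis]
          continuous_on_fst continuous_on_snd continuous_on_id) auto
    show "(\<lambda>z. \<Phi> z t) holomorphic_vec_on ball z0 r" for t
      unfolding \<Phi>_def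
      using holomorphic_vec_compose_linear[OF f bounded_linear_ident, of "axis k (c t)" "ball z0 r"] in_S c
      by (intro holomorphic_vec_mult holomorphic_vec_const) (auto simp: add.commute image_subset_iff)
  qed auto
  then have "partial_deriv k f holomorphic_vec_on ball z0 r"
    using eq by (subst holomorphic_vec_cong[of _ _ "\<lambda>z. integral {0..1} (\<Phi> z)"]) auto
  then show "\<exists>T. open T \<and> z0 \<in> T \<and> partial_deriv k f holomorphic_vec_on T"
    using r by (intro exI[of _ "ball z0 r"]) auto
qed

section \<open>The radial derivative and the operator along rays\<close>

lemma holomorphic_vec_radial_deriv:
  assumes "f holomorphic_vec_on S" "open S"
  shows "radial_deriv f holomorphic_vec_on S"
  unfolding radial_deriv_def[abs_def]
  by (intro holomorphic_vec_sum holomorphic_vec_mult holomorphic_vec_component holomorphic_vec_partial_deriv assms)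

lemma radial_deriv_slice:
  assumes "f holomorphic_vec_on S" "open S" "z \<in> S"
  shows "((\<lambda>w. f (w *s z)) has_field_derivative radial_deriv f z) (at 1)"
  using holomorphic_vec_line_derivative[OF assms(1,2), of 0 1 z] assms(3) by (simp add: radial_deriv_def)

text \<open>The radial derivative of \<open>g\<close> at \<open>t *\<^sub>R z\<close> with the
  factor \<open>t\<close> taken out. It is continuous in \<open>t\<close> up to 0, which removes the
  apparent singularity of the integrand of \<open>J_op\<close>.\<close>

definition radial_quot :: "(complex ^ 'n \<Rightarrow> complex) \<Rightarrow> complex ^ 'n \<Rightarrow> real \<Rightarrow> complex" where
  "radial_quot g z t = (\<Sum>k\<in>UNIV. z $ k * partial_deriv k g (t *\<^sub>R z))"

lemma radial_deriv_scaleR: "radial_deriv g (t *\<^sub>R z) = of_real t * radial_quot g z t"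
  unfolding radial_deriv_def radial_quot_def
  by (simp add: sum_distrib_left mult.assoc) (simp add: scaleR_conv_of_real mult.assoc)

text \<open>The integrands can differ only at \<open>t = 0\<close>, where division by zero yields 0
  and \<open>radial_quot\<close> need not vanish; a single point does not affect the
  integral.\<close>

lemma J_op_eq: "J_op g f z = integral {0..1} (\<lambda>t. f (t *\<^sub>R z) * radial_quot g z t)"
  unfolding J_op_def
  by (rule integral_spike[where S = "{0}"]) (auto simp: radial_deriv_scaleR)

lemma scaleR_in_ball:
  fixes z :: "'a::real_normed_vector"
  assumes "z \<in> ball 0 r" "0 \<le> t" "t \<le> 1"
  shows "t *\<^sub>R z \<in> ball 0 r"
proof -
  have "\<bar>t\<bar> * norm z \<le> 1 * norm z" using assms by (intro mult_right_mono) auto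
  then show ?thesis using assms by simp
qed

lemma continuous_on_J_integrand:
  assumes f: "f holomorphic_vec_on ball 0 1" and g: "g holomorphic_vec_on ball 0 1"
    and A: "\<And>z t. (z, t) \<in> A \<Longrightarrow> t *\<^sub>R z \<in> ball 0 1"
  shows "continuous_on A (\<lambda>(z, t). f (t *\<^sub>R z) * radial_quot g z t)"
  unfolding radial_quot_def split_beta
  by (intro continuous_intros continuous_on_compose2[OF holomorphic_vec_imp_continuous_on[OF f]]
      continuous_on_compose2[OF holomorphic_vec_imp_continuous_on[OF holomorphic_vec_partial_deriv[OF g open_ball]]]
      bounded_linear.continuous_on[OF bounded_linear_vec_nth] continuous_on_fst continuous_on_snd)
     (use A in auto)

lemma continuous_on_J_slice:
  assumes f: "f holomorphic_vec_on ball 0 1" and g: "g holomorphic_vec_on ball 0 1" and z: "z \<in> ball 0 1"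
  shows "continuous_on {0..1} (\<lambda>t. f (t *\<^sub>R z) * radial_quot g z t)"
proof -
  have "continuous_on {0..1} (\<lambda>t. case (z, t) of (z, t) \<Rightarrow> f (t *\<^sub>R z) * radial_quot g z t)"
    by (rule continuous_on_compose2[OF continuous_on_J_integrand[OF f g, of "{z} \<times> {0..1}"]])
       (use scaleR_in_ball[OF z] in \<open>auto intro!: continuous_intros\<close>)
  then show ?thesis by simp
qed

lemma scaleR_smult_commute: "t *\<^sub>R (c *s v) = c *s (t *\<^sub>R (v :: complex ^ 'n))"
  by (simp add: vec_eq_iff)

lemma holomorphic_vec_J_op:
  assumes f: "f holomorphic_vec_on ball 0 1" and g: "g holomorphic_vec_on ball 0 1"
  shows "J_op g f holomorphic_vec_on ball 0 1"
proof -
  have "(\<lambda>z. integral {0..1} (\<lambda>t. f (t *\<^sub>R z) * radial_quot g z t)) holomorphic_vec_on ball 0 1"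
  proof (rule holomorphic_vec_integral)
    show "continuous_on (ball 0 1 \<times> {0..1}) (\<lambda>(z, t). f (t *\<^sub>R z) * radial_quot g z t)"
      using scaleR_in_ball by (intro continuous_on_J_integrand f g) auto
    fix t :: real assume t: "t \<in> {0..1}"
    have "(\<lambda>z. h (0 + t *\<^sub>R z)) holomorphic_vec_on ball 0 1" if "h holomorphic_vec_on ball 0 1" for h
      using t by (intro holomorphic_vec_compose_linear[OF that] bounded_linear_scaleR_right)
        (auto simp: scaleR_smult_commute intro!: scaleR_in_ball simp del: mem_ball mem_ball_0)
    then show "(\<lambda>z. f (t *\<^sub>R z) * radial_quot g z t) holomorphic_vec_on ball 0 1"
      unfolding radial_quot_def
      using f holomorphic_vec_partial_deriv[OF g open_ball]
      by (intro holomorphic_vec_mult holomorphic_vec_sum holomorphic_vec_component) auto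
  qed auto
  then show ?thesis by (subst holomorphic_vec_cong) (auto simp: J_op_eq)
qed

text \<open>Substituting \<open>\<tau> = s * t\<close> turns \<open>J_op g f (s *\<^sub>R z)\<close>
  into the integral of \<open>\<phi>\<close> over \<open>{0..s}\<close>, which the fundamental
  theorem differentiates at \<open>s = 1\<close>. That real derivative is the complex one along the
  slice through \<open>z\<close>.\<close>

lemma radial_deriv_J_op:
  assumes f: "f holomorphic_vec_on ball 0 1" and g: "g holomorphic_vec_on ball 0 1"
    and z: "z \<in> ball 0 1"
  shows "radial_deriv (J_op g f) z = f z * radial_deriv g z"
proof -
  define \<phi> where "\<phi> \<tau> = f (\<tau> *\<^sub>R z) * radial_quot g z \<tau>" for \<tau>
  \<comment> \<open>The ray is continued a little beyond \<open>z\<close>, so that the derivative at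
    \<open>s = 1\<close> is two-sided.\<close>
  obtain b where b: "1 < b" "b * norm z < 1"
  proof (cases "z = 0")
    case False
    then obtain b where "1 < b" "b < 1 / norm z" using z dense[of 1 "1 / norm z"] by auto
    then show ?thesis using False that by (simp add: field_simps)
  qed (auto intro: that[of 2])
  have in_ball: "\<tau> *\<^sub>R z \<in> ball 0 1" if "\<tau> \<in> {0..b}" for \<tau>
  proof -
    have "\<tau> * norm z \<le> b * norm z" using that by (intro mult_right_mono) auto
    then show ?thesis using that b by simp
  qed
  have cont: "continuous_on {0..b} \<phi>"
  proof -
    have "continuous_on {0..b} (\<lambda>t. case (z, t) of (z, t) \<Rightarrow> f (t *\<^sub>R z) * radial_quot g z t)"
      by (rule continuous_on_compose2[OF continuous_on_J_integrand[OF f g, of "{z} \<times> {0..b}"]])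
         (use in_ball in \<open>auto intro!: continuous_intros\<close>)
    then show ?thesis by (simp add: \<phi>_def[abs_def])
  qed
  \<comment> \<open>The substitution divides by \<open>s\<close>; staying above 1/2 avoids 0 and
    still leaves a neighbourhood of 1.\<close>
  have J: "J_op g f (s *\<^sub>R z) = integral {0..s} \<phi>" if s: "s \<in> {1/2..b}" for s
  proof -
    have "((\<lambda>\<tau>. \<phi> \<tau>) has_integral integral {0..s} \<phi>) (cbox 0 s)"
      unfolding cbox_interval using s
      by (intro integrable_integral integrable_continuous_interval continuous_on_subset[OF cont]) auto
    then have "((\<lambda>t. \<phi> (s *\<^sub>R t + 0)) has_integral (1 / (\<bar>s\<bar> ^ DIM(real))) *\<^sub>R integral {0..s} \<phi>)
        ((\<lambda>x. (1 / s) *\<^sub>R x + - ((1 / s) *\<^sub>R 0)) ` cbox 0 s)"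
      by (rule has_integral_affinity) (use s in auto)
    moreover have "(\<lambda>x. (1 / s) *\<^sub>R x + - ((1 / s) *\<^sub>R 0)) ` cbox 0 s = {0..1}"
    proof -
      have "(\<lambda>x. (1 / s) *\<^sub>R x + - ((1 / s) *\<^sub>R 0)) ` cbox 0 s = (\<lambda>x. x / s) ` {0..s}"
        by (intro image_cong) (simp_all add: cbox_interval)
      then show ?thesis using s image_divide_atLeastAtMost[of s 0 s] by simp
    qed
    ultimately have "((\<lambda>t. \<phi> (s * t)) has_integral (1 / s) *\<^sub>R integral {0..s} \<phi>) {0..1}"
      using s by simp
    from has_integral_mult_right[OF this, of "of_real s"]
    have "((\<lambda>t. of_real s * \<phi> (s * t)) has_integral integral {0..s} \<phi>) {0..1}"
      using s by (simp add: scaleR_conv_of_real)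
    moreover have "of_real s * \<phi> (s * t) = f (t *\<^sub>R (s *\<^sub>R z)) * radial_quot g (s *\<^sub>R z) t" for t
      unfolding \<phi>_def radial_quot_def
      by (simp add: sum_distrib_left mult_ac) (simp add: scaleR_conv_of_real mult_ac)
    ultimately show ?thesis
      using s unfolding J_op_eq by (simp add: integral_unique)
  qed
  have "((\<lambda>s. integral {0..s} \<phi>) has_vector_derivative \<phi> 1) (at 1 within {0..b})"
    using cont b by (intro integral_has_vector_derivative) auto
  then have "((\<lambda>s. integral {0..s} \<phi>) has_vector_derivative \<phi> 1) (at 1)"
    using b at_within_interior[of 1 "{0..b}"] by (simp add: interior_atLeastAtMost_real)
  then have 1: "((\<lambda>s. J_op g f (s *\<^sub>R z)) has_vector_derivative \<phi> 1) (at 1)"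
    by (rule has_vector_derivative_transform_within_open[of _ _ _ "{1/2<..<b}"]) (use b J in auto)
  have "((\<lambda>w. J_op g f (w *s z)) has_field_derivative radial_deriv (J_op g f) z) (at (of_real 1))"
    using radial_deriv_slice[OF holomorphic_vec_J_op[OF f g] open_ball z] by simp
  from has_vector_derivative_real_field[OF this]
  have "((\<lambda>s. J_op g f (s *\<^sub>R z)) has_vector_derivative radial_deriv (J_op g f) z) (at 1)"
    by (simp add: scaleR_eq_smult)
  from vector_derivative_unique_at[OF this 1]
  show ?thesis using radial_deriv_scaleR[of g 1 z] by (simp add: \<phi>_def)
qed

subsection \<open>Integration on the ball and the sphere\<close>

declare borel_open[OF open_ball, measurable] borel_closed[OF closed_sphere, measurable]

lemma ennreal_mult_right_cancel:
  fixes a b c :: ennreal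
  assumes "a * c = b * c" "c \<noteq> 0" "c \<noteq> \<infinity>"
  shows "a = b"
  using assms by (metis ennreal_mult_cancel_left infinity_ennreal_def mult.commute)

lemma nn_integral_lborel_cong_except:
  fixes f g :: "'a::euclidean_space \<Rightarrow> ennreal"
  assumes "\<And>x. x \<noteq> c \<Longrightarrow> f x = g x"
  shows "(\<integral>\<^sup>+x. f x \<partial>lborel) = (\<integral>\<^sup>+x. g x \<partial>lborel)"
  using AE_lborel_singleton[of c] by (rule nn_integral_cong_AE[OF eventually_mono]) (rule assms)

lemma nn_integral_lborel_affine:
  fixes f :: "'a::euclidean_space \<Rightarrow> ennreal"
  assumes [measurable]: "f \<in> borel_measurable borel" and "c \<noteq> 0"
  shows "(\<integral>\<^sup>+x. f x \<partial>lborel) = ennreal (\<bar>c\<bar> ^ DIM('a)) * (\<integral>\<^sup>+x. f (t + c *\<^sub>R x) \<partial>lborel)"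
  by (subst lborel_affine[OF \<open>c \<noteq> 0\<close>, of t])
     (simp add: nn_integral_density nn_integral_distr nn_integral_cmult)

text \<open>Uniqueness of Haar measure, with the unit ball as the test set that fixes the constant.\<close>

lemma nn_integral_lborel_isometry:
  fixes f :: "'a::euclidean_space \<Rightarrow> ennreal" and U :: "'a \<Rightarrow> 'a"
  assumes [measurable]: "f \<in> borel_measurable borel" and "linear U" and nU: "\<And>x. norm (U x) = norm x"
  shows "(\<integral>\<^sup>+x. f (U x) \<partial>lborel) = (\<integral>\<^sup>+x. f x \<partial>lborel)"
proof -
  interpret U: linear U by fact
  have [measurable]: "U \<in> borel_measurable borel"
    using \<open>linear U\<close> by (intro borel_measurable_continuous_onI linear_continuous_on) (simp add: linear_conv_bounded_linear)
  have "inj U"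
    unfolding inj_def using nU by (metis U.diff eq_iff_diff_eq_0 norm_eq_zero)
  then have "surj U"
    using \<open>linear U\<close> linear_injective_imp_surjective by blast
  define V where "V = inv U"
  have UV: "U (V y) = y" for y
    using \<open>surj U\<close> by (simp add: V_def surj_f_inv_f)
  define b :: "'a \<Rightarrow> ennreal" where "b x = indicator (ball 0 1) x" for x
  have [measurable]: "b \<in> borel_measurable borel" unfolding b_def by measurable
  have bU: "b (U x) = b x" for x by (simp add: b_def nU indicator_def)
  have shift: "(\<integral>\<^sup>+x. h (c + x) \<partial>lborel) = (\<integral>\<^sup>+x. h x \<partial>lborel)"
    if "h \<in> borel_measurable borel" for h :: "'a \<Rightarrow> ennreal" and c
    using nn_integral_lborel_affine[OF that, of 1 c] by simp
  have reflect: "(\<integral>\<^sup>+x. h (c - x) \<partial>lborel) = (\<integral>\<^sup>+x. h x \<partial>lborel)"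
    if "h \<in> borel_measurable borel" for h :: "'a \<Rightarrow> ennreal" and c
    using nn_integral_lborel_affine[OF that, of "-1" c] by simp
  \<comment> \<open>The pivot is the double integral of \<open>f (U x) * b (U x + y)\<close>.
    Integrating over \<open>y\<close> gives the left side; shifting \<open>x\<close> by
    \<open>- V y\<close> and using the invariance of \<open>b\<close> under \<open>U\<close> gives
    the right side.\<close>
  have "(\<integral>\<^sup>+x. f (U x) \<partial>lborel) * (\<integral>\<^sup>+y. b y \<partial>lborel) = (\<integral>\<^sup>+x. (\<integral>\<^sup>+y. f (U x) * b y \<partial>lborel) \<partial>lborel)"
    by (simp add: nn_integral_cmult nn_integral_multc)
  also have "\<dots> = (\<integral>\<^sup>+x. (\<integral>\<^sup>+y. f (U x) * b (U x + y) \<partial>lborel) \<partial>lborel)"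
    by (intro nn_integral_cong shift[symmetric]) measurable
  also have "\<dots> = (\<integral>\<^sup>+y. (\<integral>\<^sup>+x. f (U x) * b (U x + y) \<partial>lborel) \<partial>lborel)"
    by (rule lborel_pair.Fubini') measurable
  also have "\<dots> = (\<integral>\<^sup>+y. (\<integral>\<^sup>+x. f (U (- V y + x)) * b (U (- V y + x) + y) \<partial>lborel) \<partial>lborel)"
    by (intro nn_integral_cong shift[symmetric]) measurable
  also have "\<dots> = (\<integral>\<^sup>+y. (\<integral>\<^sup>+x. f (U x - y) * b x \<partial>lborel) \<partial>lborel)"
    by (simp add: U.diff UV bU)
  also have "\<dots> = (\<integral>\<^sup>+x. (\<integral>\<^sup>+y. f (U x - y) * b x \<partial>lborel) \<partial>lborel)"
    by (rule lborel_pair.Fubini') measurable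
  also have "\<dots> = (\<integral>\<^sup>+x. f x \<partial>lborel) * (\<integral>\<^sup>+y. b y \<partial>lborel)"
    by (simp add: nn_integral_cmult nn_integral_multc reflect)
  finally have eq: "(\<integral>\<^sup>+x. f (U x) \<partial>lborel) * (\<integral>\<^sup>+y. b y \<partial>lborel) = (\<integral>\<^sup>+x. f x \<partial>lborel) * (\<integral>\<^sup>+y. b y \<partial>lborel)" .
  have "(\<integral>\<^sup>+y. b y \<partial>lborel) = emeasure lborel (ball (0::'a) 1)"
    by (simp add: b_def)
  moreover have "emeasure lborel (ball (0::'a) 1) \<noteq> 0"
    using content_ball_pos[of 1 "0 :: 'a"] by (auto simp: measure_def)
  moreover have "emeasure lborel (ball (0::'a) 1) < \<infinity>"
    using emeasure_lborel_ball_finite by blast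
  ultimately show ?thesis
    using ennreal_mult_right_cancel[OF eq] by simp
qed

section \<open>The Hermitian inner product and unitary maps\<close>

definition cinner :: "complex ^ 'n \<Rightarrow> complex ^ 'n \<Rightarrow> complex" where
  "cinner z w = (\<Sum>k\<in>UNIV. z $ k * cnj (w $ k))"

lemma cinner_diff_left: "cinner (x - y) w = cinner x w - cinner y w"
  and cinner_diff_right: "cinner w (x - y) = cinner w x - cinner w y"
  and cinner_add_left: "cinner (x + y) w = cinner x w + cinner y w"
  and cinner_smult_left: "cinner (c *s x) w = c * cinner x w"
  and cinner_smult_right: "cinner w (c *s x) = cnj c * cinner w x"
  unfolding cinner_def
  by (simp_all add: algebra_simps sum.distrib sum_subtractf sum_distrib_left)

lemma cinner_cnj: "cinner w z = cnj (cinner z w)"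
  by (simp add: cinner_def mult.commute)

lemma cinner_self: "cinner z z = of_real ((norm z)\<^sup>2)"
  unfolding cinner_def norm_vec_def L2_set_def
  by (simp add: sum_nonneg complex_norm_square del: of_real_power)

lemma cinner_axis_right: "cinner z (axis k c) = z $ k * cnj c"
  by (simp add: cinner_def axis_def if_distrib[of cnj] if_distrib[of "\<lambda>x. _ * x"] cong: if_cong)

lemma cmod_cinner_le: "cmod (cinner z w) \<le> norm z * norm w"
proof -
  have "cmod (cinner z w) \<le> (\<Sum>k\<in>UNIV. \<bar>cmod (z $ k)\<bar> * \<bar>cmod (w $ k)\<bar>)"
    unfolding cinner_def by (rule order_trans[OF norm_sum]) (simp add: norm_mult)
  also have "\<dots> \<le> norm z * norm w"
    unfolding norm_vec_def by (rule L2_set_mult_ineq)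
  finally show ?thesis .
qed

text \<open>\<open>linear\<close> is real linearity, hence the separate clause on complex scalars.
  Invertibility follows from the isometry, since the dimension is finite.\<close>

definition unitary_map :: "(complex ^ 'n \<Rightarrow> complex ^ 'n) \<Rightarrow> bool" where
  "unitary_map U \<longleftrightarrow> linear U \<and> (\<forall>c v. U (c *s v) = c *s U v) \<and> (\<forall>v. norm (U v) = norm v)"

text \<open>\<open>U\<close> is a Householder reflection composed with multiplication by a phase.\<close>

lemma unitary_to_axis:
  fixes e :: "complex ^ 'n"
  assumes e: "norm e = 1"
  obtains U :: "complex ^ 'n \<Rightarrow> complex ^ 'n" where "unitary_map U" "\<And>z. U z $ k = cinner z e"
proof -
  \<comment> \<open>The phase makes the inner product of \<open>e\<close> with
    \<open>axis k c\<close> real. Reflection along the difference \<open>w\<close> of these two unit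
    vectors then carries \<open>e\<close> to \<open>axis k c\<close>, and the factor
    \<open>cnj c\<close> in \<open>U\<close> removes the phase.\<close>
  define c where "c = (if e $ k = 0 then 1 else e $ k / cmod (e $ k))"
  have c: "cmod c = 1" "e $ k = cmod (e $ k) * c"
    by (auto simp: c_def norm_divide)
  have cc: "cnj c * c = 1" "c * cnj c = 1"
    using complex_norm_square[of c] c by (simp_all add: mult.commute)
  define w where "w = e - axis k c"
  define N where "N = 2 - 2 * cmod (e $ k)"
  have N: "(norm w)\<^sup>2 = N"
  proof -
    have "complex_of_real ((norm w)\<^sup>2) = cinner w w" by (simp add: cinner_self)
    also have "\<dots> = cinner e e - cinner e (axis k c) - cnj (cinner e (axis k c)) + cinner (axis k c) (axis k c)"
      by (simp add: w_def cinner_diff_left cinner_diff_right cinner_cnj[of "axis k c" e])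
    also have "cinner e (axis k c) = cmod (e $ k)"
      using c(2) cc by (simp add: cinner_axis_right) (metis mult.assoc mult.right_neutral)
    also have "cinner (axis k c) (axis k c) = 1"
      using c by (simp add: cinner_self)
    finally have "complex_of_real ((norm w)\<^sup>2) = of_real N"
      using e by (simp add: cinner_self N_def)
    then show ?thesis by (simp only: of_real_eq_iff)
  qed
  \<comment> \<open>\<open>N\<close> is the squared norm of \<open>w\<close>. If it is 0, then
    \<open>e\<close> already is \<open>axis k c\<close>, and division by zero turns the reflection
    into the identity, as wanted.\<close>
  define U where "U z = cnj c *s (z - (2 * cinner z w / N) *s w)" for z
  show ?thesis
  proof (rule that[of U])
    have nU: "norm (U z) = norm z" for z
    proof -
      define a where "a = 2 * cinner z w / N"
      have aN: "a * N = 2 * cinner z w" "cnj a * N = 2 * cnj (cinner z w)"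
        using N by (cases "N = 0"; simp add: a_def cinner_def)+
      have "cnj a * cinner z w + a * cnj (cinner z w) = a * cnj a * N"
      proof -
        have h: "cnj (cinner z w) = cnj a * N / 2" "cinner z w = a * N / 2"
          using aN by simp_all
        show ?thesis unfolding h(1) unfolding h(2) by (simp add: algebra_simps)
      qed
      then have "cinner (z - a *s w) (z - a *s w) = cinner z z"
        using cinner_self[of w] N
        by (simp add: cinner_diff_left cinner_diff_right cinner_smult_left cinner_smult_right cinner_cnj[of w z] algebra_simps)
      then have "(norm (z - a *s w))\<^sup>2 = (norm z)\<^sup>2"
        unfolding cinner_self of_real_eq_iff .
      then have "norm (z - a *s w) = norm z" by simp
      then show ?thesis unfolding U_def norm_vector_smult_complex a_def by (simp only: complex_mod_cnj c mult_1)
    qed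
    have "linear U"
      unfolding U_def
      by (intro linearI) (simp_all add: vec_eq_iff cinner_add_left scaleR_eq_smult cinner_smult_left add_divide_distrib algebra_simps)
    moreover have "U (d *s v) = d *s U v" for d v
      by (simp add: U_def vec_eq_iff cinner_smult_left algebra_simps)
    ultimately show "unitary_map U" using nU by (simp add: unitary_map_def)
    fix z
    show "U z $ k = cinner z e"
    proof (cases "N = 0")
      case True
      then have "w = 0" using N by simp
      then have "cinner z e = cinner z (axis k c)" by (simp add: w_def)
      then show ?thesis using \<open>w = 0\<close> by (simp add: U_def cinner_axis_right)
    next
      case False
      have "w $ k = e $ k - c" by (simp add: w_def)
      also have "\<dots> = of_real (cmod (e $ k)) * c - c"
        using arg_cong[OF c(2), of "\<lambda>x. x - c"] .
      also have "\<dots> = - (of_real N / 2) * c"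
        by (simp add: N_def field_simps)
      finally have "w $ k = - (of_real N / 2) * c" .
      then have E: "(2 * cinner z w / N) * w $ k = - (cinner z w * c)"
        using False by simp
      have "U z $ k = cnj c * (z $ k - (2 * cinner z w / N) * w $ k)"
        by (simp only: U_def vector_smult_component vector_minus_component)
      also have "\<dots> = cnj c * z $ k + cinner z w * (cnj c * c)"
        unfolding E by (simp add: algebra_simps)
      also have "cinner z w = cinner z e - z $ k * cnj c"
        by (simp add: w_def cinner_diff_right cinner_axis_right)
      finally show ?thesis by (simp add: cc)
    qed
  qed
qed

lemma unitary_map_inverse:
  assumes "unitary_map U"
  obtains V where "unitary_map V" "\<And>x. U (V x) = x" "\<And>x. V (U x) = x"
proof -
  have lin: "linear U" and sm: "\<And>c v. U (c *s v) = c *s U v" and nU: "\<And>v. norm (U v) = norm v"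
    using assms by (auto simp: unitary_map_def)
  interpret U: linear U by fact
  have inj: "inj U"
    unfolding inj_def using nU by (metis U.diff eq_iff_diff_eq_0 norm_eq_zero)
  then have "surj U"
    using lin linear_injective_imp_surjective by blast
  define V where "V = inv U"
  have UV: "U (V x) = x" and VU: "V (U x) = x" for x
    using \<open>surj U\<close> inj by (auto simp: V_def surj_f_inv_f)
  have "unitary_map V"
    unfolding unitary_map_def
  proof (intro conjI allI linearI)
    show "V (x + y) = V x + V y" for x y by (metis U.add UV VU)
    show "V (r *\<^sub>R x) = r *\<^sub>R V x" for r x by (metis U.scaleR UV VU)
    show "V (c *s v) = c *s V v" for c v by (metis sm UV VU)
    show "norm (V v) = norm v" for v by (metis nU UV)
  qed
  with UV VU show ?thesis using that by blast
qed

lemma unitary_map_smult: "cmod c = 1 \<Longrightarrow> unitary_map (\<lambda>v. c *s v)"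
  unfolding unitary_map_def
  by (auto intro!: linearI simp: vec_eq_iff algebra_simps)

section \<open>The sphere measure, polar coordinates and non-isotropic dilations\<close>

abbreviation ball_volume :: "'n::finite itself \<Rightarrow> ennreal" where
  "ball_volume TYPE('n::finite) \<equiv> emeasure lborel (ball 0 1 :: (complex ^ 'n) set)"

lemma ball_volume_pos: "ball_volume TYPE('n::finite) \<noteq> 0"
  using content_ball_pos[of 1 "0 :: complex ^ 'n"] by (auto simp: measure_def)

lemma ball_volume_finite: "ball_volume TYPE('n::finite) \<noteq> \<infinity>"
  using emeasure_lborel_ball_finite[of "0 :: complex ^ 'n" 1] by auto

lemma sets_sphere_measure: "sets (sphere_measure :: (complex ^ 'n) measure) = sets (restrict_space borel (sphere 0 1))"
  unfolding sphere_measure_def by (intro sets_restrict_space_cong) simp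

lemma measurable_sphere_measureI:
  "u \<in> borel_measurable borel \<Longrightarrow> u \<in> borel_measurable (sphere_measure :: (complex ^ 'n) measure)"
  using measurable_cong_sets[OF sets_sphere_measure refl] measurable_restrict_space1 by blast

lemma nn_integral_sphere_measure:
  fixes u :: "complex ^ 'n \<Rightarrow> ennreal"
  assumes [measurable]: "u \<in> borel_measurable borel"
  shows "(\<integral>\<^sup>+\<zeta>. u \<zeta> \<partial>sphere_measure) * ball_volume TYPE('n) = (\<integral>\<^sup>+z. u (z /\<^sub>R norm z) * indicator (ball 0 1) z \<partial>lborel)"
proof -
  let ?p = "\<lambda>z :: complex ^ 'n. z /\<^sub>R norm z"
  have "(\<integral>\<^sup>+\<zeta>. u \<zeta> \<partial>sphere_measure) =
    (\<integral>\<^sup>+\<zeta>. u \<zeta> * indicator (sphere 0 1) \<zeta> \<partial>distr (uniform_measure lborel (ball 0 1)) borel ?p)"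
    unfolding sphere_measure_def by (subst nn_integral_restrict_space) auto
  also have "\<dots> = (\<integral>\<^sup>+z. u (?p z) * indicator (sphere 0 1) (?p z) \<partial>uniform_measure lborel (ball 0 1))"
    by (subst nn_integral_distr) auto
  also have "\<dots> = (\<integral>\<^sup>+z. u (?p z) * indicator (sphere 0 1) (?p z) * indicator (ball 0 1) z \<partial>lborel) / ball_volume TYPE('n)"
    by (subst nn_integral_uniform_measure) auto
  also have "(\<integral>\<^sup>+z. u (?p z) * indicator (sphere 0 1) (?p z) * indicator (ball 0 1) z \<partial>lborel) =
     (\<integral>\<^sup>+z. u (?p z) * indicator (ball 0 1) z \<partial>lborel)"
    by (rule nn_integral_lborel_cong_except[of 0]) (auto simp: indicator_def)
  finally show ?thesis
    using ball_volume_pos[where 'n = 'n] ball_volume_finite[where 'n = 'n]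
    by (simp add: ennreal_divide_times ennreal_divide_self top.not_eq_extremum flip: ennreal_times_divide)
qed

lemma emeasure_sphere_space: "emeasure sphere_measure (space (sphere_measure :: (complex ^ 'n) measure)) = 1"
  by (simp add: space_sphere_measure emeasure_sphere_measure_sphere)

lemma finite_measure_sphere: "finite_measure (sphere_measure :: (complex ^ 'n) measure)"
  by (rule finite_measureI) (simp add: emeasure_sphere_space)

text \<open>A unitary map commutes with the radial projection and preserves Lebesgue measure on the
  ball, so it preserves the projected measure.\<close>

lemma nn_integral_sphere_unitary:
  fixes u :: "complex ^ 'n \<Rightarrow> ennreal"
  assumes [measurable]: "u \<in> borel_measurable borel" and U: "unitary_map U"
  shows "(\<integral>\<^sup>+\<zeta>. u (U \<zeta>) \<partial>sphere_measure) = (\<integral>\<^sup>+\<zeta>. u \<zeta> \<partial>sphere_measure)"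
proof -
  have lin: "linear U" and nU: "\<And>v. norm (U v) = norm v"
    using U by (auto simp: unitary_map_def)
  interpret U: linear U by fact
  have [measurable]: "U \<in> borel_measurable borel"
    using lin by (intro borel_measurable_continuous_onI linear_continuous_on) (simp add: linear_conv_bounded_linear)
  have "(\<integral>\<^sup>+\<zeta>. u (U \<zeta>) \<partial>sphere_measure) * ball_volume TYPE('n) =
      (\<integral>\<^sup>+z. u (U (z /\<^sub>R norm z)) * indicator (ball 0 1) z \<partial>lborel)"
    by (rule nn_integral_sphere_measure) measurable
  also have "\<dots> = (\<integral>\<^sup>+z. u (U z /\<^sub>R norm (U z)) * indicator (ball 0 1) (U z) \<partial>lborel)"
    by (intro nn_integral_cong) (simp add: U.scaleR nU indicator_def)
  also have "\<dots> = (\<integral>\<^sup>+z. u (z /\<^sub>R norm z) * indicator (ball 0 1) z \<partial>lborel)"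
    by (rule nn_integral_lborel_isometry[OF _ lin nU]) measurable
  also have "\<dots> = (\<integral>\<^sup>+\<zeta>. u \<zeta> \<partial>sphere_measure) * ball_volume TYPE('n)"
    by (rule nn_integral_sphere_measure[symmetric]) measurable
  finally show ?thesis
    by (rule ennreal_mult_right_cancel) (fact ball_volume_pos ball_volume_finite)+
qed

text \<open>This is the inner integral over the dilation factor in the polar coordinate
  formula.\<close>

lemma nn_integral_powr_tail:
  assumes "0 < a" "0 < m"
  shows "(\<integral>\<^sup>+s. ennreal (1 / s ^ Suc m) * (if a < s then 1 else 0) \<partial>lborel) = ennreal (1 / (real m * a ^ m))"
proof -
  have "((\<lambda>s. s powr (- real m - 1)) has_integral - (a powr (- real m - 1 + 1)) / (- real m - 1 + 1)) {a..}"
    using assms by (intro has_integral_powr_to_inf) auto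
  then have "((\<lambda>s. s powr (- real m - 1)) has_integral 1 / (real m * a ^ m)) {a..}"
    using assms by (simp add: powr_minus powr_realpow field_simps)
  then have "(\<integral>\<^sup>+s. ennreal (s powr (- real m - 1)) * indicator {a..} s \<partial>lborel) = ennreal (1 / (real m * a ^ m))"
    by (intro nn_integral_has_integral_lebesgue') auto
  moreover have "(\<integral>\<^sup>+s. ennreal (1 / s ^ Suc m) * (if a < s then 1 else 0) \<partial>lborel) =
    (\<integral>\<^sup>+s. ennreal (s powr (- real m - 1)) * indicator {a..} s \<partial>lborel)"
  proof (rule nn_integral_lborel_cong_except[of a])
    fix s assume "s \<noteq> a"
    have "s powr (- real m - 1) = 1 / s ^ Suc m" if "0 < s"
    proof -
      have "- real m - 1 = - real (Suc m)" by simp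
      then show ?thesis by (simp only: powr_minus powr_realpow[OF that] inverse_eq_divide)
    qed
    then show "ennreal (1 / s ^ Suc m) * (if a < s then 1 else 0) = ennreal (s powr (- real m - 1)) * indicator {a..} s"
      using \<open>s \<noteq> a\<close> \<open>0 < a\<close> by (auto simp: indicator_def)
  qed
  ultimately show ?thesis by simp
qed

lemma DIM_complex_vec: "DIM(complex ^ 'n) = 2 * CARD('n)"
  by simp

text \<open>Polar coordinates without a Jacobian: both sides are iterated integrals over \<open>s\<close> and \<open>z\<close>
  of \<open>u (s z)\<close>, once in the variable \<open>r = s \<bar>z\<bar>\<close> and once in \<open>w = s z\<close>.\<close>

lemma nn_integral_polar:
  fixes u :: "complex ^ 'n \<Rightarrow> ennreal"
  assumes [measurable]: "u \<in> borel_measurable borel"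
  defines "m \<equiv> 2 * CARD('n)"
  shows "(\<integral>\<^sup>+w. u w * ennreal (1 / norm w ^ (m - 1)) * indicator (ball 0 1) w \<partial>lborel)
    = ennreal m * ball_volume TYPE('n) * (\<integral>\<^sup>+r. (\<integral>\<^sup>+\<zeta>. u (r *\<^sub>R \<zeta>) \<partial>sphere_measure) * indicator {0<..<1} r \<partial>lborel)"
proof -
  have m: "0 < m" by (simp add: m_def)
  let ?B = "ball 0 1 :: (complex ^ 'n) set"
  have "ball_volume TYPE('n) * (\<integral>\<^sup>+r. (\<integral>\<^sup>+\<zeta>. u (r *\<^sub>R \<zeta>) \<partial>sphere_measure) * indicator {0<..<1} r \<partial>lborel)
    = (\<integral>\<^sup>+r. ball_volume TYPE('n) * ((\<integral>\<^sup>+\<zeta>. u (r *\<^sub>R \<zeta>) \<partial>sphere_measure) * indicator {0<..<1} r) \<partial>lborel)"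
  proof (rule nn_integral_cmult[symmetric])
    have "(\<lambda>r. (\<integral>\<^sup>+z. u (r *\<^sub>R (z /\<^sub>R norm z)) * indicator ?B z \<partial>lborel) / ball_volume TYPE('n)) \<in> borel_measurable borel"
      by measurable
    moreover have "(\<integral>\<^sup>+\<zeta>. u (r *\<^sub>R \<zeta>) \<partial>sphere_measure) =
       (\<integral>\<^sup>+z. u (r *\<^sub>R (z /\<^sub>R norm z)) * indicator ?B z \<partial>lborel) / ball_volume TYPE('n)" for r
      using ball_volume_pos[where 'n = 'n] ball_volume_finite[where 'n = 'n]
      by (subst nn_integral_sphere_measure[symmetric])
         (auto simp: ennreal_mult_divide_eq top.not_eq_extremum)
    ultimately have [measurable]: "(\<lambda>r. \<integral>\<^sup>+\<zeta>. u (r *\<^sub>R \<zeta>) \<partial>sphere_measure) \<in> borel_measurable borel"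
      by simp
    show "(\<lambda>r. (\<integral>\<^sup>+\<zeta>. u (r *\<^sub>R \<zeta>) \<partial>sphere_measure) * indicator {0<..<1} r) \<in> borel_measurable lborel"
      by measurable
  qed
  also have "\<dots> = (\<integral>\<^sup>+r. (\<integral>\<^sup>+z. u (r *\<^sub>R (z /\<^sub>R norm z)) * indicator ?B z * indicator {0<..<1} r \<partial>lborel) \<partial>lborel)"
  proof (intro nn_integral_cong)
    fix r :: real
    have "ball_volume TYPE('n) * ((\<integral>\<^sup>+\<zeta>. u (r *\<^sub>R \<zeta>) \<partial>sphere_measure) * indicator {0<..<1} r) =
      (\<integral>\<^sup>+\<zeta>. u (r *\<^sub>R \<zeta>) \<partial>sphere_measure) * ball_volume TYPE('n) * indicator {0<..<1} r"
      by (simp add: mult_ac)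
    also have "\<dots> = (\<integral>\<^sup>+z. u (r *\<^sub>R (z /\<^sub>R norm z)) * indicator ?B z \<partial>lborel) * indicator {0<..<1} r"
      by (subst nn_integral_sphere_measure) auto
    also have "\<dots> = (\<integral>\<^sup>+z. u (r *\<^sub>R (z /\<^sub>R norm z)) * indicator ?B z * indicator {0<..<1} r \<partial>lborel)"
      by (rule nn_integral_multc[symmetric]) measurable
    finally show "ball_volume TYPE('n) * ((\<integral>\<^sup>+\<zeta>. u (r *\<^sub>R \<zeta>) \<partial>sphere_measure) * indicator {0<..<1} r) = \<dots>" .
  qed
  also have "\<dots> = (\<integral>\<^sup>+z. (\<integral>\<^sup>+r. u (r *\<^sub>R (z /\<^sub>R norm z)) * indicator ?B z * indicator {0<..<1} r \<partial>lborel) \<partial>lborel)"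
    by (rule lborel_pair.Fubini') measurable
  also have "\<dots> = (\<integral>\<^sup>+z. (\<integral>\<^sup>+s. u (s *\<^sub>R z) * ennreal (norm z) * indicator ?B z * indicator {0<..<1} (s * norm z) \<partial>lborel) \<partial>lborel)"
  proof (rule nn_integral_lborel_cong_except[of 0])
    fix z :: "complex ^ 'n" assume z: "z \<noteq> 0"
    have "(\<integral>\<^sup>+r. u (r *\<^sub>R (z /\<^sub>R norm z)) * indicator ?B z * indicator {0<..<1} r \<partial>lborel) =
      ennreal \<bar>norm z\<bar> * (\<integral>\<^sup>+s. u ((0 + norm z * s) *\<^sub>R (z /\<^sub>R norm z)) * indicator ?B z * indicator {0<..<1} (0 + norm z * s) \<partial>lborel)"
      using z by (intro nn_integral_real_affine) auto
    also have "\<dots> = (\<integral>\<^sup>+s. ennreal \<bar>norm z\<bar> * (u ((0 + norm z * s) *\<^sub>R (z /\<^sub>R norm z)) * indicator ?B z * indicator {0<..<1} (0 + norm z * s)) \<partial>lborel)"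
      by (rule nn_integral_cmult[symmetric]) measurable
    also have "\<dots> = (\<integral>\<^sup>+s. u (s *\<^sub>R z) * ennreal (norm z) * indicator ?B z * indicator {0<..<1} (s * norm z) \<partial>lborel)"
      using z by (intro nn_integral_cong) (simp add: mult_ac)
    finally show "(\<integral>\<^sup>+r. u (r *\<^sub>R (z /\<^sub>R norm z)) * indicator ?B z * indicator {0<..<1} r \<partial>lborel) = \<dots>" .
  qed
  also have "\<dots> = (\<integral>\<^sup>+s. (\<integral>\<^sup>+z. u (s *\<^sub>R z) * ennreal (norm z) * indicator ?B z * indicator {0<..<1} (s * norm z) \<partial>lborel) \<partial>lborel)"
    by (rule lborel_pair.Fubini') measurable
  \<comment> \<open>The dilation \<open>w = s z\<close> in real dimension \<open>m\<close>
    contributes \<open>s\<close> to the power \<open>- m\<close>, and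
    \<open>norm z = norm w / s\<close> one more; hence \<open>Suc m\<close>. The two cut-offs change
    places: \<open>norm z < 1\<close> becomes \<open>norm w < s\<close>, and
    \<open>s * norm z < 1\<close> becomes membership of \<open>w\<close> in the ball.\<close>
  also have "\<dots> = (\<integral>\<^sup>+s. (\<integral>\<^sup>+w. u w * ennreal (norm w) * indicator ?B w * (ennreal (1 / s ^ Suc m) * (if norm w < s then 1 else 0)) \<partial>lborel) \<partial>lborel)"
  proof (rule nn_integral_cong)
    fix s :: real
    show "(\<integral>\<^sup>+z. u (s *\<^sub>R z) * ennreal (norm z) * indicator ?B z * indicator {0<..<1} (s * norm z) \<partial>lborel)
      = (\<integral>\<^sup>+w. u w * ennreal (norm w) * indicator ?B w * (ennreal (1 / s ^ Suc m) * (if norm w < s then 1 else 0)) \<partial>lborel)"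
    proof (cases "0 < s")
      case True
      have "(\<integral>\<^sup>+w. u w * ennreal (norm w) * indicator ?B w * (ennreal (1 / s ^ Suc m) * (if norm w < s then 1 else 0)) \<partial>lborel)
        = ennreal (\<bar>s\<bar> ^ DIM(complex ^ 'n)) * (\<integral>\<^sup>+z. u (0 + s *\<^sub>R z) * ennreal (norm (0 + s *\<^sub>R z)) * indicator ?B (0 + s *\<^sub>R z) *
          (ennreal (1 / s ^ Suc m) * (if norm (0 + s *\<^sub>R z) < s then 1 else 0)) \<partial>lborel)"
        using True by (intro nn_integral_lborel_affine) auto
      also have "\<dots> = (\<integral>\<^sup>+z. ennreal (\<bar>s\<bar> ^ DIM(complex ^ 'n)) * (u (0 + s *\<^sub>R z) * ennreal (norm (0 + s *\<^sub>R z)) * indicator ?B (0 + s *\<^sub>R z) *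
          (ennreal (1 / s ^ Suc m) * (if norm (0 + s *\<^sub>R z) < s then 1 else 0))) \<partial>lborel)"
        by (rule nn_integral_cmult[symmetric]) measurable
      also have "\<dots> = (\<integral>\<^sup>+z. u (s *\<^sub>R z) * ennreal (norm z) * indicator ?B z * indicator {0<..<1} (s * norm z) \<partial>lborel)"
      proof (rule nn_integral_lborel_cong_except[of 0])
        fix z :: "complex ^ 'n" assume z: "z \<noteq> 0"
        have ind: "indicator ?B (s *\<^sub>R z) = (indicator {0<..<1} (s * norm z) :: ennreal)"
          "(if norm (s *\<^sub>R z) < s then 1 else 0) = (indicator ?B z :: ennreal)"
          using True z by (auto simp: indicator_def)
        have "ennreal (s ^ m) * (ennreal (s * norm z) * ennreal (1 / s ^ Suc m)) = ennreal (norm z)"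
          using True by (simp add: ennreal_mult[symmetric])
        then have "ennreal (s ^ m) * (A * ennreal (s * norm z) * B * (ennreal (1 / s ^ Suc m) * C)) = A * ennreal (norm z) * C * B" for A B C
          by (metis (no_types, lifting) mult.assoc mult.commute)
        then show "ennreal (\<bar>s\<bar> ^ DIM(complex ^ 'n)) * (u (0 + s *\<^sub>R z) * ennreal (norm (0 + s *\<^sub>R z)) * indicator ?B (0 + s *\<^sub>R z) *
          (ennreal (1 / s ^ Suc m) * (if norm (0 + s *\<^sub>R z) < s then 1 else 0))) = u (s *\<^sub>R z) * ennreal (norm z) * indicator ?B z * indicator {0<..<1} (s * norm z)"
          using True unfolding add_0 ind DIM_complex_vec m_def[symmetric] by simp
      qed
      finally show ?thesis ..
    next
      case False
      then have "indicator {0<..<1} (s * norm z) = (0 :: ennreal)" "(if norm z < s then 1 else 0) = (0 :: ennreal)" for z :: "complex ^ 'n"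
        using mult_nonpos_nonneg[of s "norm z"] order.strict_trans1[OF norm_ge_zero[of z], of s]
        by (auto simp: indicator_def)
      then show ?thesis by simp
    qed
  qed
  also have "\<dots> = (\<integral>\<^sup>+w. (\<integral>\<^sup>+s. u w * ennreal (norm w) * indicator ?B w * (ennreal (1 / s ^ Suc m) * (if norm w < s then 1 else 0)) \<partial>lborel) \<partial>lborel)"
    by (rule lborel_pair.Fubini') measurable
  \<comment> \<open>The tail integral is 1 over \<open>m * norm w ^ m\<close>; the factor
    \<open>norm w\<close> already present lowers the power to \<open>m - 1\<close>.\<close>
  also have "\<dots> = (\<integral>\<^sup>+w. ennreal (1 / m) * (u w * ennreal (1 / norm w ^ (m - 1)) * indicator ?B w) \<partial>lborel)"
  proof (rule nn_integral_lborel_cong_except[of 0])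
    fix w :: "complex ^ 'n" assume w: "w \<noteq> 0"
    have "norm w ^ m = norm w * norm w ^ (m - 1)" using m by (metis Suc_diff_1 power_Suc)
    then have "norm w * (1 / (real m * norm w ^ m)) = 1 / m * (1 / norm w ^ (m - 1))"
      using w by simp
    then have e: "ennreal (norm w) * ennreal (1 / (real m * norm w ^ m)) = ennreal (1 / m) * ennreal (1 / norm w ^ (m - 1))"
      by (simp add: ennreal_mult[symmetric] del: ennreal_1 divide_inverse)
    have "(\<integral>\<^sup>+s. u w * ennreal (norm w) * indicator ?B w * (ennreal (1 / s ^ Suc m) * (if norm w < s then 1 else 0)) \<partial>lborel)
      = u w * ennreal (norm w) * indicator ?B w * ennreal (1 / (real m * norm w ^ m))"
      using w m by (subst nn_integral_cmult, measurable, subst nn_integral_powr_tail) auto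
    also have "\<dots> = u w * (ennreal (norm w) * ennreal (1 / (real m * norm w ^ m))) * indicator ?B w"
      by (simp only: mult_ac)
    also have "\<dots> = ennreal (1 / m) * (u w * ennreal (1 / norm w ^ (m - 1)) * indicator ?B w)"
      unfolding e by (simp only: mult_ac)
    finally show "(\<integral>\<^sup>+s. u w * ennreal (norm w) * indicator ?B w * (ennreal (1 / s ^ Suc m) * (if norm w < s then 1 else 0)) \<partial>lborel) = \<dots>" .
  qed
  also have "\<dots> = ennreal (1 / m) * (\<integral>\<^sup>+w. u w * ennreal (1 / norm w ^ (m - 1)) * indicator ?B w \<partial>lborel)"
    by (rule nn_integral_cmult) measurable
  finally have "ennreal m * (ball_volume TYPE('n) * (\<integral>\<^sup>+r. (\<integral>\<^sup>+\<zeta>. u (r *\<^sub>R \<zeta>) \<partial>sphere_measure) * indicator {0<..<1} r \<partial>lborel))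
    = (ennreal m * ennreal (1 / m)) * (\<integral>\<^sup>+w. u w * ennreal (1 / norm w ^ (m - 1)) * indicator ?B w \<partial>lborel)"
    by (simp add: mult.assoc)
  also have "ennreal m * ennreal (1 / m) = 1"
    using m by (subst ennreal_mult[symmetric]) auto
  finally show ?thesis by (simp add: mult.assoc)
qed

definition aniso :: "'n \<Rightarrow> real \<Rightarrow> real \<Rightarrow> complex ^ 'n \<Rightarrow> complex ^ 'n" where
  "aniso k a b v = (\<chi> j. (if j = k then a else b) *\<^sub>R (v $ j))"

text \<open>Each complex coordinate is two real ones: the real basis vectors \<open>axis k 1\<close>
  and \<open>axis k \<i>\<close> are scaled by \<open>a\<close> and the remaining
  \<open>2 * (CARD('n) - 1)\<close> by \<open>b\<close>.\<close>

lemma nn_integral_aniso: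
  fixes f :: "complex ^ 'n \<Rightarrow> ennreal"
  assumes [measurable]: "f \<in> borel_measurable borel" and ab: "0 < a" "0 < b"
  shows "(\<integral>\<^sup>+x. f x \<partial>lborel) = ennreal (a\<^sup>2 * b ^ (2 * (CARD('n) - 1))) * (\<integral>\<^sup>+v. f (t + aniso k a b v) \<partial>lborel)"
proof -
  define c where "c i = (if i $ k \<noteq> 0 then a else b)" for i :: "complex ^ 'n"
  have T: "(\<Sum>j\<in>Basis. (c j * (x \<bullet> j)) *\<^sub>R j) = aniso k a b x" for x
  proof (rule euclidean_eqI)
    fix i :: "complex ^ 'n" assume i: "i \<in> Basis"
    then obtain l u where lu: "i = axis l u" "u \<in> Basis" by (auto simp: Basis_vec_def)
    have "(\<Sum>j\<in>Basis. (c j * (x \<bullet> j)) *\<^sub>R j) \<bullet> i = c i * (x \<bullet> i)"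
      using i by (simp add: inner_sum_left inner_Basis if_distrib cong: if_cong)
    also have "\<dots> = aniso k a b x \<bullet> i"
      using lu nonzero_Basis[OF lu(2)] by (auto simp: c_def aniso_def inner_axis) (auto simp: axis_def)
    finally show "(\<Sum>j\<in>Basis. (c j * (x \<bullet> j)) *\<^sub>R j) \<bullet> i = aniso k a b x \<bullet> i" .
  qed
  have A: "{i \<in> Basis. i $ k \<noteq> 0} = {axis k 1, axis k \<i>}"
  proof -
    have "axis l u $ k = (if k = l then u else 0)" for l and u :: complex
      by (simp add: axis_def)
    then show ?thesis by (auto simp: Basis_vec_def Basis_complex_def split: if_splits)
  qed
  have card: "card {axis k 1, axis k \<i> :: complex ^ 'n} = 2"
    by (simp add: axis_eq_axis complex_eq_iff)
  have "(\<Prod>j\<in>Basis. \<bar>c j\<bar>) = (\<Prod>j\<in>(Basis :: (complex ^ 'n) set). if j $ k \<noteq> 0 then a else b)"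
    using ab by (intro prod.cong) (auto simp: c_def)
  also have "\<dots> = a ^ card (Basis \<inter> {i :: complex ^ 'n. i $ k \<noteq> 0}) * b ^ card (Basis \<inter> - {i. i $ k \<noteq> 0} :: (complex ^ 'n) set)"
    by (subst prod.If_cases) auto
  also have "Basis \<inter> {i :: complex ^ 'n. i $ k \<noteq> 0} = {axis k 1, axis k \<i>}" using A by auto
  also have "Basis \<inter> - {i :: complex ^ 'n. i $ k \<noteq> 0} = Basis - {axis k 1, axis k \<i>}" using A by auto
  also have "card (Basis - {axis k 1, axis k \<i>} :: (complex ^ 'n) set) = 2 * (CARD('n) - 1)"
    using card by (subst card_Diff_subset) (auto simp: algebra_simps)
  finally have P: "(\<Prod>j\<in>Basis. \<bar>c j\<bar>) = a\<^sup>2 * b ^ (2 * (CARD('n) - 1))"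
    using card by simp
  have [measurable]: "(\<lambda>v. t + aniso k a b v) \<in> borel_measurable borel"
    unfolding T[symmetric] by measurable
  have "lborel = density (distr lborel borel (\<lambda>x. t + (\<Sum>j\<in>Basis. (c j * (x \<bullet> j)) *\<^sub>R j))) (\<lambda>_. \<Prod>j\<in>Basis. \<bar>c j\<bar>)"
    using ab by (intro lborel_affine_euclidean) (auto simp: c_def)
  then have "lborel = density (distr lborel borel (\<lambda>x. t + aniso k a b x)) (\<lambda>_. ennreal (a\<^sup>2 * b ^ (2 * (CARD('n) - 1))))"
    unfolding T P .
  then have "(\<integral>\<^sup>+x. f x \<partial>lborel) = (\<integral>\<^sup>+x. f x \<partial>density (distr lborel borel (\<lambda>x. t + aniso k a b x)) (\<lambda>_. ennreal (a\<^sup>2 * b ^ (2 * (CARD('n) - 1)))))"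
    by simp
  also have "\<dots> = ennreal (a\<^sup>2 * b ^ (2 * (CARD('n) - 1))) * (\<integral>\<^sup>+v. f (t + aniso k a b v) \<partial>lborel)"
    by (simp add: nn_integral_density nn_integral_distr nn_integral_cmult)
  finally show ?thesis .
qed

subsection \<open>Hardy spaces\<close>

text \<open>Elements of the Hardy spaces are unconstrained outside the ball, hence cut off for measurability.\<close>

definition modp :: "real \<Rightarrow> (complex ^ 'n \<Rightarrow> complex) \<Rightarrow> complex ^ 'n \<Rightarrow> ennreal" where
  "modp p f z = ennreal (cmod (indicat_real (ball 0 1) z *\<^sub>R f z) powr p)"

lemma modp_in_ball: "z \<in> ball 0 1 \<Longrightarrow> modp p f z = ennreal (cmod (f z) powr p)"
  by (simp add: modp_def)

lemma measurable_modp [measurable]: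
  assumes "f holomorphic_vec_on ball 0 1"
  shows "modp p f \<in> borel_measurable borel"
proof -
  have [measurable]: "(\<lambda>z. indicat_real (ball 0 1) z *\<^sub>R f z) \<in> borel_measurable borel"
    using holomorphic_vec_imp_continuous_on[OF assms] by (intro borel_measurable_continuous_on_indicator) auto
  show ?thesis unfolding modp_def by measurable
qed

lemma hardy_mean_modp:
  "hardy_mean p f = (SUP r\<in>{0<..<1}. \<integral>\<^sup>+\<zeta>. modp p f (r *\<^sub>R \<zeta>) \<partial>sphere_measure)"
  unfolding hardy_mean_def
  by (intro SUP_cong refl nn_integral_cong) (auto simp: modp_in_ball space_sphere_measure)

lemma hardy_mean_upper:
  "0 < r \<Longrightarrow> r < 1 \<Longrightarrow> (\<integral>\<^sup>+\<zeta>. modp p f (r *\<^sub>R \<zeta>) \<partial>sphere_measure) \<le> hardy_mean p f"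
  unfolding hardy_mean_modp by (rule SUP_upper) simp

text \<open>Poisson domination at the centre of a disc, where the kernel is 1 on the circle; it
  holds for every positive exponent, including \<open>p < 1\<close>.\<close>

lemma holomorphic_vec_submean:
  assumes f: "f holomorphic_vec_on ball 0 1" and p: "0 < p"
    and zv: "\<And>w. cmod w \<le> 1 \<Longrightarrow> z + w *s v \<in> ball 0 1"
  shows "modp p f z \<le> (\<integral>\<^sup>+y. modp p f (z + y *s v) \<partial>circle_measure)"
proof -
  have [measurable]: "(\<lambda>y. z + y *s v) \<in> borel_measurable borel"
    by (intro borel_measurable_continuous_onI continuous_intros
        bounded_linear.continuous_on[OF bounded_linear_smult_left])
  have [measurable]: "(\<lambda>y. modp p f (z + y *s v)) \<in> borel_measurable borel"
    using measurable_modp[OF f, of p] by measurable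
  have zB: "z \<in> ball 0 1" using zv[of 0] by simp
  have "ennreal (cmod (f (z + 0 *s v)) powr p) \<le>
      (\<integral>\<^sup>+y. ennreal (poisson 0 y) * modp p f (z + y *s v) \<partial>circle_measure)"
  proof (rule holomorphic_powr_le_poisson[where h = "\<lambda>w. f (z + w *s v)"])
    show "(\<lambda>w. f (z + w *s v)) holomorphic_on cball 0 1"
      using zv by (intro holomorphic_vec_line_holomorphic[OF f open_ball]) auto
    show "modp p f (z + y *s v) = ennreal (cmod (f (z + y *s v)) powr p)" if "cmod y = 1" for y
      using zv[of y] that by (intro modp_in_ball) simp
  qed (use p in auto)
  also have "\<dots> = (\<integral>\<^sup>+y. modp p f (z + y *s v) \<partial>circle_measure)"
    by (rule nn_integral_circle_cong) (auto simp: poisson_def)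
  finally show ?thesis using zB by (simp add: modp_in_ball)
qed

section \<open>Pointwise growth of Hardy functions\<close>

lemma norm_vec_power2: "(norm (x :: complex ^ 'n))\<^sup>2 = (cmod (x $ k))\<^sup>2 + (\<Sum>j\<in>UNIV - {k}. (cmod (x $ j))\<^sup>2)"
proof -
  have "(norm x)\<^sup>2 = (\<Sum>j\<in>UNIV. (cmod (x $ j))\<^sup>2)"
    by (simp add: norm_vec_def L2_set_def sum_nonneg)
  then show ?thesis by (simp add: sum.remove[of UNIV k])
qed

lemma norm_component_le: "cmod ((x :: complex ^ 'n) $ k) \<le> norm x"
  by (rule Finite_Cartesian_Product.norm_nth_le)

text \<open>The image of the ball is a non-isotropic ellipsoid about \<open>s\<close> times the \<open>k\<close>-th unit vector:
  the complex radial direction scales like \<open>\<delta>\<close>, the others like its square root.\<close>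

lemma aniso_ellipsoid:
  fixes v :: "complex ^ 'n" and k :: 'n
  assumes s: "0 \<le> s" "s < 1" and v: "v \<in> ball 0 1" and \<delta>: "\<delta> = 1 - s"
  defines "w \<equiv> s *\<^sub>R axis k 1 + aniso k (\<delta> / 2) (sqrt \<delta> / 2) v"
  shows "w \<in> ball 0 1" "1 - 3 / 2 * \<delta> \<le> norm w"
proof -
  have wk: "w $ k = of_real s + of_real (\<delta> / 2) * v $ k"
    by (simp add: w_def aniso_def) (simp add: scaleR_conv_of_real)
  have wj: "cmod (w $ j) = sqrt \<delta> / 2 * cmod (v $ j)" if "j \<noteq> k" for j
    using that s \<delta> by (simp add: w_def aniso_def axis_def)
  have vk: "cmod (v $ k) \<le> 1" using norm_component_le[of v k] v by simp
  have dk: "cmod (of_real (\<delta> / 2) * v $ k) = \<delta> / 2 * cmod (v $ k)"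
    unfolding norm_mult norm_of_real using s \<delta> by simp
  have dk1: "\<delta> / 2 * cmod (v $ k) \<le> \<delta> / 2"
    using mult_left_mono[OF vk, of "\<delta> / 2"] s \<delta> by simp
  have ns: "cmod (of_real s) = s" using s by simp
  have up: "cmod (w $ k) \<le> s + \<delta> / 2"
    unfolding wk using dk1 by (intro order_trans[OF norm_triangle_ineq]) (simp only: dk ns)
  have "(\<Sum>j\<in>UNIV - {k}. (cmod (w $ j))\<^sup>2) = (\<Sum>j\<in>UNIV - {k}. \<delta> / 4 * (cmod (v $ j))\<^sup>2)"
    using s \<delta> by (intro sum.cong) (auto simp: wj power_mult_distrib power_divide)
  also have "\<dots> = \<delta> / 4 * (\<Sum>j\<in>UNIV - {k}. (cmod (v $ j))\<^sup>2)"
    by (simp add: sum_distrib_left)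
  also have "\<dots> \<le> \<delta> / 4 * 1"
  proof (rule mult_left_mono)
    have "(\<Sum>j\<in>UNIV - {k}. (cmod (v $ j))\<^sup>2) \<le> (norm v)\<^sup>2"
      unfolding norm_vec_power2[of v k] by simp
    also have "\<dots> \<le> 1" using v by (simp add: power_le_one)
    finally show "(\<Sum>j\<in>UNIV - {k}. (cmod (v $ j))\<^sup>2) \<le> 1" .
  qed (use s \<delta> in simp)
  finally have "(norm w)\<^sup>2 \<le> (s + \<delta> / 2)\<^sup>2 + \<delta> / 4"
    unfolding norm_vec_power2[of w k] using power_mono[OF up, of 2] by simp
  also have "\<dots> = 1 - \<delta> * (3 - \<delta>) / 4"
    unfolding \<delta> by (simp add: power2_eq_square field_simps)
  also have "\<dots> < 1\<^sup>2" using s \<delta> by simp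
  finally have "norm w < 1" using power2_less_imp_less[of "norm w" 1] by simp
  then show "w \<in> ball 0 1" by simp
  have "s - \<delta> / 2 \<le> cmod (w $ k)"
    unfolding wk using dk1 norm_diff_ineq[of "of_real s :: complex" "of_real (\<delta> / 2) * v $ k"]
    unfolding dk ns by linarith
  also have "\<dots> \<le> norm w" by (rule norm_component_le)
  finally show "1 - 3 / 2 * \<delta> \<le> norm w" unfolding \<delta> by (simp add: field_simps)
qed

lemma aniso_smult: "aniso k a b (c *s v) = c *s aniso k a b v"
  by (simp add: aniso_def vec_eq_iff)

lemma measurable_smult [measurable (raw)]:
  fixes g :: "'a \<Rightarrow> complex ^ 'n"
  assumes [measurable]: "f \<in> borel_measurable M" "g \<in> borel_measurable M"
  shows "(\<lambda>x. f x *s g x) \<in> borel_measurable M"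
proof -
  have "continuous_on UNIV (\<lambda>p :: complex \<times> (complex ^ 'n). fst p *s snd p)"
    unfolding vector_scalar_mult_def by (intro continuous_intros)
  then have [measurable]: "(\<lambda>p :: complex \<times> (complex ^ 'n). fst p *s snd p) \<in> borel_measurable borel"
    by (rule borel_measurable_continuous_onI)
  have "(\<lambda>x. fst (f x, g x) *s snd (f x, g x)) \<in> borel_measurable M"
    by measurable
  then show ?thesis by simp
qed

lemma measurable_aniso [measurable]: "aniso k a b \<in> borel_measurable borel"
  unfolding aniso_def[abs_def]
  by (intro borel_measurable_continuous_onI continuous_intros)

text \<open>The polar weight is at least 1 in the ball, so inserting it only increases the left
  side. Each sphere then contributes at most the Hardy mean, and the radii are confined to
  \<open>{c..1}\<close>; a negative \<open>c\<close> is harmless.\<close>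

lemma nn_integral_annulus_le:
  fixes f :: "complex ^ 'n \<Rightarrow> complex"
  assumes f: "f holomorphic_vec_on ball 0 1"
  shows "(\<integral>\<^sup>+w. modp p f w * indicator {c..} (norm w) * indicator (ball 0 1) w \<partial>lborel)
    \<le> ennreal (2 * CARD('n)) * ball_volume TYPE('n) * (ennreal (1 - c) * hardy_mean p f)"
proof -
  note [measurable] = measurable_modp[OF f]
  let ?m = "2 * CARD('n)"
  define u where "u w = modp p f w * indicator {c..} (norm w)" for w
  have "(\<integral>\<^sup>+w. u w * indicator (ball 0 1) w \<partial>lborel) \<le> (\<integral>\<^sup>+w. u w * ennreal (1 / norm w ^ (?m - 1)) * indicator (ball 0 1) w \<partial>lborel)"
  proof (rule nn_integral_mono_AE, rule eventually_mono[OF AE_lborel_singleton[of 0]])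
    fix w :: "complex ^ 'n" assume w: "w \<noteq> 0"
    show "u w * indicator (ball 0 1) w \<le> u w * ennreal (1 / norm w ^ (?m - 1)) * indicator (ball 0 1) w"
    proof (cases "w \<in> ball 0 1")
      case True
      then have "1 \<le> 1 / norm w ^ (?m - 1)" using w by (simp add: power_le_one)
      then have "1 \<le> ennreal (1 / norm w ^ (?m - 1))" by (simp add: ennreal_ge_1)
      then have "u w * 1 \<le> u w * ennreal (1 / norm w ^ (?m - 1))" by (rule mult_left_mono) simp
      then show ?thesis using True by simp
    qed simp
  qed
  also have "\<dots> = ennreal ?m * ball_volume TYPE('n) * (\<integral>\<^sup>+r. (\<integral>\<^sup>+\<zeta>. u (r *\<^sub>R \<zeta>) \<partial>sphere_measure) * indicator {0<..<1} r \<partial>lborel)"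
    unfolding u_def by (rule nn_integral_polar) measurable
  also have "\<dots> \<le> ennreal ?m * ball_volume TYPE('n) * (\<integral>\<^sup>+r. hardy_mean p f * indicator {c..1} r \<partial>lborel)"
  proof (intro mult_left_mono nn_integral_mono)
    fix r :: real
    show "(\<integral>\<^sup>+\<zeta>. u (r *\<^sub>R \<zeta>) \<partial>sphere_measure) * indicator {0<..<1} r \<le> hardy_mean p f * indicator {c..1} r"
    proof (cases "0 < r \<and> r < 1")
      case True
      have "(\<integral>\<^sup>+\<zeta>. u (r *\<^sub>R \<zeta>) \<partial>sphere_measure) = (\<integral>\<^sup>+\<zeta>. modp p f (r *\<^sub>R \<zeta>) * indicator {c..} r \<partial>sphere_measure)"
        using True by (intro nn_integral_cong) (auto simp: u_def space_sphere_measure)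
      also have "\<dots> = (\<integral>\<^sup>+\<zeta>. modp p f (r *\<^sub>R \<zeta>) \<partial>sphere_measure) * indicator {c..} r"
        by (intro nn_integral_multc measurable_sphere_measureI) measurable
      also have "\<dots> \<le> hardy_mean p f * indicator {c..} r"
        using True by (intro mult_right_mono hardy_mean_upper) auto
      finally show ?thesis using True by (auto simp: indicator_def split: if_splits)
    qed (auto simp: indicator_def)
  qed auto
  also have "(\<integral>\<^sup>+r. hardy_mean p f * indicator {c..1} r \<partial>lborel) = ennreal (1 - c) * hardy_mean p f"
  proof (cases "c \<le> 1")
    case True
    then show ?thesis by (simp add: nn_integral_cmult mult.commute)
  next
    case False
    then show ?thesis by (simp add: ennreal_neg)
  qed
  finally show ?thesis by (simp add: u_def)
qed

text \<open>The value at the point is bounded by an average over the ellipsoid, of volume of order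
  \<open>\<delta> ^ (n + 1)\<close>. The ellipsoid lies in an annulus of thickness
  \<open>3 / 2 * \<delta>\<close>, over which the integral is at most of order
  \<open>\<delta>\<close> times the mean. The quotient has order \<open>\<delta>\<close> to the
  power \<open>- n\<close>.\<close>

lemma hardy_pointwise_axis:
  fixes f :: "complex ^ 'n \<Rightarrow> complex"
  assumes f: "f holomorphic_vec_on ball 0 1" and p: "0 < p" and s: "0 \<le> s" "s < 1"
  shows "modp p f (s *\<^sub>R axis k 1) \<le> ennreal (3 * CARD('n) * 4 ^ CARD('n) / (1 - s) ^ CARD('n)) * hardy_mean p f"
proof -
  note [measurable] = measurable_modp[OF f]
  define \<delta> where "\<delta> = 1 - s"
  have \<delta>: "0 < \<delta>" using s by (simp add: \<delta>_def)
  let ?z = "s *\<^sub>R axis k 1 :: complex ^ 'n"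
  define A :: "complex ^ 'n \<Rightarrow> complex ^ 'n" where "A = aniso k (\<delta> / 2) (sqrt \<delta> / 2)"
  have [measurable]: "A \<in> borel_measurable borel" by (simp add: A_def)
  let ?B = "ball 0 1 :: (complex ^ 'n) set"
  interpret CL: pair_sigma_finite circle_measure "lborel :: (complex ^ 'n) measure" ..
  have Ay: "A (y *s v) = y *s A v" for y v by (simp add: A_def aniso_smult)
  have in_B: "?z + A v \<in> ?B" "1 - 3 / 2 * \<delta> \<le> norm (?z + A v)" if "v \<in> ?B" for v
    using aniso_ellipsoid[OF s that \<delta>_def, of k] by (simp_all add: A_def)
  define h where "h w = modp p f w * indicator {1 - 3 / 2 * \<delta>..} (norm w) * indicator ?B w" for w
  have [measurable]: "h \<in> borel_measurable borel" unfolding h_def by measurable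
  have sub: "modp p f ?z * indicator ?B v \<le> (\<integral>\<^sup>+y. modp p f (?z + A (y *s v)) * indicator ?B v \<partial>circle_measure)" for v
  proof (cases "v \<in> ?B")
    case True
    have "y *s v \<in> ?B" if "cmod y \<le> 1" for y
      using True that mult_left_le_one_le[of "norm v" "cmod y"] by auto
    then have "modp p f ?z \<le> (\<integral>\<^sup>+y. modp p f (?z + y *s A v) \<partial>circle_measure)"
      using in_B by (intro holomorphic_vec_submean f p) (simp add: Ay[symmetric])
    then show ?thesis using True by (simp add: Ay)
  qed simp
  have "modp p f ?z * ball_volume TYPE('n) = (\<integral>\<^sup>+v. modp p f ?z * indicator ?B v \<partial>lborel)"
    by (simp add: nn_integral_cmult)
  also have "\<dots> \<le> (\<integral>\<^sup>+v. (\<integral>\<^sup>+y. modp p f (?z + A (y *s v)) * indicator ?B v \<partial>circle_measure) \<partial>lborel)"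
    by (intro nn_integral_mono sub)
  \<comment> \<open>The disc inequality has been averaged over \<open>v\<close>. Rotation of
    \<open>v\<close> by \<open>y\<close> preserves Lebesgue measure on the ball, so after Fubini the
    inner integral does not depend on \<open>y\<close> and only the integral over the ellipsoid
    remains.\<close>
  also have "\<dots> = (\<integral>\<^sup>+y. (\<integral>\<^sup>+v. modp p f (?z + A (y *s v)) * indicator ?B v \<partial>lborel) \<partial>circle_measure)"
    by (rule CL.Fubini') measurable
  also have "\<dots> = (\<integral>\<^sup>+y. (\<integral>\<^sup>+v. modp p f (?z + A v) * indicator ?B v \<partial>lborel) \<partial>circle_measure)"
  proof (rule nn_integral_circle_cong)
    fix y :: complex assume y: "cmod y = 1"
    have "(\<integral>\<^sup>+v. modp p f (?z + A (y *s v)) * indicator ?B v \<partial>lborel) =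
        (\<integral>\<^sup>+v. modp p f (?z + A (y *s v)) * indicator ?B (y *s v) \<partial>lborel)"
      using y by (intro nn_integral_cong) (simp add: indicator_def)
    also have "\<dots> = (\<integral>\<^sup>+v. modp p f (?z + A v) * indicator ?B v \<partial>lborel)"
      using unitary_map_smult[OF y] unfolding unitary_map_def
      by (intro nn_integral_lborel_isometry[where f = "\<lambda>v. modp p f (?z + A v) * indicator ?B v"]) auto
    finally show "(\<integral>\<^sup>+v. modp p f (?z + A (y *s v)) * indicator ?B v \<partial>lborel) = \<dots>" .
  qed measurable
  also have "\<dots> = (\<integral>\<^sup>+v. modp p f (?z + A v) * indicator ?B v \<partial>lborel)"
    by simp
  also have "\<dots> \<le> (\<integral>\<^sup>+v. h (?z + A v) \<partial>lborel)"
    using in_B by (intro nn_integral_mono) (auto simp: h_def indicator_def simp del: mem_ball mem_ball_0)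
  finally have 1: "modp p f ?z * ball_volume TYPE('n) \<le> (\<integral>\<^sup>+v. h (?z + A v) \<partial>lborel)" .
  let ?d = "(\<delta> / 2)\<^sup>2 * (sqrt \<delta> / 2) ^ (2 * (CARD('n) - 1))"
  have d: "?d = \<delta> ^ (CARD('n) + 1) / 4 ^ CARD('n)"
  proof -
    obtain m where m: "CARD('n) = Suc m" using zero_less_card_finite by (metis gr0_implies_Suc)
    have "(sqrt \<delta> / 2) ^ (2 * m) = (\<delta> / 4) ^ m"
      using \<delta> by (simp add: power_mult power_divide)
    then show ?thesis unfolding m by (simp add: power_divide power2_eq_square)
  qed
  have "ennreal ?d * (\<integral>\<^sup>+v. h (?z + A v) \<partial>lborel) = (\<integral>\<^sup>+w. h w \<partial>lborel)"
    unfolding A_def using \<delta> by (intro nn_integral_aniso[symmetric]) auto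
  also have "\<dots> \<le> ennreal (2 * CARD('n)) * ball_volume TYPE('n) * (ennreal (1 - (1 - 3 / 2 * \<delta>)) * hardy_mean p f)"
    unfolding h_def by (rule nn_integral_annulus_le[OF f])
  finally have "ennreal ?d * (modp p f ?z * ball_volume TYPE('n)) \<le>
      ennreal (2 * CARD('n)) * ball_volume TYPE('n) * (ennreal (3 / 2 * \<delta>) * hardy_mean p f)"
    using mult_left_mono[OF 1, of "ennreal ?d"] by simp
  then have "ball_volume TYPE('n) * (ennreal ?d * modp p f ?z) \<le>
      ball_volume TYPE('n) * (ennreal (2 * CARD('n)) * ennreal (3 / 2 * \<delta>) * hardy_mean p f)"
    by (simp only: mult_ac)
  then have "ennreal ?d * modp p f ?z \<le> ennreal (2 * CARD('n)) * ennreal (3 / 2 * \<delta>) * hardy_mean p f"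
    using ball_volume_pos[where 'n = 'n] ball_volume_finite[where 'n = 'n]
    by (simp add: ennreal_mult_le_mult_iff)
  then have "ennreal (1 / ?d) * (ennreal ?d * modp p f ?z) \<le> ennreal (1 / ?d) * (ennreal (2 * CARD('n)) * ennreal (3 / 2 * \<delta>) * hardy_mean p f)"
    by (rule mult_left_mono) simp
  also have "ennreal (1 / ?d) * (ennreal ?d * modp p f ?z) = modp p f ?z"
  proof -
    have "ennreal (1 / ?d) * ennreal ?d = 1"
      using \<delta> unfolding d by (subst ennreal_mult[symmetric]) auto
    then show ?thesis by (simp add: mult.assoc[symmetric])
  qed
  also have "ennreal (1 / ?d) * (ennreal (2 * CARD('n)) * ennreal (3 / 2 * \<delta>) * hardy_mean p f)
      = ennreal (1 / ?d * (2 * CARD('n) * (3 / 2 * \<delta>))) * hardy_mean p f"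
  proof -
    have "ennreal a * (ennreal b * ennreal c * H) = ennreal (a * (b * c)) * H"
      if "0 \<le> a" "0 \<le> b" "0 \<le> c" for a b c and H :: ennreal
      using that by (simp add: ennreal_mult mult.assoc)
    then show ?thesis using \<delta> by simp
  qed
  also have "1 / ?d * (2 * CARD('n) * (3 / 2 * \<delta>)) = 3 * CARD('n) * 4 ^ CARD('n) / (1 - s) ^ CARD('n)"
    using \<delta> unfolding d \<delta>_def[symmetric] by (simp add: field_simps)
  finally show ?thesis .
qed

lemma holomorphic_vec_compose_unitary:
  assumes f: "f holomorphic_vec_on ball 0 1" and U: "unitary_map U"
  shows "(\<lambda>z. f (U z)) holomorphic_vec_on ball 0 1"
  using holomorphic_vec_compose_linear[OF f, of U 0 "ball 0 1"] U
  by (auto simp: unitary_map_def linear_conv_bounded_linear image_subset_iff)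

lemma hardy_mean_unitary:
  assumes f: "f holomorphic_vec_on ball 0 1" and U: "unitary_map U"
  shows "hardy_mean p (\<lambda>z. f (U z)) = hardy_mean p f"
proof -
  have nU: "norm (U v) = norm v" and linU: "linear U" for v using U by (auto simp: unitary_map_def)
  have "(\<integral>\<^sup>+\<zeta>. modp p (\<lambda>z. f (U z)) (r *\<^sub>R \<zeta>) \<partial>sphere_measure) = (\<integral>\<^sup>+\<zeta>. modp p f (r *\<^sub>R \<zeta>) \<partial>sphere_measure)" for r
  proof -
    have "modp p (\<lambda>z. f (U z)) (r *\<^sub>R \<zeta>) = modp p f (r *\<^sub>R U \<zeta>)" for \<zeta>
      by (simp add: modp_def nU linear_scale[OF linU] indicator_def)
    moreover have [measurable]: "modp p f \<in> borel_measurable borel" by (rule measurable_modp[OF f])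
    ultimately show ?thesis
      using nn_integral_sphere_unitary[of "\<lambda>\<zeta>. modp p f (r *\<^sub>R \<zeta>)" U] U by simp
  qed
  then show ?thesis by (simp add: hardy_mean_modp)
qed

text \<open>Hardy means are unitarily invariant, so \<open>z\<close> may be rotated onto a
  coordinate axis. \<open>undefined\<close> stands for an arbitrary but fixed coordinate.\<close>

theorem hardy_pointwise:
  fixes f :: "complex ^ 'n \<Rightarrow> complex"
  assumes f: "f holomorphic_vec_on ball 0 1" and p: "0 < p" and z: "z \<in> ball 0 1"
  shows "ennreal (cmod (f z) powr p) \<le> ennreal (3 * CARD('n) * 4 ^ CARD('n) / (1 - norm z) ^ CARD('n)) * hardy_mean p f"
proof -
  define e where "e = (if z = 0 then axis undefined 1 else z /\<^sub>R norm z)"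
  have e: "norm e = 1" "z = norm z *\<^sub>R e" by (auto simp: e_def)
  obtain U :: "complex ^ 'n \<Rightarrow> complex ^ 'n" where U: "unitary_map U" "\<And>x. U x $ undefined = cinner x e"
    using unitary_to_axis[OF e(1)] by metis
  have Ue: "U e = axis undefined 1"
  proof -
    have 1: "U e $ undefined = 1" using U(2)[of e] e(1) by (simp add: cinner_self)
    have n: "norm (U e) = 1" using U(1) e by (simp add: unitary_map_def)
    have "(\<Sum>j\<in>UNIV - {undefined}. (cmod (U e $ j))\<^sup>2) = 0"
      using norm_vec_power2[of "U e" undefined] 1 n by simp
    then have "U e $ j = 0" if "j \<noteq> undefined" for j
      using that by (subst (asm) sum_nonneg_eq_0_iff) auto
    then show ?thesis using 1 by (auto simp: vec_eq_iff axis_def)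
  qed
  obtain V where V: "unitary_map V" "\<And>x. U (V x) = x" "\<And>x. V (U x) = x"
    using unitary_map_inverse[OF U(1)] by metis
  have Vz: "V (norm z *\<^sub>R axis undefined 1) = z"
    using V(1,3) e(2) Ue by (metis unitary_map_def linear_scale)
  have "modp p (\<lambda>x. f (V x)) (norm z *\<^sub>R axis undefined 1) \<le>
      ennreal (3 * CARD('n) * 4 ^ CARD('n) / (1 - norm z) ^ CARD('n)) * hardy_mean p (\<lambda>x. f (V x))"
    using z by (intro hardy_pointwise_axis[OF holomorphic_vec_compose_unitary[OF f V(1)] p]) auto
  then show ?thesis
    using z unfolding hardy_mean_unitary[OF f V(1)] by (simp add: modp_in_ball Vz)
qed

section \<open>The radial maximal function\<close>

text \<open>\<open>sphere_measure\<close> lives on a restricted sigma-algebra; moving it to the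
  Borel sets of the whole space puts joint measurability with \<open>circle_measure\<close> within
  reach of the ordinary Borel rules for Fubini.\<close>

definition sphere_borel :: "(complex ^ 'n) measure" where
  "sphere_borel = distr sphere_measure borel (\<lambda>x. x)"

lemma sets_sphere_borel [simp, measurable_cong]: "sets sphere_borel = sets borel"
  by (simp add: sphere_borel_def)

lemma nn_integral_sphere_borel:
  "u \<in> borel_measurable borel \<Longrightarrow> nn_integral sphere_borel u = nn_integral sphere_measure u"
  unfolding sphere_borel_def
  by (subst nn_integral_distr) (auto intro: measurable_sphere_measureI)

lemma finite_measure_sphere_borel: "finite_measure (sphere_borel :: (complex ^ 'n) measure)"
  unfolding sphere_borel_def
  by (intro finite_measure.finite_measure_distr finite_measure_sphere measurable_sphere_measureI) simp

text \<open>The one-variable maximal function of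
  \<open>y \<mapsto> f (R *\<^sub>R (y *s \<zeta>))\<close> at \<open>y = 1\<close>. For
  \<open>0 < R < 1\<close> the slice function is holomorphic on a neighbourhood of the closed disc;
  the exponent \<open>p / 2\<close> makes the square comparable with
  \<open>|f| powr p\<close>.\<close>

definition slice_max :: "real \<Rightarrow> nat \<Rightarrow> real \<Rightarrow> (complex ^ 'n \<Rightarrow> complex) \<Rightarrow> complex ^ 'n \<Rightarrow> ennreal" where
  "slice_max p J R f \<zeta> = poisson_max J (\<lambda>y. modp (p / 2) f (R *\<^sub>R (y *s \<zeta>))) 1"

lemma measurable_poisson_max [measurable]:
  assumes [measurable]: "case_prod u \<in> borel_measurable (M \<Otimes>\<^sub>M borel)" "g \<in> borel_measurable M"
  shows "(\<lambda>\<zeta>. poisson_max J (u \<zeta>) (g \<zeta>)) \<in> borel_measurable M"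
  unfolding poisson_max_def by measurable

lemma measurable_slice_max [measurable]:
  assumes "f holomorphic_vec_on ball 0 1"
  shows "slice_max p J R f \<in> borel_measurable borel"
proof -
  have [measurable]: "modp (p / 2) f \<in> borel_measurable borel" by (rule measurable_modp[OF assms])
  have "case_prod (\<lambda>\<zeta> y. modp (p / 2) f (R *\<^sub>R (y *s \<zeta>))) \<in> borel_measurable (borel \<Otimes>\<^sub>M borel)"
    by measurable
  then show ?thesis
    unfolding slice_max_def[abs_def] by (rule measurable_poisson_max) simp
qed

text \<open>As \<open>x\<close> runs over the circle, the values at \<open>x *s \<zeta>\<close> are
  those of the maximal function of one fixed slice function. This is what brings the bound on the
  circle to bear on the sphere.\<close>

lemma slice_max_rotate:
  assumes f: "f holomorphic_vec_on ball 0 1" and x: "cmod x = 1"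
  shows "slice_max p J R f (x *s \<zeta>) = poisson_max J (\<lambda>y. modp (p / 2) f (R *\<^sub>R (y *s \<zeta>))) x"
proof -
  have [measurable]: "modp (p / 2) f \<in> borel_measurable borel" by (rule measurable_modp[OF f])
  have "(\<integral>\<^sup>+y. ennreal (poisson (of_real t * 1) y) * modp (p / 2) f (R *\<^sub>R (y *s (x *s \<zeta>))) \<partial>circle_measure)
    = (\<integral>\<^sup>+y. ennreal (poisson (of_real t * x) y) * modp (p / 2) f (R *\<^sub>R (y *s \<zeta>)) \<partial>circle_measure)" for t
  proof -
    have "poisson (of_real t * x) (x * y) = poisson (of_real t * 1) y" for y
    proof -
      have "x * y - of_real t * x = x * (y - of_real t * 1)" by (simp add: algebra_simps)
      then show ?thesis using x by (simp only: poisson_def norm_mult mult_1 mult_1_right norm_one)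
    qed
    moreover have "y *s (x *s \<zeta>) = (x * y) *s \<zeta>" for y by (simp add: vec_eq_iff)
    ultimately show ?thesis
      using nn_integral_circle_rotate[of "\<lambda>y. ennreal (poisson (of_real t * x) y) * modp (p / 2) f (R *\<^sub>R (y *s \<zeta>))" x] x
      by (simp add: mult.commute)
  qed
  then show ?thesis by (simp only: slice_max_def poisson_max_def)
qed

text \<open>Unitary invariance replaces the integral by its average over rotations \<open>x\<close>;
  after Fubini the inner integral is over the circle of one slice, where
  \<open>circle_maximal\<close> applies. A second use of invariance undoes the averaging.\<close>

theorem nn_integral_slice_max_le:
  fixes f :: "complex ^ 'n \<Rightarrow> complex"
  assumes f: "f holomorphic_vec_on ball 0 1" and R: "0 < R" "R < 1"
  shows "(\<integral>\<^sup>+\<zeta>. (slice_max p J R f \<zeta>)\<^sup>2 \<partial>sphere_measure) \<le> ennreal 4096 * hardy_mean p f"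
proof -
  note [measurable] = measurable_modp[OF f] measurable_slice_max[OF f]
  let ?W = "slice_max p J R f"
  let ?u = "\<lambda>\<zeta> y. modp (p / 2) f (R *\<^sub>R (y *s \<zeta>))"
  interpret SB: finite_measure "sphere_borel :: (complex ^ 'n) measure" by (rule finite_measure_sphere_borel)
  interpret CS: pair_sigma_finite circle_measure "sphere_borel :: (complex ^ 'n) measure" ..
  have "(\<integral>\<^sup>+\<zeta>. (?W \<zeta>)\<^sup>2 \<partial>sphere_measure) = (\<integral>\<^sup>+x. (\<integral>\<^sup>+\<zeta>. (?W \<zeta>)\<^sup>2 \<partial>sphere_measure) \<partial>circle_measure)"
    by simp
  also have "\<dots> = (\<integral>\<^sup>+x. (\<integral>\<^sup>+\<zeta>. (?W (x *s \<zeta>))\<^sup>2 \<partial>sphere_borel) \<partial>circle_measure)"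
  proof (rule nn_integral_circle_cong)
    fix x :: complex assume x: "cmod x = 1"
    have "(\<integral>\<^sup>+\<zeta>. (?W (x *s \<zeta>))\<^sup>2 \<partial>sphere_borel) = (\<integral>\<^sup>+\<zeta>. (?W (x *s \<zeta>))\<^sup>2 \<partial>sphere_measure)"
      by (rule nn_integral_sphere_borel) measurable
    also have "\<dots> = (\<integral>\<^sup>+\<zeta>. (?W \<zeta>)\<^sup>2 \<partial>sphere_measure)"
      by (rule nn_integral_sphere_unitary[OF _ unitary_map_smult[OF x], of "\<lambda>\<zeta>. (?W \<zeta>)\<^sup>2"]) measurable
    finally show "(\<integral>\<^sup>+\<zeta>. (?W \<zeta>)\<^sup>2 \<partial>sphere_measure) = (\<integral>\<^sup>+\<zeta>. (?W (x *s \<zeta>))\<^sup>2 \<partial>sphere_borel)" ..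
  qed measurable
  also have "\<dots> = (\<integral>\<^sup>+\<zeta>. (\<integral>\<^sup>+x. (?W (x *s \<zeta>))\<^sup>2 \<partial>circle_measure) \<partial>sphere_borel)"
    by (rule CS.Fubini'[symmetric]) measurable
  also have "\<dots> = (\<integral>\<^sup>+\<zeta>. (\<integral>\<^sup>+x. (poisson_max J (?u \<zeta>) x)\<^sup>2 \<partial>circle_measure) \<partial>sphere_borel)"
    by (intro nn_integral_cong nn_integral_circle_cong) (auto simp: slice_max_rotate[OF f])
  also have "\<dots> \<le> (\<integral>\<^sup>+\<zeta>. ennreal 4096 * (\<integral>\<^sup>+y. (?u \<zeta> y)\<^sup>2 \<partial>circle_measure) \<partial>sphere_borel)"
    by (intro nn_integral_mono circle_maximal) measurable
  also have "\<dots> = ennreal 4096 * (\<integral>\<^sup>+\<zeta>. (\<integral>\<^sup>+y. (?u \<zeta> y)\<^sup>2 \<partial>circle_measure) \<partial>sphere_borel)"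
    by (rule nn_integral_cmult) measurable
  also have "(\<integral>\<^sup>+\<zeta>. (\<integral>\<^sup>+y. (?u \<zeta> y)\<^sup>2 \<partial>circle_measure) \<partial>sphere_borel) =
      (\<integral>\<^sup>+y. (\<integral>\<^sup>+\<zeta>. (?u \<zeta> y)\<^sup>2 \<partial>sphere_borel) \<partial>circle_measure)"
    by (rule CS.Fubini') measurable
  also have "\<dots> = (\<integral>\<^sup>+y. (\<integral>\<^sup>+\<zeta>. modp p f (R *\<^sub>R \<zeta>) \<partial>sphere_measure) \<partial>circle_measure)"
  proof (rule nn_integral_circle_cong)
    fix y :: complex assume y: "cmod y = 1"
    have sq: "(modp (p / 2) f z)\<^sup>2 = modp p f z" for z
    proof -
      have "a powr (p / 2) * a powr (p / 2) = a powr p" for a :: real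
        by (simp add: powr_add[symmetric])
      then show ?thesis by (simp add: modp_def power2_eq_square del: norm_scaleR flip: ennreal_mult)
    qed
    have "(\<integral>\<^sup>+\<zeta>. (?u \<zeta> y)\<^sup>2 \<partial>sphere_borel) = (\<integral>\<^sup>+\<zeta>. modp p f (R *\<^sub>R (y *s \<zeta>)) \<partial>sphere_measure)"
      unfolding sq by (rule nn_integral_sphere_borel) measurable
    also have "\<dots> = (\<integral>\<^sup>+\<zeta>. modp p f (R *\<^sub>R \<zeta>) \<partial>sphere_measure)"
      by (rule nn_integral_sphere_unitary[OF _ unitary_map_smult[OF y], of "\<lambda>\<zeta>. modp p f (R *\<^sub>R \<zeta>)"]) measurable
    finally show "(\<integral>\<^sup>+\<zeta>. (?u \<zeta> y)\<^sup>2 \<partial>sphere_borel) = \<dots>" .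
  qed measurable
  also have "\<dots> = (\<integral>\<^sup>+\<zeta>. modp p f (R *\<^sub>R \<zeta>) \<partial>sphere_measure)"
    by simp
  also have "\<dots> \<le> hardy_mean p f"
    using R by (rule hardy_mean_upper)
  finally show ?thesis by (simp add: mult_left_mono)
qed

text \<open>In the slice disc of radius \<open>R\<close> the point sits at relative radius
  \<open>t / R\<close>, which is at most the largest dyadic radius of index
  \<open>J\<close>.\<close>

lemma modp_le_slice_max:
  assumes f: "f holomorphic_vec_on ball 0 1" and p: "0 < p" and R: "0 < R" "R < 1"
    and \<zeta>: "norm \<zeta> = 1" and t: "0 \<le> t" "t \<le> R * (1 - 1 / 2 ^ J)"
  shows "modp (p / 2) f (t *\<^sub>R \<zeta>) \<le> 16 * slice_max p J R f \<zeta>"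
proof -
  have [measurable]: "modp (p / 2) f \<in> borel_measurable borel" by (rule measurable_modp[OF f])
  have in_B: "R *\<^sub>R (w *s \<zeta>) \<in> ball 0 1" if "cmod w \<le> 1" for w
  proof -
    have "R * cmod w \<le> R * 1" using R that by (intro mult_left_mono) auto
    then have "R * cmod w < 1" using R by linarith
    then show ?thesis using R \<zeta> by simp
  qed
  have eq: "R *\<^sub>R (w *s \<zeta>) = 0 + w *s (R *\<^sub>R \<zeta>)" for w by (simp add: vec_eq_iff)
  have "ennreal (cmod (f (R *\<^sub>R ((of_real (t / R) * 1) *s \<zeta>))) powr (p / 2)) \<le>
      16 * poisson_max J (\<lambda>y. modp (p / 2) f (R *\<^sub>R (y *s \<zeta>))) 1"
  proof (rule holomorphic_powr_le_poisson_max[where h = "\<lambda>w. f (R *\<^sub>R (w *s \<zeta>))"])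
    show "(\<lambda>w. f (R *\<^sub>R (w *s \<zeta>))) holomorphic_on cball 0 1"
      unfolding eq by (rule holomorphic_vec_line_holomorphic[OF f open_ball]) (use in_B in \<open>simp add: eq\<close>)
    show "modp (p / 2) f (R *\<^sub>R (y *s \<zeta>)) = ennreal (cmod (f (R *\<^sub>R (y *s \<zeta>))) powr (p / 2))"
      if "cmod y = 1" for y
      using that in_B[of y] by (intro modp_in_ball) simp
  qed (use p R t in \<open>auto simp: field_simps\<close>)
  moreover have "R *\<^sub>R ((of_real (t / R) * 1) *s \<zeta>) = t *\<^sub>R \<zeta>"
    using R by (simp add: vec_eq_iff) (simp add: scaleR_conv_of_real)
  moreover have "t *\<^sub>R \<zeta> \<in> ball 0 1"
  proof -
    have "R * (1 - 1 / 2 ^ J) \<le> R * 1" using R by (intro mult_left_mono) auto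
    then have "t < 1" using t R by linarith
    then show ?thesis using t \<zeta> by simp
  qed
  ultimately show ?thesis by (simp add: modp_in_ball slice_max_def)
qed

section \<open>Caps and the Szego kernel\<close>

lemma measurable_vec_nth [measurable (raw)]:
  fixes f :: "'a \<Rightarrow> complex ^ 'n"
  assumes [measurable]: "f \<in> borel_measurable M"
  shows "(\<lambda>x. f x $ k) \<in> borel_measurable M"
proof -
  have [measurable]: "(\<lambda>z :: complex ^ 'n. z $ k) \<in> borel_measurable borel"
    by (intro borel_measurable_continuous_onI continuous_intros)
  show ?thesis by measurable
qed

text \<open>The cone over a cap, cut off near the sphere, lies in a non-isotropic box of volume of the
  order of \<open>\<delta>\<close> to the power \<open>n + 1\<close>.\<close>

lemma emeasure_cap_le:
  fixes k :: "'n::finite"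
  obtains C where "0 < C" "\<And>\<delta>. 0 < \<delta> \<Longrightarrow>
    (\<integral>\<^sup>+\<zeta>. (if cmod (1 - (\<zeta> :: complex ^ 'n) $ k) < \<delta> then 1 else 0) \<partial>sphere_measure) \<le> ennreal (C * \<delta> ^ CARD('n))"
proof -
  let ?n = "CARD('n)" let ?m = "2 * CARD('n)"
  let ?B = "ball 0 1 :: (complex ^ 'n) set"
  \<comment> \<open>Large enough to contain the unit polydisc: the norm is at most the sum of the
    moduli of the coordinates.\<close>
  let ?D = "ball 0 (real ?n + 1) :: (complex ^ 'n) set"
  define V where "V = measure lborel ?B"
  have V: "ball_volume TYPE('n) = ennreal V" "0 < V"
    using ball_volume_finite[where 'n = 'n] content_ball_pos[of 1 "0 :: complex ^ 'n"]
    by (auto simp: V_def emeasure_eq_ennreal_measure)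
  define K where "K = measure lborel ?D"
  have K: "emeasure lborel ?D = ennreal K"
    using emeasure_lborel_ball_finite[of "0 :: complex ^ 'n" "real ?n + 1"]
    by (auto simp: K_def emeasure_eq_ennreal_measure)
  define C0 where "C0 = 2 ^ (?m - 1) * 4 ^ ?n * K / (?m * V)"
  \<comment> \<open>The second entry serves large \<open>\<delta>\<close>: beyond 1/2 the total mass
    1 is at most \<open>(2 * \<delta>) ^ ?n\<close>.\<close>
  define C where "C = max C0 (2 ^ ?n)"
  define cap where "cap \<delta> \<zeta> = (if cmod (1 - \<zeta> $ k) < \<delta> then 1 else 0 :: ennreal)" for \<delta> and \<zeta> :: "complex ^ 'n"
  have [measurable]: "cap \<delta> \<in> borel_measurable borel" for \<delta>
    unfolding cap_def by measurable
  have small: "(\<integral>\<^sup>+\<zeta>. cap \<delta> \<zeta> \<partial>sphere_measure) \<le> ennreal (C0 * \<delta> ^ ?n)" if \<delta>: "0 < \<delta>" "\<delta> \<le> 1/2" for \<delta>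
  proof -
    define u where "u w = cap \<delta> (w /\<^sub>R norm w) * indicator {1 - \<delta><..} (norm w)" for w :: "complex ^ 'n"
    have [measurable]: "u \<in> borel_measurable borel" unfolding u_def by measurable
    define A :: "complex ^ 'n \<Rightarrow> complex ^ 'n" where "A = aniso k (2 * \<delta>) (2 * sqrt \<delta>)"
    have [measurable]: "A \<in> borel_measurable borel" by (simp add: A_def)
    let ?d = "(2 * \<delta>)\<^sup>2 * (2 * sqrt \<delta>) ^ (2 * (?n - 1))"
    have d: "?d = 4 ^ ?n * \<delta> ^ (?n + 1)"
    proof -
      obtain m where m: "?n = Suc m" using zero_less_card_finite by (metis gr0_implies_Suc)
      have "(2 * sqrt \<delta>) ^ (2 * m) = (4 * \<delta>) ^ m"
        using \<delta> by (simp add: power_mult power_mult_distrib)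
      then show ?thesis unfolding m by (simp add: power_mult_distrib power2_eq_square)
    qed
    \<comment> \<open>For \<open>w\<close> in the truncated cone, projecting to the sphere moves the
      \<open>k\<close>-th coordinate by less than \<open>\<delta>\<close>, so
      \<open>|1 - w $ k| < 2 * \<delta>\<close>. As \<open>norm w < 1\<close>, the other coordinates
      have squared sum below \<open>1 - (1 - 2 * \<delta>)\<^sup>2 \<le> 4 * \<delta>\<close>.
      Undoing \<open>A\<close> lands in the unit polydisc.\<close>
    have box: "u (axis k 1 + A v) * indicator ?B (axis k 1 + A v) \<le> indicator ?D v" for v
    proof (cases "u (axis k 1 + A v) * indicator ?B (axis k 1 + A v) = 0")
      case False
      define w where "w = axis k 1 + A v"
      have w: "w \<in> ?B" "1 - \<delta> < norm w" "cmod (1 - (w /\<^sub>R norm w) $ k) < \<delta>"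
        using False by (auto simp: w_def[symmetric] u_def cap_def indicator_def split: if_splits)
      have nw: "0 < norm w" "norm w < 1" using w \<delta> by auto
      have wk: "w $ k = 1 + of_real (2 * \<delta>) * v $ k"
        by (simp add: w_def A_def aniso_def) (simp add: scaleR_conv_of_real)
      have wj: "cmod (w $ j) = 2 * sqrt \<delta> * cmod (v $ j)" if "j \<noteq> k" for j
        using that \<delta> by (simp add: w_def A_def aniso_def axis_def)
      have "cmod (1 - w $ k) \<le> cmod (1 - (w /\<^sub>R norm w) $ k) + cmod ((w /\<^sub>R norm w) $ k - w $ k)"
        using norm_triangle_ineq[of "1 - (w /\<^sub>R norm w) $ k" "(w /\<^sub>R norm w) $ k - w $ k"] by simp
      also have "(w /\<^sub>R norm w) $ k - w $ k = of_real (1 - norm w) * (w /\<^sub>R norm w) $ k"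
      proof -
        have "(w /\<^sub>R norm w) $ k = w $ k / of_real (norm w)"
          unfolding vector_scaleR_component by (simp add: scaleR_conv_of_real divide_inverse)
        then show ?thesis using nw by (simp add: field_simps)
      qed
      also have "cmod \<dots> \<le> (1 - norm w) * 1"
        unfolding norm_mult norm_of_real using nw norm_component_le[of "w /\<^sub>R norm w" k]
        by (intro mult_mono) auto
      finally have d2: "cmod (1 - w $ k) < 2 * \<delta>" using w by simp
      have vk: "cmod (v $ k) < 1"
      proof -
        have "cmod (1 - w $ k) = 2 * \<delta> * cmod (v $ k)"
          unfolding wk using \<delta> by (simp add: norm_mult)
        then show ?thesis using d2 \<delta> by simp
      qed
      have "1 - 2 * \<delta> \<le> cmod (w $ k)"
        using d2 norm_triangle_ineq2[of 1 "w $ k"] norm_triangle_ineq3[of 1 "w $ k"] by (simp add: norm_minus_commute)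
      then have "(1 - 2 * \<delta>)\<^sup>2 \<le> (cmod (w $ k))\<^sup>2"
        using \<delta> by (intro power_mono) auto
      have "(norm w)\<^sup>2 < 1" using nw by (simp add: power_less_one_iff)
      have S: "(\<Sum>j\<in>UNIV - {k}. (cmod (w $ j))\<^sup>2) < 4 * \<delta>"
      proof -
        have "1 - 4 * \<delta> \<le> (1 - 2 * \<delta>)\<^sup>2" by (simp add: power2_eq_square algebra_simps)
        with \<open>(1 - 2 * \<delta>)\<^sup>2 \<le> (cmod (w $ k))\<^sup>2\<close> \<open>(norm w)\<^sup>2 < 1\<close>
        show ?thesis using norm_vec_power2[of w k] by linarith
      qed
      have vj: "cmod (v $ j) < 1" if j: "j \<noteq> k" for j
      proof -
        have "(cmod (w $ j))\<^sup>2 \<le> (\<Sum>j\<in>UNIV - {k}. (cmod (w $ j))\<^sup>2)"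
          using j by (intro member_le_sum) auto
        moreover have "(cmod (w $ j))\<^sup>2 = 4 * \<delta> * (cmod (v $ j))\<^sup>2"
          unfolding wj[OF j] using \<delta> by (simp add: power_mult_distrib)
        ultimately have "4 * \<delta> * (cmod (v $ j))\<^sup>2 < 4 * \<delta> * 1"
          using S by linarith
        then have "(cmod (v $ j))\<^sup>2 < 1\<^sup>2" using \<delta> by simp
        then show ?thesis by (rule power2_less_imp_less) simp
      qed
      have "norm v \<le> (\<Sum>j\<in>UNIV. cmod (v $ j))"
        unfolding norm_vec_def by (rule L2_set_le_sum) simp
      also have "\<dots> \<le> (\<Sum>j\<in>(UNIV :: 'n set). 1)"
        using vk vj by (intro sum_mono) (metis less_imp_le)
      finally have "v \<in> ?D" by simp
      moreover have "u (axis k 1 + A v) * indicator ?B (axis k 1 + A v) \<le> 1"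
        by (auto simp: u_def cap_def indicator_def)
      ultimately show ?thesis by simp
    next
      case True
      show ?thesis unfolding True by simp
    qed
    \<comment> \<open>The truncated cone meets the sphere of radius \<open>r\<close> in the dilated
      cap exactly for \<open>1 - \<delta> < r < 1\<close>, so the radial integral is
      \<open>\<delta>\<close> times the measure of the cap.\<close>
    have "ennreal ?m * ennreal V * (ennreal \<delta> * (\<integral>\<^sup>+\<zeta>. cap \<delta> \<zeta> \<partial>sphere_measure)) =
      ennreal ?m * ennreal V * (\<integral>\<^sup>+r. (\<integral>\<^sup>+\<zeta>. u (r *\<^sub>R \<zeta>) \<partial>sphere_measure) * indicator {0<..<1} r \<partial>lborel)"
    proof -
      have "(\<integral>\<^sup>+\<zeta>. u (r *\<^sub>R \<zeta>) \<partial>sphere_measure) * indicator {0<..<1} r =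
          (\<integral>\<^sup>+\<zeta>. cap \<delta> \<zeta> \<partial>sphere_measure) * indicator {1 - \<delta><..<1} r" for r :: real
      proof (cases "0 < r \<and> r < 1")
        case True
        have "(\<integral>\<^sup>+\<zeta>. u (r *\<^sub>R \<zeta>) \<partial>sphere_measure) = (\<integral>\<^sup>+\<zeta>. cap \<delta> \<zeta> * indicator {1 - \<delta><..} r \<partial>sphere_measure)"
          using True by (intro nn_integral_cong) (auto simp: u_def space_sphere_measure)
        also have "\<dots> = (\<integral>\<^sup>+\<zeta>. cap \<delta> \<zeta> \<partial>sphere_measure) * indicator {1 - \<delta><..} r"
          by (intro nn_integral_multc measurable_sphere_measureI) measurable
        finally show ?thesis using True by (auto simp: indicator_def)
      qed (use \<delta> in \<open>auto simp: indicator_def\<close>)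
      then show ?thesis using \<delta> by (simp add: nn_integral_cmult mult.commute)
    qed
    also have "\<dots> = (\<integral>\<^sup>+w. u w * ennreal (1 / norm w ^ (?m - 1)) * indicator ?B w \<partial>lborel)"
      unfolding V(1)[symmetric] by (rule nn_integral_polar[symmetric]) measurable
    \<comment> \<open>Since \<open>\<delta> \<le> 1/2\<close>, the support of \<open>u\<close> has
      \<open>norm w > 1/2\<close>, which bounds the polar weight.\<close>
    also have "\<dots> \<le> (\<integral>\<^sup>+w. ennreal (2 ^ (?m - 1)) * (u w * indicator ?B w) \<partial>lborel)"
    proof (rule nn_integral_mono)
      fix w :: "complex ^ 'n"
      show "u w * ennreal (1 / norm w ^ (?m - 1)) * indicator ?B w \<le> ennreal (2 ^ (?m - 1)) * (u w * indicator ?B w)"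
      proof (cases "1 / 2 < norm w")
        case True
        then have "0 < norm w" by linarith
        with True have "1 / norm w \<le> 2" by (simp add: field_simps)
        then have "(1 / norm w) ^ (?m - 1) \<le> 2 ^ (?m - 1)"
          by (intro power_mono) auto
        then have "ennreal (1 / norm w ^ (?m - 1)) \<le> ennreal (2 ^ (?m - 1))"
          by (intro ennreal_leI) (simp add: power_divide)
        then have "(u w * indicator ?B w) * ennreal (1 / norm w ^ (?m - 1)) \<le> (u w * indicator ?B w) * ennreal (2 ^ (?m - 1))"
          by (rule mult_left_mono) simp
        then show ?thesis by (simp only: mult_ac)
      next
        case False
        then show ?thesis using \<delta> by (simp add: u_def indicator_def)
      qed
    qed
    also have "\<dots> = ennreal (2 ^ (?m - 1)) * (\<integral>\<^sup>+w. u w * indicator ?B w \<partial>lborel)"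
      by (rule nn_integral_cmult) measurable
    also have "(\<integral>\<^sup>+w. u w * indicator ?B w \<partial>lborel) = ennreal ?d * (\<integral>\<^sup>+v. u (axis k 1 + A v) * indicator ?B (axis k 1 + A v) \<partial>lborel)"
      unfolding A_def using \<delta> by (intro nn_integral_aniso) auto
    also have "(\<integral>\<^sup>+v. u (axis k 1 + A v) * indicator ?B (axis k 1 + A v) \<partial>lborel) \<le> (\<integral>\<^sup>+v. indicator ?D v \<partial>lborel)"
      by (intro nn_integral_mono box)
    also have "\<dots> = ennreal K" using K by simp
    finally have *: "ennreal ?m * ennreal V * (ennreal \<delta> * (\<integral>\<^sup>+\<zeta>. cap \<delta> \<zeta> \<partial>sphere_measure)) \<le>
        ennreal (2 ^ (?m - 1)) * (ennreal ?d * ennreal K)"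
      by (simp add: mult_left_mono)
    have "(\<integral>\<^sup>+\<zeta>. cap \<delta> \<zeta> \<partial>sphere_measure) \<le> (\<integral>\<^sup>+\<zeta>. 1 \<partial>(sphere_measure :: (complex ^ 'n) measure))"
      by (intro nn_integral_mono) (simp add: cap_def)
    also have "\<dots> = 1" by (simp add: emeasure_sphere_space)
    finally obtain s where s: "(\<integral>\<^sup>+\<zeta>. cap \<delta> \<zeta> \<partial>sphere_measure) = ennreal s" "0 \<le> s"
      by (cases "\<integral>\<^sup>+\<zeta>. cap \<delta> \<zeta> \<partial>sphere_measure") (auto simp: top_unique)
    have K0: "0 \<le> K" by (simp add: K_def)
    have "ennreal (?m * V * (\<delta> * s)) \<le> ennreal (2 ^ (?m - 1) * (?d * K))"
      using * V \<delta> s(2) K0 unfolding s(1) by (simp add: ennreal_mult[symmetric] mult.assoc del: power_Suc)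
    then have "?m * V * (\<delta> * s) \<le> 2 ^ (?m - 1) * (?d * K)"
      using K0 by (subst (asm) ennreal_le_iff) auto
    then have "\<delta> * (?m * V * s) \<le> \<delta> * (2 ^ (?m - 1) * (4 ^ ?n * \<delta> ^ ?n * K))"
      unfolding d by (simp add: mult_ac)
    then have "?m * V * s \<le> 2 ^ (?m - 1) * (4 ^ ?n * \<delta> ^ ?n * K)"
      using \<delta> by simp
    then have "s \<le> C0 * \<delta> ^ ?n"
      using V by (simp add: C0_def field_simps)
    then show ?thesis unfolding s by (rule ennreal_leI)
  qed
  show ?thesis
  proof (rule that[of C])
    show "0 < C" by (simp add: C_def less_max_iff_disj)
    fix \<delta> :: real assume \<delta>: "0 < \<delta>"
    have "(\<integral>\<^sup>+\<zeta>. cap \<delta> \<zeta> \<partial>sphere_measure) \<le> ennreal (C * \<delta> ^ ?n)"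
    proof (cases "\<delta> \<le> 1/2")
      case True
      have "C0 * \<delta> ^ ?n \<le> C * \<delta> ^ ?n" using \<delta> by (intro mult_right_mono) (auto simp: C_def)
      then show ?thesis using small[OF \<delta> True] by (meson ennreal_leI order_trans)
    next
      case False
      have "(\<integral>\<^sup>+\<zeta>. cap \<delta> \<zeta> \<partial>sphere_measure) \<le> (\<integral>\<^sup>+\<zeta>. 1 \<partial>(sphere_measure :: (complex ^ 'n) measure))"
        by (intro nn_integral_mono) (simp add: cap_def)
      also have "\<dots> = ennreal 1" by (simp add: emeasure_sphere_space)
      also have "\<dots> \<le> ennreal (C * \<delta> ^ ?n)"
      proof (rule ennreal_leI)
        have "1 \<le> (2 * \<delta>) ^ ?n" using False by (intro one_le_power) simp
        also have "\<dots> \<le> C * \<delta> ^ ?n"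
          unfolding power_mult_distrib using \<delta> by (intro mult_right_mono) (auto simp: C_def)
        finally show "1 \<le> C * \<delta> ^ ?n" .
      qed
      finally show ?thesis .
    qed
    then show "(\<integral>\<^sup>+\<zeta>. (if cmod (1 - \<zeta> $ k) < \<delta> then 1 else 0) \<partial>sphere_measure) \<le> ennreal (C * \<delta> ^ ?n)"
      by (simp add: cap_def)
  qed
qed

text \<open>Dyadic decomposition of the sphere into caps about the direction of \<open>b\<close>.\<close>

lemma szego_kernel_integral:
  fixes M :: real
  assumes M: "real CARD('n) < M"
  obtains C where "0 < C" "\<And>b :: complex ^ 'n. b \<in> ball 0 1 \<Longrightarrow>
    (\<integral>\<^sup>+\<zeta>. ennreal (cmod (1 - cinner \<zeta> b) powr (- M)) \<partial>sphere_measure) \<le> ennreal (C * (1 - norm b) powr (real CARD('n) - M))"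
proof -
  let ?n = "real CARD('n)"
  obtain k :: 'n where True by blast
  obtain C where C: "0 < C" "\<And>\<delta>. 0 < \<delta> \<Longrightarrow>
    (\<integral>\<^sup>+\<zeta>. (if cmod (1 - (\<zeta> :: complex ^ 'n) $ k) < \<delta> then 1 else 0) \<partial>sphere_measure) \<le> ennreal (C * \<delta> ^ CARD('n))"
    by (rule emeasure_cap_le[of k]) blast
  \<comment> \<open>The \<open>j\<close>-th cap contributes a constant times
    \<open>(2 ^ j * \<delta>) powr (?n - M)\<close>; \<open>q\<close> is the ratio of this geometric
    series, and \<open>n < M\<close> puts it below 1.\<close>
  define q where "q = 2 powr (?n - M)"
  have q: "0 < q" "q < 1" using M by (auto simp: q_def powr_less_one)
  define C' where "C' = C * 4 powr M / (1 - q)"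
  have axis: "(\<integral>\<^sup>+\<zeta>. ennreal (cmod (1 - of_real \<rho> * \<zeta> $ k) powr (- M)) \<partial>(sphere_measure :: (complex ^ 'n) measure)) \<le>
      ennreal (C' * (1 - \<rho>) powr (?n - M))" if \<rho>: "0 \<le> \<rho>" "\<rho> < 1" for \<rho>
  proof -
    define \<delta> where "\<delta> = 1 - \<rho>"
    have \<delta>: "0 < \<delta>" using \<rho> by (simp add: \<delta>_def)
    \<comment> \<open>Outside the cap of index \<open>j - 1\<close> the kernel's denominator is at
      least \<open>2 ^ j * \<delta> / 4\<close>: one factor 2 from the dyadic step, one from
      \<open>|1 - \<zeta> $ k| \<le> 2 * ?x\<close>.\<close>
    define c where "c j = (2 ^ j * \<delta> / 4) powr (- M)" for j :: nat
    define cap where "cap j \<zeta> = (if cmod (1 - \<zeta> $ k) < 2 ^ j * \<delta> then 1 else 0 :: ennreal)" for j :: nat and \<zeta> :: "complex ^ 'n"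
    have [measurable]: "cap j \<in> borel_measurable borel" for j unfolding cap_def by measurable
    have pw: "ennreal (cmod (1 - of_real \<rho> * \<zeta> $ k) powr (- M)) \<le> (\<Sum>j. ennreal (c j) * cap j \<zeta>)"
      if "\<zeta> \<in> sphere 0 1" for \<zeta>
    proof -
      let ?x = "cmod (1 - of_real \<rho> * \<zeta> $ k)"
      have zk: "cmod (\<zeta> $ k) \<le> 1" using norm_component_le[of \<zeta> k] that by simp
      have x1: "\<delta> \<le> ?x"
        using norm_triangle_ineq2[of 1 "of_real \<rho> * \<zeta> $ k"] mult_left_mono[OF zk \<rho>(1)] \<rho>
        by (simp add: \<delta>_def norm_mult)
      have "cmod (1 - \<zeta> $ k) \<le> ?x + cmod (of_real (1 - \<rho>) * \<zeta> $ k)"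
        using norm_triangle_ineq4[of "1 - of_real \<rho> * \<zeta> $ k" "of_real (1 - \<rho>) * \<zeta> $ k"] by (simp add: algebra_simps)
      also have "cmod (of_real (1 - \<rho>) * \<zeta> $ k) \<le> \<delta> * 1"
        unfolding norm_mult norm_of_real using zk \<rho> by (intro mult_mono) (auto simp: \<delta>_def)
      finally have x2: "cmod (1 - \<zeta> $ k) \<le> 2 * ?x" using x1 by simp
      have "\<exists>j. cmod (1 - \<zeta> $ k) < 2 ^ j * \<delta>"
      proof -
        obtain j where "cmod (1 - \<zeta> $ k) / \<delta> < 2 ^ j" using real_arch_pow[of 2] by auto
        then show ?thesis using \<delta> by (auto simp: field_simps)
      qed
      then obtain j where j: "cmod (1 - \<zeta> $ k) < 2 ^ j * \<delta>" "\<And>i. i < j \<Longrightarrow> \<not> cmod (1 - \<zeta> $ k) < 2 ^ i * \<delta>"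
        using exists_least_iff[of "\<lambda>j. cmod (1 - \<zeta> $ k) < 2 ^ j * \<delta>"] by auto
      have "2 ^ j * \<delta> / 4 \<le> ?x"
      proof (cases j)
        case 0
        then show ?thesis using x1 \<delta> by simp
      next
        case (Suc i)
        then have "2 ^ i * \<delta> \<le> cmod (1 - \<zeta> $ k)" using j(2)[of i] by simp
        then show ?thesis using x2 Suc by (simp add: field_simps)
      qed
      then have "?x powr (- M) \<le> c j"
        unfolding c_def using M \<delta> by (intro powr_mono2') auto
      then have "ennreal (?x powr (- M)) \<le> ennreal (c j) * cap j \<zeta>"
        using j(1) by (simp add: cap_def ennreal_leI)
      also have "\<dots> \<le> (\<Sum>j. ennreal (c j) * cap j \<zeta>)"
        using sum_le_suminf[of "\<lambda>j. ennreal (c j) * cap j \<zeta>" "{j}"] by simp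
      finally show ?thesis .
    qed
    have "(\<integral>\<^sup>+\<zeta>. ennreal (cmod (1 - of_real \<rho> * \<zeta> $ k) powr (- M)) \<partial>(sphere_measure :: (complex ^ 'n) measure)) \<le>
        (\<integral>\<^sup>+\<zeta>. (\<Sum>j. ennreal (c j) * cap j \<zeta>) \<partial>sphere_measure)"
      by (intro nn_integral_mono pw) (simp add: space_sphere_measure)
    also have "\<dots> = (\<Sum>j. \<integral>\<^sup>+\<zeta>. ennreal (c j) * cap j \<zeta> \<partial>sphere_measure)"
      by (intro nn_integral_suminf measurable_sphere_measureI) measurable
    also have "\<dots> \<le> (\<Sum>j. ennreal (C * 4 powr M * \<delta> powr (?n - M) * q ^ j))"
    proof (rule suminf_le)
      fix j
      have "(\<integral>\<^sup>+\<zeta>. ennreal (c j) * cap j \<zeta> \<partial>sphere_measure) = ennreal (c j) * (\<integral>\<^sup>+\<zeta>. cap j \<zeta> \<partial>sphere_measure)"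
        by (intro nn_integral_cmult measurable_sphere_measureI) measurable
      also have "\<dots> \<le> ennreal (c j) * ennreal (C * (2 ^ j * \<delta>) ^ CARD('n))"
        unfolding cap_def using \<delta> by (intro mult_left_mono C(2)) auto
      also have "\<dots> = ennreal (c j * (C * (2 ^ j * \<delta>) ^ CARD('n)))"
        using C \<delta> by (simp add: ennreal_mult c_def)
      also have "c j * (C * (2 ^ j * \<delta>) ^ CARD('n)) = C * 4 powr M * \<delta> powr (?n - M) * q ^ j"
      proof -
        have "(2 ^ j * \<delta>) ^ CARD('n) = (2 ^ j * \<delta>) powr ?n" using \<delta> by (simp add: powr_realpow)
        moreover have "c j = (2 ^ j * \<delta>) powr (- M) * 4 powr M"
        proof -
          have "c j = (2 ^ j * \<delta>) powr (- M) / 4 powr (- M)"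
            unfolding c_def by (rule powr_divide)
          then show ?thesis by (simp add: powr_minus[of 4] divide_inverse)
        qed
        ultimately have "c j * (C * (2 ^ j * \<delta>) ^ CARD('n)) = C * 4 powr M * ((2 ^ j * \<delta>) powr (- M) * (2 ^ j * \<delta>) powr ?n)"
          by (simp only: mult_ac)
        also have "(2 ^ j * \<delta>) powr (- M) * (2 ^ j * \<delta>) powr ?n = (2 ^ j * \<delta>) powr (?n - M)"
          by (simp add: powr_add[symmetric])
        also have "\<dots> = (2 ^ j) powr (?n - M) * \<delta> powr (?n - M)"
          using \<delta> by (simp add: powr_mult)
        also have "(2 ^ j :: real) powr (?n - M) = q ^ j"
        proof -
          have "(2 ^ j :: real) powr (?n - M) = (2 powr real j) powr (?n - M)"
            by (simp add: powr_realpow)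
          also have "\<dots> = (2 powr (?n - M)) powr real j"
            unfolding powr_powr by (simp only: mult.commute)
          also have "\<dots> = q ^ j" unfolding q_def by (rule powr_realpow) simp
          finally show ?thesis .
        qed
        finally show ?thesis by (simp only: mult_ac)
      qed
      finally show "(\<integral>\<^sup>+\<zeta>. ennreal (c j) * cap j \<zeta> \<partial>sphere_measure) \<le> ennreal (C * 4 powr M * \<delta> powr (?n - M) * q ^ j)" .
    qed auto
    also have "\<dots> = ennreal (C * 4 powr M * \<delta> powr (?n - M) * (1 / (1 - q)))"
    proof (rule suminf_ennreal_eq)
      show "(\<lambda>j. C * 4 powr M * \<delta> powr (?n - M) * q ^ j) sums (C * 4 powr M * \<delta> powr (?n - M) * (1 / (1 - q)))"
        using q by (intro sums_mult geometric_sums) auto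
    qed (use C q in auto)
    also have "C * 4 powr M * \<delta> powr (?n - M) * (1 / (1 - q)) = C' * (1 - \<rho>) powr (?n - M)"
      by (simp add: C'_def \<delta>_def)
    finally show ?thesis .
  qed
  show ?thesis
  proof (rule that[of C'])
    show "0 < C'" using C q by (simp add: C'_def)
    fix b :: "complex ^ 'n" assume b: "b \<in> ball 0 1"
    define e where "e = (if b = 0 then axis k 1 else b /\<^sub>R norm b)"
    have e: "norm e = 1" "b = norm b *\<^sub>R e" by (auto simp: e_def)
    obtain U :: "complex ^ 'n \<Rightarrow> complex ^ 'n" where U: "unitary_map U" "\<And>x. U x $ k = cinner x e"
      using unitary_to_axis[OF e(1)] by metis
    have "cinner \<zeta> b = of_real (norm b) * U \<zeta> $ k" for \<zeta>
      unfolding U(2) by (subst e(2)) (simp add: scaleR_eq_smult cinner_smult_right)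
    then have "(\<integral>\<^sup>+\<zeta>. ennreal (cmod (1 - cinner \<zeta> b) powr (- M)) \<partial>sphere_measure) =
        (\<integral>\<^sup>+\<zeta>. ennreal (cmod (1 - of_real (norm b) * U \<zeta> $ k) powr (- M)) \<partial>sphere_measure)"
      by simp
    also have "\<dots> = (\<integral>\<^sup>+\<zeta>. ennreal (cmod (1 - of_real (norm b) * \<zeta> $ k) powr (- M)) \<partial>(sphere_measure :: (complex ^ 'n) measure))"
      by (rule nn_integral_sphere_unitary[OF _ U(1), of "\<lambda>\<zeta>. ennreal (cmod (1 - of_real (norm b) * \<zeta> $ k) powr (- M))"]) measurable
    also have "\<dots> \<le> ennreal (C' * (1 - norm b) powr (?n - M))"
      using b by (intro axis) auto
    finally show "(\<integral>\<^sup>+\<zeta>. ennreal (cmod (1 - cinner \<zeta> b) powr (- M)) \<partial>sphere_measure) \<le> \<dots>" .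
  qed
qed

subsection \<open>Boundedness and compactness\<close>

text \<open>Hedberg's argument: where the two bounds on \<open>F\<close> cross, the integral is split.\<close>

lemma hedberg_integral:
  fixes F :: "real \<Rightarrow> complex"
  assumes ab: "0 < \<alpha>" "\<alpha> < \<beta>" and NK: "0 < N" "0 < K" and D: "0 \<le> D"
    and cont: "continuous_on {0..1} F"
    and bnd: "\<And>t. 0 \<le> t \<Longrightarrow> t < 1 \<Longrightarrow> cmod (F t) \<le> D \<or>
      cmod (F t) \<le> N * (1 - t) powr (\<alpha> - 1) \<and> cmod (F t) \<le> K * (1 - t) powr (\<alpha> - 1 - \<beta>)"
  shows "cmod (integral {0..1} F) \<le> D + (1 / \<alpha> + 1 / (\<beta> - \<alpha>)) * (N powr (1 - \<alpha> / \<beta>) * K powr (\<alpha> / \<beta>))"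
proof -
  define \<delta> where "\<delta> = (K / N) powr (1 / \<beta>)"
  have \<delta>: "0 < \<delta>" using NK by (simp add: \<delta>_def)
  \<comment> \<open>Both majorants are taken over their full ranges, possibly beyond 1. This only
    enlarges the bound and avoids comparing \<open>\<delta>\<close> with 1.\<close>
  define H1 where "H1 x = ennreal (N * x powr (\<alpha> - 1)) * indicator {0..\<delta>} x" for x :: real
  define H2 where "H2 x = ennreal (K * x powr (\<alpha> - 1 - \<beta>)) * indicator {\<delta>..} x" for x :: real
  have [measurable]: "H1 \<in> borel_measurable borel" "H2 \<in> borel_measurable borel"
    unfolding H1_def H2_def by measurable
  \<comment> \<open>At the crossing point \<open>\<delta>\<close> the two halves are balanced:
    \<open>N * \<delta> powr \<alpha>\<close> and
    \<open>K * \<delta> powr (\<alpha> - \<beta>)\<close> both equal \<open>E\<close>.\<close>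
  define E where "E = N powr (1 - \<alpha> / \<beta>) * K powr (\<alpha> / \<beta>)"
  have E: "0 \<le> E" by (simp add: E_def)
  have e1: "N * \<delta> powr \<alpha> = E"
  proof -
    have "\<delta> powr \<alpha> = (K / N) powr (\<alpha> / \<beta>)" by (simp add: \<delta>_def powr_powr)
    also have "\<dots> = K powr (\<alpha> / \<beta>) / N powr (\<alpha> / \<beta>)" by (rule powr_divide)
    finally show ?thesis using NK by (simp add: E_def powr_diff)
  qed
  have e2: "K * \<delta> powr (\<alpha> - \<beta>) = E"
  proof -
    have "\<delta> powr \<beta> = K / N" using ab NK by (simp add: \<delta>_def powr_powr)
    then have "\<delta> powr (\<alpha> - \<beta>) = \<delta> powr \<alpha> / (K / N)" by (simp add: powr_diff)
    then show ?thesis using NK e1 by (simp add: field_simps)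
  qed
  have I1: "(\<integral>\<^sup>+x. H1 x \<partial>lborel) = ennreal (E / \<alpha>)"
  proof -
    have "((\<lambda>x. N * x powr (\<alpha> - 1)) has_integral N * (\<delta> powr (\<alpha> - 1 + 1) / (\<alpha> - 1 + 1))) {0..\<delta>}"
      using ab \<delta> by (intro has_integral_mult_right has_integral_powr_from_0) auto
    then have "((\<lambda>x. N * x powr (\<alpha> - 1)) has_integral E / \<alpha>) {0..\<delta>}"
      using e1 by simp
    then show ?thesis unfolding H1_def
      using NK by (intro nn_integral_has_integral_lebesgue') auto
  qed
  have I2: "(\<integral>\<^sup>+x. H2 x \<partial>lborel) = ennreal (E / (\<beta> - \<alpha>))"
  proof -
    have "((\<lambda>x. K * x powr (\<alpha> - 1 - \<beta>)) has_integral K * (- (\<delta> powr (\<alpha> - 1 - \<beta> + 1)) / (\<alpha> - 1 - \<beta> + 1))) {\<delta>..}"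
      using ab \<delta> by (intro has_integral_mult_right has_integral_powr_to_inf) auto
    also have "K * (- (\<delta> powr (\<alpha> - 1 - \<beta> + 1)) / (\<alpha> - 1 - \<beta> + 1)) = K * \<delta> powr (\<alpha> - \<beta>) / (\<beta> - \<alpha>)"
    proof -
      have "\<alpha> - 1 - \<beta> + 1 = \<alpha> - \<beta>" by simp
      then show ?thesis using ab by (simp only:) (simp add: field_simps)
    qed
    finally show ?thesis unfolding H2_def e2
      using NK by (intro nn_integral_has_integral_lebesgue') auto
  qed
  have "ennreal (cmod (integral {0..1} F)) \<le> ennreal (integral {0..1} (\<lambda>t. cmod (F t)))"
    using cont by (intro ennreal_leI integral_norm_bound_integral integrable_continuous_interval continuous_on_norm) auto
  also have "\<dots> = (\<integral>\<^sup>+t. ennreal (cmod (F t)) * indicator {0..1} t \<partial>lborel)"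
    using cont by (intro nn_integral_has_integral_lebesgue'[symmetric] integrable_integral
        integrable_continuous_interval continuous_on_norm) auto
  also have "\<dots> \<le> (\<integral>\<^sup>+t. ennreal D * indicator {0..1} t + (H1 (1 + - 1 * t) + H2 (1 + - 1 * t)) \<partial>lborel)"
  proof (rule nn_integral_mono_AE, rule eventually_mono[OF AE_lborel_singleton[of 1]])
    fix t :: real assume t: "t \<noteq> 1"
    show "ennreal (cmod (F t)) * indicator {0..1} t \<le> ennreal D * indicator {0..1} t + (H1 (1 + - 1 * t) + H2 (1 + - 1 * t))"
    proof (cases "0 \<le> t \<and> t < 1")
      case True
      then consider "cmod (F t) \<le> D" | "cmod (F t) \<le> N * (1 - t) powr (\<alpha> - 1)" "cmod (F t) \<le> K * (1 - t) powr (\<alpha> - 1 - \<beta>)"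
        using bnd by blast
      then show ?thesis
      proof cases
        case 1
        then have "ennreal (cmod (F t)) \<le> ennreal D" by (rule ennreal_leI)
        then show ?thesis using True by (simp add: add_increasing2)
      next
        case 2
        have "ennreal (cmod (F t)) \<le> H1 (1 - t) + H2 (1 - t)"
        proof (cases "1 - t \<le> \<delta>")
          case True
          with 2 \<open>0 \<le> t \<and> t < 1\<close> have "ennreal (cmod (F t)) \<le> H1 (1 - t)"
            by (simp add: H1_def ennreal_leI)
          then show ?thesis by (simp add: add_increasing2)
        next
          case False
          with 2 \<open>0 \<le> t \<and> t < 1\<close> have "ennreal (cmod (F t)) \<le> H2 (1 - t)"
            by (simp add: H2_def ennreal_leI)
          then show ?thesis by (simp add: add_increasing)
        qed
        then show ?thesis using True by (simp add: add_increasing)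
      qed
    next
      case False
      with t have "t \<notin> {0..1}" by auto
      then show ?thesis by simp
    qed
  qed
  also have "\<dots> = (\<integral>\<^sup>+t. ennreal D * indicator {0..1 :: real} t \<partial>lborel) + (\<integral>\<^sup>+t. H1 (1 + - 1 * t) + H2 (1 + - 1 * t) \<partial>lborel)"
    by (subst nn_integral_add) auto
  also have "(\<integral>\<^sup>+t. H1 (1 + - 1 * t) + H2 (1 + - 1 * t) \<partial>lborel) =
      (\<integral>\<^sup>+t. H1 (1 + - 1 * t) \<partial>lborel) + (\<integral>\<^sup>+t. H2 (1 + - 1 * t) \<partial>lborel)"
    by (subst nn_integral_add) auto
  also have "(\<integral>\<^sup>+t. ennreal D * indicator {0..1 :: real} t \<partial>lborel) = ennreal D"
    by (simp add: nn_integral_cmult)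
  also have "(\<integral>\<^sup>+t. H1 (1 + - 1 * t) \<partial>lborel) = (\<integral>\<^sup>+x. H1 x \<partial>lborel)"
    by (subst nn_integral_real_affine[of H1 "-1" 1]) auto
  also have "(\<integral>\<^sup>+t. H2 (1 + - 1 * t) \<partial>lborel) = (\<integral>\<^sup>+x. H2 x \<partial>lborel)"
    by (subst nn_integral_real_affine[of H2 "-1" 1]) auto
  also have "ennreal D + ((\<integral>\<^sup>+x. H1 x \<partial>lborel) + (\<integral>\<^sup>+x. H2 x \<partial>lborel)) = ennreal (D + (E / \<alpha> + E / (\<beta> - \<alpha>)))"
    unfolding I1 I2 using D E ab by (simp add: ennreal_plus)
  finally have "cmod (integral {0..1} F) \<le> D + (E / \<alpha> + E / (\<beta> - \<alpha>))"
    using D E ab by (subst (asm) ennreal_le_iff) auto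
  then show ?thesis unfolding E_def[symmetric] by (simp add: distrib_right)
qed

text \<open>A quasi-triangle inequality that treats exponents below and above 1 alike, by comparison
  with twice the larger summand.\<close>

lemma powr_add_le:
  fixes a b q :: real
  assumes "0 \<le> a" "0 \<le> b" "0 < q"
  shows "(a + b) powr q \<le> 2 powr q * (a powr q + b powr q)"
proof -
  have "(a + b) powr q \<le> (2 * max a b) powr q"
    using assms by (intro powr_mono2) auto
  also have "\<dots> = 2 powr q * max a b powr q"
    using assms by (intro powr_mult)
  also have "max a b powr q \<le> a powr q + b powr q"
    using assms by (simp add: max_def)
  finally show ?thesis by simp
qed

lemma hardy_mean_cong:
  assumes "\<And>z. z \<in> ball 0 1 \<Longrightarrow> f z = g z"
  shows "hardy_mean p f = hardy_mean p g"
proof -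
  have "modp p f = modp p g" using assms by (auto simp: modp_def indicator_def)
  then show ?thesis by (simp add: hardy_mean_modp)
qed

lemma hardy_mean_diff_le:
  assumes f: "f holomorphic_vec_on ball 0 1" and g: "g holomorphic_vec_on ball 0 1" and p: "0 < p"
  shows "hardy_mean p (\<lambda>z. f z - g z) \<le> ennreal (2 powr p) * (hardy_mean p f + hardy_mean p g)"
  unfolding hardy_mean_modp[of p "\<lambda>z. f z - g z"]
proof (rule SUP_least)
  fix r :: real assume r: "r \<in> {0<..<1}"
  note [measurable] = measurable_modp[OF f] measurable_modp[OF g]
  have "modp p (\<lambda>z. f z - g z) z \<le> ennreal (2 powr p) * (modp p f z + modp p g z)" for z
  proof -
    let ?a = "cmod (indicat_real (ball 0 1) z *\<^sub>R f z)" and ?b = "cmod (indicat_real (ball 0 1) z *\<^sub>R g z)"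
    have "cmod (indicat_real (ball 0 1) z *\<^sub>R (f z - g z)) \<le> ?a + ?b"
      using norm_triangle_ineq4[of "indicat_real (ball 0 1) z *\<^sub>R f z" "indicat_real (ball 0 1) z *\<^sub>R g z"]
      by (simp add: scaleR_diff_right)
    then have "cmod (indicat_real (ball 0 1) z *\<^sub>R (f z - g z)) powr p \<le> (?a + ?b) powr p"
      using p by (intro powr_mono2) auto
    also have "\<dots> \<le> 2 powr p * (?a powr p + ?b powr p)"
      using p by (intro powr_add_le) auto
    finally have "modp p (\<lambda>z. f z - g z) z \<le> ennreal (2 powr p * (?a powr p + ?b powr p))"
      unfolding modp_def by (rule ennreal_leI)
    also have "\<dots> = ennreal (2 powr p) * (modp p f z + modp p g z)"
      by (simp add: modp_def ennreal_mult ennreal_plus del: norm_scaleR)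
    finally show ?thesis .
  qed
  then have "(\<integral>\<^sup>+\<zeta>. modp p (\<lambda>z. f z - g z) (r *\<^sub>R \<zeta>) \<partial>sphere_measure) \<le>
      (\<integral>\<^sup>+\<zeta>. ennreal (2 powr p) * (modp p f (r *\<^sub>R \<zeta>) + modp p g (r *\<^sub>R \<zeta>)) \<partial>sphere_measure)"
    by (intro nn_integral_mono)
  also have "\<dots> = ennreal (2 powr p) * ((\<integral>\<^sup>+\<zeta>. modp p f (r *\<^sub>R \<zeta>) \<partial>sphere_measure) + (\<integral>\<^sup>+\<zeta>. modp p g (r *\<^sub>R \<zeta>) \<partial>sphere_measure))"
  proof -
    have [measurable]: "(\<lambda>\<zeta>. modp p f (r *\<^sub>R \<zeta>)) \<in> borel_measurable sphere_measure"
      "(\<lambda>\<zeta>. modp p g (r *\<^sub>R \<zeta>)) \<in> borel_measurable sphere_measure"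
      by (intro measurable_sphere_measureI; measurable)+
    show ?thesis by (simp add: nn_integral_cmult nn_integral_add)
  qed
  also have "\<dots> \<le> ennreal (2 powr p) * (hardy_mean p f + hardy_mean p g)"
    using r by (intro mult_left_mono add_mono hardy_mean_upper) auto
  finally show "(\<integral>\<^sup>+\<zeta>. modp p (\<lambda>z. f z - g z) (r *\<^sub>R \<zeta>) \<partial>sphere_measure) \<le> \<dots>" .
qed

lemma hardy_pointwise_real:
  fixes f :: "complex ^ 'n \<Rightarrow> complex" and L :: real
  assumes f: "f holomorphic_vec_on ball 0 1" and p: "0 < p" and z: "z \<in> ball 0 1"
    and L: "hardy_mean p f \<le> ennreal L" "0 \<le> L"
  shows "cmod (f z) \<le> (3 * real CARD('n) * 4 ^ CARD('n) * L) powr (1 / p) * (1 - norm z) powr (- (CARD('n) / p))"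
proof -
  let ?n = "CARD('n)"
  have z1: "0 < 1 - norm z" using z by simp
  have "ennreal (cmod (f z) powr p) \<le> ennreal (3 * real ?n * 4 ^ ?n / (1 - norm z) ^ ?n) * ennreal L"
  proof -
    have "ennreal (cmod (f z) powr p) \<le> ennreal (3 * real ?n * 4 ^ ?n / (1 - norm z) ^ ?n) * hardy_mean p f"
      using hardy_pointwise[OF f p z] by simp
    then show ?thesis using L(1) by (meson mult_left_mono order_trans zero_le)
  qed
  also have "\<dots> = ennreal (3 * real ?n * 4 ^ ?n / (1 - norm z) ^ ?n * L)"
    using z1 L by (intro ennreal_mult[symmetric]) auto
  finally have "cmod (f z) powr p \<le> 3 * real ?n * 4 ^ ?n / (1 - norm z) ^ ?n * L"
    using z1 L by (subst (asm) ennreal_le_iff) auto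
  also have "\<dots> = (3 * real ?n * 4 ^ ?n * L) * (1 - norm z) powr (- ?n)"
    using z1 by (simp add: powr_minus powr_realpow divide_inverse)
  finally have "(cmod (f z) powr p) powr (1 / p) \<le> ((3 * real ?n * 4 ^ ?n * L) * (1 - norm z) powr (- ?n)) powr (1 / p)"
    using p by (intro powr_mono2) auto
  also have "(cmod (f z) powr p) powr (1 / p) = cmod (f z)"
    using p by (simp add: powr_powr)
  also have "((3 * real ?n * 4 ^ ?n * L) * (1 - norm z) powr (- ?n)) powr (1 / p) =
      (3 * real ?n * 4 ^ ?n * L) powr (1 / p) * (1 - norm z) powr (- (?n / p))"
    using L by (simp add: powr_mult powr_powr)
  finally show ?thesis .
qed

lemma radial_quot_le:
  assumes g: "g holomorphic_vec_on ball 0 1" and \<rho>: "\<rho> < 1"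
  obtains B where "0 \<le> B" "\<And>z t. z \<in> ball 0 1 \<Longrightarrow> 0 \<le> t \<Longrightarrow> t * norm z \<le> \<rho> \<Longrightarrow> cmod (radial_quot g z t) \<le> B"
proof -
  have "\<exists>b. \<forall>z\<in>cball 0 \<rho>. cmod (partial_deriv k g z) \<le> b" for k
  proof -
    have "continuous_on (cball 0 \<rho>) (partial_deriv k g)"
      using \<rho> by (intro continuous_on_subset[OF holomorphic_vec_imp_continuous_on[OF holomorphic_vec_partial_deriv[OF g open_ball]]]) auto
    then have "bounded (partial_deriv k g ` cball 0 \<rho>)"
      by (intro compact_imp_bounded compact_continuous_image compact_cball)
    then show ?thesis by (auto simp: bounded_iff)
  qed
  then obtain b where b: "\<And>k z. z \<in> cball 0 \<rho> \<Longrightarrow> cmod (partial_deriv k g z) \<le> b k" by metis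
  show ?thesis
  proof (rule that[of "\<Sum>k\<in>UNIV. \<bar>b k\<bar>"])
    show "0 \<le> (\<Sum>k\<in>UNIV. \<bar>b k\<bar>)" by (simp add: sum_nonneg)
    fix z :: "complex ^ 'a" and t :: real assume z: "z \<in> ball 0 1" and t: "0 \<le> t" "t * norm z \<le> \<rho>"
    have "cmod (radial_quot g z t) \<le> (\<Sum>k\<in>UNIV. cmod (z $ k * partial_deriv k g (t *\<^sub>R z)))"
      unfolding radial_quot_def by (rule norm_sum)
    also have "\<dots> \<le> (\<Sum>k\<in>UNIV. \<bar>b k\<bar>)"
    proof (rule sum_mono)
      fix k
      have "cmod (z $ k) \<le> 1" using norm_component_le[of z k] z by simp
      moreover have "cmod (partial_deriv k g (t *\<^sub>R z)) \<le> \<bar>b k\<bar>"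
        using b[of "t *\<^sub>R z" k] t by simp
      ultimately show "cmod (z $ k * partial_deriv k g (t *\<^sub>R z)) \<le> \<bar>b k\<bar>"
        using mult_mono[of "cmod (z $ k)" 1 "cmod (partial_deriv k g (t *\<^sub>R z))" "\<bar>b k\<bar>"] by (simp add: norm_mult)
    qed
    finally show "cmod (radial_quot g z t) \<le> (\<Sum>k\<in>UNIV. \<bar>b k\<bar>)" .
  qed
qed

text \<open>The order of the quantifiers is the point: \<open>X\<close> is fixed before
  \<open>f\<close>, \<open>g\<close>, \<open>M\<close>, \<open>\<rho>\<close>, \<open>S\<close> and
  \<open>B\<close>. So \<open>M\<close> can be made small by moving \<open>\<rho>\<close> towards 1,
  and afterwards \<open>S\<close> by uniform convergence on the ball of radius
  \<open>\<rho>\<close>.\<close>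

theorem J_op_hardy_bound:
  fixes p q \<alpha> L :: real
  assumes pq: "0 < p" "p < q" and \<alpha>: "\<alpha> = real CARD('n) * (1 / p - 1 / q)" "\<alpha> < 1" and L: "0 < L"
  obtains X where "0 \<le> X" "\<And>(f :: complex ^ 'n \<Rightarrow> complex) g M \<rho> S B.
    f holomorphic_vec_on ball 0 1 \<Longrightarrow> g holomorphic_vec_on ball 0 1 \<Longrightarrow> hardy_mean p f \<le> ennreal L \<Longrightarrow>
    0 < M \<Longrightarrow> 1 / 2 \<le> \<rho> \<Longrightarrow> 
    (\<And>z. \<rho> < norm z \<Longrightarrow> norm z < 1 \<Longrightarrow> (1 - (norm z)\<^sup>2) powr (1 - \<alpha>) * cmod (radial_deriv g z) \<le> M) \<Longrightarrow>
    0 \<le> S \<Longrightarrow> (\<And>z. norm z < 1 \<Longrightarrow> norm z \<le> \<rho> \<Longrightarrow> cmod (f z) \<le> S) \<Longrightarrow>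
    0 \<le> B \<Longrightarrow> (\<And>z t. z \<in> ball 0 1 \<Longrightarrow> 0 \<le> t \<Longrightarrow> t * norm z \<le> \<rho> \<Longrightarrow> cmod (radial_quot g z t) \<le> B) \<Longrightarrow>
    hardy_mean q (J_op g f) \<le> ennreal (2 powr q * (S * B) powr q + M powr q * X)"
proof -
  let ?n = "real CARD('n)"
  define \<beta> where "\<beta> = ?n / p"
  have \<alpha>0: "0 < \<alpha>" unfolding \<alpha>(1) using pq by (simp add: frac_less2)
  have q: "0 < q" using pq by simp
  have \<alpha>\<beta>: "\<alpha> < \<beta>" unfolding \<alpha>(1) \<beta>_def using q by (simp add: right_diff_distrib)
  \<comment> \<open>With the growth exponent \<open>\<beta> = n / p\<close>, Hedberg's bound carries
    \<open>N\<close> to the power \<open>p / q\<close>. Its \<open>q\<close>-th power is then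
    \<open>N powr p\<close>, a multiple of the integrable square of the slice maximal
    function.\<close>
  have rat: "\<alpha> / \<beta> = 1 - p / q" "1 - \<alpha> / \<beta> = p / q"
    unfolding \<alpha>(1) \<beta>_def using pq by (simp_all add: field_simps)
  define c where "c = 1 / \<alpha> + 1 / (\<beta> - \<alpha>)"
  have c0: "0 < c" unfolding c_def using \<alpha>0 \<alpha>\<beta> by (intro add_pos_pos) auto
  then have c: "0 \<le> c" by simp
  define K where "K = (3 * real CARD('n) * 4 ^ CARD('n) * L) powr (1 / p)"
  have K: "0 < K" using L by (simp add: K_def)
  define X0 where "X0 = 2 powr q * ((2 * c) powr q * (K powr (1 - p / q)) powr q)"
  define X where "X = X0 * 256 * 4096 * L"
  have X0: "0 \<le> X0" by (simp add: X0_def)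
  show ?thesis
  proof (rule that[of X])
    show "0 \<le> X" using L X0 by (simp add: X_def)
    fix f g :: "complex ^ 'n \<Rightarrow> complex" and M \<rho> S B :: real
    assume f: "f holomorphic_vec_on ball 0 1" and g: "g holomorphic_vec_on ball 0 1"
      and fL: "hardy_mean p f \<le> ennreal L" and M: "0 < M" and \<rho>: "1 / 2 \<le> \<rho>"
      and gM: "\<And>z. \<rho> < norm z \<Longrightarrow> norm z < 1 \<Longrightarrow> (1 - (norm z)\<^sup>2) powr (1 - \<alpha>) * cmod (radial_deriv g z) \<le> M"
      and S: "0 \<le> S" "\<And>z. norm z < 1 \<Longrightarrow> norm z \<le> \<rho> \<Longrightarrow> cmod (f z) \<le> S"
      and B: "0 \<le> B" "\<And>z t. z \<in> ball 0 1 \<Longrightarrow> 0 \<le> t \<Longrightarrow> t * norm z \<le> \<rho> \<Longrightarrow> cmod (radial_quot g z t) \<le> B"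
    show "hardy_mean q (J_op g f) \<le> ennreal (2 powr q * (S * B) powr q + M powr q * X)"
      unfolding hardy_mean_modp
    proof (rule SUP_least)
      fix r :: real assume r: "r \<in> {0<..<1}"
      \<comment> \<open>\<open>R\<close> lies strictly between \<open>r\<close> and 1, so the slice
        functions extend past the closed disc; \<open>J\<close> is then chosen to make the dyadic
        radii in the disc of radius \<open>R\<close> reach \<open>r\<close>.\<close>
      define R where "R = (1 + r) / 2"
      have R: "0 < R" "R < 1" "r < R" using r by (auto simp: R_def)
      obtain J where J: "(1 / 2) ^ J < 1 - r / R"
        using real_arch_pow_inv[of "1 - r / R" "1 / 2"] R r by (auto simp: field_simps)
      have rJ: "r \<le> R * (1 - 1 / 2 ^ J)"
      proof -
        have "R * (r / R) \<le> R * (1 - 1 / 2 ^ J)"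
          using J R by (intro mult_left_mono) (auto simp: power_one_over)
        then show ?thesis using R by simp
      qed
      define W where "W = slice_max p J R f"
      have [measurable]: "W \<in> borel_measurable borel" unfolding W_def by (rule measurable_slice_max[OF f])
      have pw: "modp q (J_op g f) (r *\<^sub>R \<zeta>) \<le> ennreal (2 powr q * (S * B) powr q) + ennreal (M powr q * X0 * 256) * (W \<zeta>)\<^sup>2"
        if \<zeta>: "\<zeta> \<in> sphere 0 1" for \<zeta>
      proof (cases "W \<zeta>")
        \<comment> \<open>The coefficient is positive, so the right side is infinite here.\<close>
        case top
        then have "ennreal (M powr q * X0 * 256) * (W \<zeta>)\<^sup>2 = \<infinity>"
        proof -
          have "0 < M powr q * X0 * 256" using M K c0 by (simp add: X0_def)
          then have "ennreal (M powr q * X0 * 256) \<noteq> 0" by (simp only: ennreal_eq_0_iff not_le)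
          moreover have "a * top\<^sup>2 = \<infinity>" if "a \<noteq> 0" for a :: ennreal
            using that by (simp add: power2_eq_square ennreal_mult_eq_top_iff)
          ultimately show ?thesis unfolding top by blast
        qed
        then show ?thesis by simp
      next
        case (real w)
        define z where "z = r *\<^sub>R \<zeta>"
        have nz: "norm z = r" and zB: "z \<in> ball 0 1" using \<zeta> r by (auto simp: z_def)
        define F where "F t = f (t *\<^sub>R z) * radial_quot g z t" for t
        have contF: "continuous_on {0..1} F"
        proof -
          have "continuous_on {0..1} (\<lambda>t. f (t *\<^sub>R z) * radial_quot g z t)"
            by (rule continuous_on_J_slice[OF f g zB])
          then show ?thesis by (simp add: F_def[abs_def])
        qed
        \<comment> \<open>\<open>16 * w\<close> dominates \<open>|f| powr (p / 2)\<close> along the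
          radius; the power \<open>2 / p\<close> recovers \<open>|f|\<close>.\<close>
        define N where "N = (16 * w) powr (2 / p)"
        have fN: "cmod (f (t *\<^sub>R z)) \<le> N" if t: "0 \<le> t" "t \<le> 1" for t
        proof -
          have "t * r \<le> 1 * r" using t r by (intro mult_right_mono) auto
          with rJ have "t * r \<le> R * (1 - 1 / 2 ^ J)" by linarith
          then have "modp (p / 2) f ((t * r) *\<^sub>R \<zeta>) \<le> 16 * W \<zeta>"
            unfolding W_def using \<zeta> R t r pq by (intro modp_le_slice_max f) auto
          moreover have "(t * r) *\<^sub>R \<zeta> = t *\<^sub>R z" by (simp add: z_def)
          ultimately have "ennreal (cmod (f (t *\<^sub>R z)) powr (p / 2)) \<le> 16 * ennreal w"
            using scaleR_in_ball[OF zB t] real by (simp add: modp_in_ball)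
          also have "16 * ennreal w = ennreal (16 * w)"
            using real by (simp add: ennreal_mult)
          finally have "cmod (f (t *\<^sub>R z)) powr (p / 2) \<le> 16 * w"
            using real by (subst (asm) ennreal_le_iff) auto
          then have "(cmod (f (t *\<^sub>R z)) powr (p / 2)) powr (2 / p) \<le> N"
            unfolding N_def using pq by (intro powr_mono2) auto
          then show ?thesis using pq by (simp add: powr_powr)
        qed
        \<comment> \<open>Hedberg's lemma needs \<open>N > 0\<close>. For \<open>w = 0\<close> the
          function vanishes along the whole radius and the integral is 0.\<close>
        have bnd: "cmod (J_op g f z) \<le> S * B + c * ((2 * M * N) powr (p / q) * (2 * M * K) powr (1 - p / q))"
        proof (cases "w = 0")
          case True
          then have "f (t *\<^sub>R z) = 0" if "t \<in> {0..1}" for t using fN[of t] that by (simp add: N_def)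
          then have "J_op g f z = integral {0..1} (\<lambda>t :: real. 0)"
            unfolding J_op_eq by (intro Henstock_Kurzweil_Integration.integral_cong) simp
          then show ?thesis using c S B by simp
        next
          case False
          then have N: "0 < N" using real by (simp add: N_def)
          have "cmod (integral {0..1} F) \<le> S * B + (1 / \<alpha> + 1 / (\<beta> - \<alpha>)) * ((2 * M * N) powr (1 - \<alpha> / \<beta>) * (2 * M * K) powr (\<alpha> / \<beta>))"
          proof (rule hedberg_integral[OF \<alpha>0 \<alpha>\<beta> _ _ _ contF])
            show "0 < 2 * M * N" "0 < 2 * M * K" "0 \<le> S * B" using M N K S B by auto
            fix t :: real assume t: "0 \<le> t" "t < 1"
            have tB: "t *\<^sub>R z \<in> ball 0 1" using scaleR_in_ball[OF zB] t by auto
            have ntz: "norm (t *\<^sub>R z) = t * r" using t nz by simp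
            show "cmod (F t) \<le> S * B \<or> cmod (F t) \<le> 2 * M * N * (1 - t) powr (\<alpha> - 1) \<and>
              cmod (F t) \<le> 2 * M * K * (1 - t) powr (\<alpha> - 1 - \<beta>)"
            proof (cases "t * r \<le> \<rho>")
              case True
              have "cmod (f (t *\<^sub>R z)) * cmod (radial_quot g z t) \<le> S * B"
                using S(2)[of "t *\<^sub>R z"] B(2)[OF zB t(1)] tB True t nz S(1)
                by (intro mult_mono) auto
              then show ?thesis by (simp add: F_def norm_mult)
            next
              case False
              have "t * r \<le> t * 1" using t r by (intro mult_left_mono) auto
              then have tr: "t * r \<le> t" by simp
              \<comment> \<open>Dividing the bound for the radial derivative by \<open>t\<close>
                costs a factor at most 2; this is where \<open>1 / 2 \<le> \<rho>\<close>
                enters.\<close>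
              have t2: "1 / 2 \<le> t" using False \<rho> tr by linarith
              have tr1: "t * r < 1" using tr t by linarith
              \<comment> \<open>The powers that occur are nonpositive, so replacing
                \<open>1 - t * r\<close> by the smaller \<open>1 - t\<close> yields bounds
                independent of \<open>r\<close>.\<close>
              have le1: "(1 - t * r) powr e \<le> (1 - t) powr e" if "e \<le> 0" for e
                using that tr t by (intro powr_mono2') auto
              have "(1 - (t * r)\<^sup>2) powr (1 - \<alpha>) * cmod (radial_deriv g (t *\<^sub>R z)) \<le> M"
                using gM[of "t *\<^sub>R z"] False tr1 unfolding ntz by simp
              moreover have "(1 - t * r) powr (1 - \<alpha>) \<le> (1 - (t * r)\<^sup>2) powr (1 - \<alpha>)"
              proof (rule powr_mono2)
                have "(t * r)\<^sup>2 \<le> 1 * (t * r)" unfolding power2_eq_square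
                  using tr1 t r by (intro mult_right_mono) auto
                then show "1 - t * r \<le> 1 - (t * r)\<^sup>2" by simp
              qed (use \<alpha> tr1 in auto)
              ultimately have "(1 - t * r) powr (1 - \<alpha>) * cmod (radial_deriv g (t *\<^sub>R z)) \<le> M"
                by (meson mult_right_mono norm_ge_zero order_trans)
              then have "(1 - t * r) powr (1 - \<alpha>) * cmod (radial_deriv g (t *\<^sub>R z)) * (1 - t * r) powr (\<alpha> - 1)
                  \<le> M * (1 - t * r) powr (\<alpha> - 1)"
                by (rule mult_right_mono) simp
              moreover have "a * x * b = x * (a * b)" for a b x :: real by simp
              moreover have "(1 - t * r) powr (1 - \<alpha>) * (1 - t * r) powr (\<alpha> - 1) = 1"
                using tr1 by (simp add: powr_add[symmetric])
              ultimately have "cmod (radial_deriv g (t *\<^sub>R z)) \<le> M * (1 - t * r) powr (\<alpha> - 1)"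
                by (metis mult.right_neutral)
              also have "\<dots> \<le> M * (1 - t) powr (\<alpha> - 1)"
                using M \<alpha> by (intro mult_left_mono le1) auto
              finally have "t * cmod (radial_quot g z t) \<le> M * (1 - t) powr (\<alpha> - 1)"
                using t by (simp add: radial_deriv_scaleR norm_mult)
              moreover have "1 / 2 * cmod (radial_quot g z t) \<le> t * cmod (radial_quot g z t)"
                using t2 by (intro mult_right_mono) auto
              ultimately have rq: "cmod (radial_quot g z t) \<le> 2 * M * (1 - t) powr (\<alpha> - 1)" by linarith
              have fK: "cmod (f (t *\<^sub>R z)) \<le> K * (1 - t) powr (- \<beta>)"
              proof -
                have "cmod (f (t *\<^sub>R z)) \<le> K * (1 - t * r) powr (- \<beta>)"
                  using hardy_pointwise_real[OF f pq(1) tB fL] L unfolding ntz K_def \<beta>_def by simp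
                also have "\<dots> \<le> K * (1 - t) powr (- \<beta>)"
                  using K \<alpha>0 \<alpha>\<beta> by (intro mult_left_mono le1) auto
                finally show ?thesis .
              qed
              have "cmod (F t) \<le> N * (2 * M * (1 - t) powr (\<alpha> - 1))"
                unfolding F_def norm_mult using fN[of t] rq t N by (intro mult_mono) auto
              moreover have "cmod (F t) \<le> K * (1 - t) powr (- \<beta>) * (2 * M * (1 - t) powr (\<alpha> - 1))"
                unfolding F_def norm_mult using fK rq K by (intro mult_mono) auto
              moreover have "(1 - t) powr (- \<beta>) * (1 - t) powr (\<alpha> - 1) = (1 - t) powr (\<alpha> - 1 - \<beta>)"
                by (simp add: powr_add[symmetric])
              ultimately show ?thesis by (simp add: mult_ac)
            qed
          qed
          then show ?thesis unfolding rat(2) unfolding rat(1) c_def[symmetric] J_op_eq F_def .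
        qed
        have "cmod (J_op g f z) powr q \<le> (S * B + c * ((2 * M * N) powr (p / q) * (2 * M * K) powr (1 - p / q))) powr q"
          using bnd q by (intro powr_mono2) auto
        also have "\<dots> \<le> 2 powr q * ((S * B) powr q + (c * ((2 * M * N) powr (p / q) * (2 * M * K) powr (1 - p / q))) powr q)"
          using S B c q by (intro powr_add_le) auto
        also have "(c * ((2 * M * N) powr (p / q) * (2 * M * K) powr (1 - p / q))) powr q =
            (2 * c) powr q * M powr q * (N powr p * (K powr (1 - p / q)) powr q)"
        proof -
          have "(2 * M) powr (p / q) * (2 * M) powr (1 - p / q) = 2 * M"
            using M by (simp add: powr_add[symmetric])
          then have "c * ((2 * M * N) powr (p / q) * (2 * M * K) powr (1 - p / q)) =
            (2 * c) * M * (N powr (p / q) * K powr (1 - p / q))"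
          proof -
            assume AA: "(2 * M) powr (p / q) * (2 * M) powr (1 - p / q) = 2 * M"
            have alg: "c * ((A * a) * (A' * b)) = c * (A * A') * (a * b)" for A A' a b :: real
              by (simp only: mult_ac)
            have "c * ((2 * M * N) powr (p / q) * (2 * M * K) powr (1 - p / q)) =
                c * ((2 * M) powr (p / q) * (2 * M) powr (1 - p / q)) * (N powr (p / q) * K powr (1 - p / q))"
              unfolding powr_mult[of "2 * M" N] powr_mult[of "2 * M" K] by (rule alg)
            also have "\<dots> = c * (2 * M) * (N powr (p / q) * K powr (1 - p / q))"
              by (simp only: AA)
            finally show ?thesis by (simp only: mult_ac)
          qed
          also have "\<dots> powr q = (2 * c) powr q * M powr q * ((N powr (p / q)) powr q * (K powr (1 - p / q)) powr q)"
            by (simp only: powr_mult)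
          also have "(N powr (p / q)) powr q = N powr p"
            using q by (simp add: powr_powr)
          finally show ?thesis .
        qed
        also have "N powr p = 256 * w\<^sup>2"
        proof -
          have "N powr p = (16 * w) powr 2" using pq by (simp add: N_def powr_powr)
          also have "\<dots> = (16 * w)\<^sup>2" using real by simp
          finally show ?thesis by (simp add: power_mult_distrib)
        qed
        also have "2 powr q * ((S * B) powr q + (2 * c) powr q * M powr q * (256 * w\<^sup>2 * (K powr (1 - p / q)) powr q)) =
            2 powr q * (S * B) powr q + (M powr q * X0 * 256) * w\<^sup>2"
          by (simp add: X0_def algebra_simps)
        finally have "ennreal (cmod (J_op g f z) powr q) \<le> ennreal (2 powr q * (S * B) powr q + (M powr q * X0 * 256) * w\<^sup>2)"
          by (rule ennreal_leI)
        also have "\<dots> = ennreal (2 powr q * (S * B) powr q) + ennreal (M powr q * X0 * 256) * (ennreal w)\<^sup>2"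
          using X0 real by (simp add: ennreal_plus ennreal_mult ennreal_power)
        finally show ?thesis
          using real zB by (simp add: modp_in_ball z_def[symmetric])
      qed
      have "(\<integral>\<^sup>+\<zeta>. modp q (J_op g f) (r *\<^sub>R \<zeta>) \<partial>sphere_measure) \<le>
        (\<integral>\<^sup>+\<zeta>. ennreal (2 powr q * (S * B) powr q) + ennreal (M powr q * X0 * 256) * (W \<zeta>)\<^sup>2 \<partial>sphere_measure)"
        by (intro nn_integral_mono pw) (simp add: space_sphere_measure)
      also have "\<dots> = (\<integral>\<^sup>+\<zeta>. ennreal (2 powr q * (S * B) powr q) \<partial>(sphere_measure :: (complex ^ 'n) measure)) +
          ennreal (M powr q * X0 * 256) * (\<integral>\<^sup>+\<zeta>. (W \<zeta>)\<^sup>2 \<partial>sphere_measure)"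
      proof -
        have [measurable]: "W \<in> borel_measurable sphere_measure"
          by (rule measurable_sphere_measureI) measurable
        show ?thesis by (simp add: nn_integral_cmult nn_integral_add)
      qed
      also have "(\<integral>\<^sup>+\<zeta>. ennreal (2 powr q * (S * B) powr q) \<partial>(sphere_measure :: (complex ^ 'n) measure)) = ennreal (2 powr q * (S * B) powr q)"
        by (simp add: emeasure_sphere_space)
      also have "ennreal (M powr q * X0 * 256) * (\<integral>\<^sup>+\<zeta>. (W \<zeta>)\<^sup>2 \<partial>sphere_measure) \<le>
          ennreal (M powr q * X0 * 256) * (ennreal 4096 * ennreal L)"
        unfolding W_def
        by (intro mult_left_mono order_trans[OF nn_integral_slice_max_le[OF f R(1,2)]] fL) auto
      also have "ennreal (M powr q * X0 * 256) * (ennreal 4096 * ennreal L) = ennreal (M powr q * X)"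
        using X0 L by (simp add: X_def ennreal_mult[symmetric] mult_ac del: ennreal_numeral)
      also have "ennreal (2 powr q * (S * B) powr q) + ennreal (M powr q * X) = ennreal (2 powr q * (S * B) powr q + M powr q * X)"
        using X0 L by (simp add: ennreal_plus X_def)
      finally show "(\<integral>\<^sup>+\<zeta>. modp q (J_op g f) (r *\<^sub>R \<zeta>) \<partial>sphere_measure) \<le> \<dots>"
        by (simp add: add_left_mono)
    qed
  qed
qed

text \<open>On the line through \<open>x\<close> with direction \<open>v = y - x\<close> the
  function is bounded by \<open>M\<close> on the disc of radius \<open>R \<ge> 2\<close>. Cauchy's
  estimate on discs of radius \<open>R - 1 \<ge> R / 2\<close> bounds the derivative on the unit
  disc, which contains 0 and 1.\<close>

lemma holomorphic_vec_lipschitz: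
  fixes f :: "complex ^ 'n \<Rightarrow> complex"
  assumes f: "f holomorphic_vec_on ball 0 1" and \<rho>: "\<rho> < \<rho>'" "\<rho>' < 1"
    and M: "\<And>z. norm z \<le> \<rho>' \<Longrightarrow> cmod (f z) \<le> M"
    and xy: "norm x \<le> \<rho>" "norm (y - x) \<le> (\<rho>' - \<rho>) / 2"
  shows "cmod (f y - f x) \<le> 2 * M / (\<rho>' - \<rho>) * norm (y - x)"
proof (cases "y = x")
  case False
  define v where "v = y - x"
  define R where "R = (\<rho>' - \<rho>) / norm v"
  have v: "0 < norm v" using False by (simp add: v_def)
  have R: "2 \<le> R" using xy v by (simp add: R_def v_def[symmetric] field_simps)
  have in_B: "norm (x + w *s v) \<le> \<rho>'" if "cmod w \<le> R" for w
  proof -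
    have "norm (x + w *s v) \<le> norm x + cmod w * norm v"
      using norm_triangle_ineq[of x "w *s v"] by simp
    also have "\<dots> \<le> \<rho> + R * norm v" using xy that v by (intro add_mono mult_right_mono) auto
    finally show ?thesis using v by (simp add: R_def)
  qed
  have "cmod (f x) \<le> M" using xy \<rho> by (intro M) simp
  then have M0: "0 \<le> M" by (meson norm_ge_zero order_trans)
  define \<phi> where "\<phi> w = f (x + w *s v)" for w
  have hol: "\<phi> holomorphic_on cball 0 R"
    unfolding \<phi>_def
  proof (rule holomorphic_vec_line_holomorphic[OF f open_ball])
    fix w :: complex assume "w \<in> cball 0 R"
    then have "norm (x + w *s v) \<le> \<rho>'" by (intro in_B) simp
    then show "x + w *s v \<in> ball 0 1" using \<rho> by simp
  qed
  have "cmod (\<phi> 1 - \<phi> 0) \<le> 2 * M / R * cmod (1 - 0)"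
  proof (rule field_differentiable_bound[where S = "cball 0 1" and f' = "deriv \<phi>"])
    fix w :: complex assume w: "w \<in> cball 0 1"
    have sub: "cball w (R - 1) \<subseteq> cball 0 R"
    proof
      fix u assume "u \<in> cball w (R - 1)"
      then show "u \<in> cball 0 R"
        using w norm_triangle_ineq2[of u w] by (simp add: dist_norm norm_minus_commute)
    qed
    have "w \<in> ball 0 R" using w R by simp
    then show "(\<phi> has_field_derivative deriv \<phi> w) (at w within cball 0 1)"
      by (rule has_field_derivative_at_within[OF holomorphic_derivI[OF holomorphic_on_subset[OF hol ball_subset_cball] open_ball]])
    have "cmod ((deriv ^^ 1) \<phi> w) \<le> fact 1 * M / (R - 1) ^ 1"
    proof (rule Cauchy_inequality)
      show "\<phi> holomorphic_on ball w (R - 1)"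
        using holomorphic_on_subset[OF hol] sub ball_subset_cball by blast
      show "continuous_on (cball w (R - 1)) \<phi>"
        using holomorphic_on_imp_continuous_on[OF holomorphic_on_subset[OF hol sub]] .
      show "0 < R - 1" using R by simp
      fix u assume "cmod (w - u) = R - 1"
      then have "u \<in> cball w (R - 1)" by (simp add: dist_norm)
      then have "u \<in> cball 0 R" using sub by blast
      then show "cmod (\<phi> u) \<le> M" unfolding \<phi>_def by (intro M in_B) simp
    qed
    also have "fact 1 * M / (R - 1) ^ 1 = M / (R - 1)" by simp
    also have "\<dots> \<le> M / (R / 2)"
      using R M0 by (intro divide_left_mono mult_pos_pos) auto
    finally show "cmod (deriv \<phi> w) \<le> 2 * M / R" by (simp add: mult.commute)
  qed auto
  moreover have "2 * M / R = 2 * M / (\<rho>' - \<rho>) * norm (y - x)"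
    using v by (simp add: R_def v_def)
  ultimately show ?thesis by (simp add: \<phi>_def v_def)
qed simp

lemma hardy_locally_bounded:
  fixes f :: "complex ^ 'n \<Rightarrow> complex" and L :: real
  assumes f: "f holomorphic_vec_on ball 0 1" and p: "0 < p"
    and L: "hardy_mean p f \<le> ennreal L" "0 \<le> L" and \<rho>: "\<rho> < 1" and z: "norm z \<le> \<rho>"
  shows "cmod (f z) \<le> (3 * real CARD('n) * 4 ^ CARD('n) * L) powr (1 / p) * (1 - \<rho>) powr (- (CARD('n) / p))"
proof -
  have "cmod (f z) \<le> (3 * real CARD('n) * 4 ^ CARD('n) * L) powr (1 / p) * (1 - norm z) powr (- (CARD('n) / p))"
    using z \<rho> by (intro hardy_pointwise_real f p L) auto
  also have "\<dots> \<le> (3 * real CARD('n) * 4 ^ CARD('n) * L) powr (1 / p) * (1 - \<rho>) powr (- (CARD('n) / p))"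
    using z \<rho> p by (intro mult_left_mono powr_mono2') auto
  finally show ?thesis .
qed

text \<open>The pointwise estimate bounds the family on smaller balls and
  \<open>holomorphic_vec_lipschitz\<close> makes it equicontinuous, so Arzela-Ascoli and a diagonal
  sequence apply. Fatou's lemma preserves the bound \<open>L\<close> on the means.\<close>

theorem hardy_montel:
  fixes F :: "nat \<Rightarrow> complex ^ 'n \<Rightarrow> complex" and L :: real
  assumes hv: "\<And>k. F k holomorphic_vec_on ball 0 1" and p: "0 < p"
    and L: "\<And>k. hardy_mean p (F k) \<le> ennreal L" "0 \<le> L"
  obtains s f where "strict_mono (s :: nat \<Rightarrow> nat)" "f holomorphic_vec_on ball 0 1" "hardy_mean p f \<le> ennreal L"
    "\<And>\<rho>. \<rho> < 1 \<Longrightarrow> uniform_limit (cball 0 \<rho>) (\<lambda>k. F (s k)) f sequentially"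
proof -
  define b where "b \<rho> = (3 * real CARD('n) * 4 ^ CARD('n) * L) powr (1 / p) * (1 - \<rho>) powr (- (CARD('n) / p))" for \<rho>
  have bnd: "cmod (F k z) \<le> b \<rho>" if "\<rho> < 1" "norm z \<le> \<rho>" for k z \<rho>
    unfolding b_def by (rule hardy_locally_bounded[OF hv p L that])
  define \<rho> where "\<rho> i = 1 - 1 / (real i + 2)" for i :: nat
  have \<rho>1: "\<rho> i < 1" for i by (simp add: \<rho>_def)
  define P where "P i r \<longleftrightarrow> (\<exists>g. uniform_limit (cball 0 (\<rho> i)) (\<lambda>k. F (r k)) g sequentially)" for i and r :: "nat \<Rightarrow> nat"
  have sub: "\<exists>k :: nat \<Rightarrow> nat. strict_mono k \<and> P i (r \<circ> k)" for i r
  proof -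
    define \<rho>' where "\<rho>' = (1 + \<rho> i) / 2"
    have \<rho>': "\<rho> i < \<rho>'" "\<rho>' < 1" using \<rho>1[of i] by (auto simp: \<rho>'_def)
    define c where "c = 2 * b \<rho>' / (\<rho>' - \<rho> i)"
    have b0: "0 \<le> b \<rho>'" by (simp add: b_def)
    have c0: "0 \<le> c" using b0 \<rho>' by (simp add: c_def)
    show ?thesis
    proof (rule Arzela_Ascoli[of "cball 0 (\<rho> i)" "\<lambda>n. F (r n)" "b (\<rho> i)"])
      show "compact (cball 0 (\<rho> i) :: (complex ^ 'n) set)" by (rule compact_cball)
      show "norm (F (r n) x) \<le> b (\<rho> i)" if "x \<in> cball 0 (\<rho> i)" for n x
        using bnd[OF \<rho>1] that by simp
      show "\<exists>d>0. \<forall>n y. y \<in> cball 0 (\<rho> i) \<and> norm (x - y) < d \<longrightarrow> norm (F (r n) x - F (r n) y) < e"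
        if x: "x \<in> cball 0 (\<rho> i)" and e: "0 < e" for x :: "complex ^ 'n" and e
      proof (intro exI[of _ "min ((\<rho>' - \<rho> i) / 2) (e / (c + 1))"] conjI allI impI)
        show "0 < min ((\<rho>' - \<rho> i) / 2) (e / (c + 1))" using \<rho>' e c0 by simp
        fix n y assume y: "y \<in> cball 0 (\<rho> i) \<and> norm (x - y) < min ((\<rho>' - \<rho> i) / 2) (e / (c + 1))"
        have "cmod (F (r n) y - F (r n) x) \<le> c * norm (y - x)"
          unfolding c_def using x y by (intro holomorphic_vec_lipschitz[OF hv \<rho>' bnd[OF \<rho>'(2)]]) (auto simp: norm_minus_commute)
        also have "\<dots> \<le> c * (e / (c + 1))"
          using y c0 by (intro mult_left_mono) (auto simp: norm_minus_commute)
        also have "\<dots> < e" using c0 e by (simp add: field_simps)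
        finally show "norm (F (r n) x - F (r n) y) < e" by (simp add: norm_minus_commute)
      qed
      fix g and k :: "nat \<Rightarrow> nat"
      assume k: "strict_mono k" and g: "\<And>e. 0 < e \<Longrightarrow> \<exists>N. \<forall>n x. n \<ge> N \<and> x \<in> cball 0 (\<rho> i) \<longrightarrow> norm (F (r (k n)) x - g x) < e"
      have "uniform_limit (cball 0 (\<rho> i)) (\<lambda>n. F ((r \<circ> k) n)) g sequentially"
        unfolding uniform_limit_sequentially_iff
      proof (intro allI impI)
        fix e :: real assume "0 < e"
        then obtain N where "\<forall>n x. n \<ge> N \<and> x \<in> cball 0 (\<rho> i) \<longrightarrow> norm (F (r (k n)) x - g x) < e" using g by blast
        then show "\<exists>N. \<forall>n\<ge>N. \<forall>x\<in>cball 0 (\<rho> i). dist (F ((r \<circ> k) n) x) (g x) < e"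
          by (intro exI[of _ N]) (auto simp: dist_norm simp del: mem_cball mem_cball_0)
      qed
      then show "\<exists>k :: nat \<Rightarrow> nat. strict_mono k \<and> P i (r \<circ> k)" using k unfolding P_def by blast
    qed
  qed
  \<comment> \<open>Uniform convergence depends only on the tail of a subsequence; this is the form
    that the diagonalization lemma expects.\<close>
  have PP: "P i (r \<circ> k2)" if P1: "P i (r \<circ> k1)" and k: "\<And>j. N \<le> j \<Longrightarrow> \<exists>j'. j \<le> j' \<and> k2 j = k1 j'" for i r k1 k2 N
  proof -
    obtain g where g: "uniform_limit (cball 0 (\<rho> i)) (\<lambda>k. F ((r \<circ> k1) k)) g sequentially"
      using P1 by (auto simp: P_def)
    have "uniform_limit (cball 0 (\<rho> i)) (\<lambda>k. F ((r \<circ> k2) k)) g sequentially"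
      unfolding uniform_limit_sequentially_iff
    proof (intro allI impI)
      fix e :: real assume "0 < e"
      then obtain N0 where N0: "\<And>n x. n \<ge> N0 \<Longrightarrow> x \<in> cball 0 (\<rho> i) \<Longrightarrow> dist (F ((r \<circ> k1) n) x) (g x) < e"
        using g unfolding uniform_limit_sequentially_iff by meson
      show "\<exists>N. \<forall>n\<ge>N. \<forall>x\<in>cball 0 (\<rho> i). dist (F ((r \<circ> k2) n) x) (g x) < e"
      proof (intro exI[of _ "max N N0"] allI impI ballI)
        fix n and x :: "complex ^ 'n" assume n: "max N N0 \<le> n" and x: "x \<in> cball 0 (\<rho> i)"
        obtain j' where "n \<le> j'" "k2 n = k1 j'" using k[of n] n by auto
        then show "dist (F ((r \<circ> k2) n) x) (g x) < e" using N0[of j' x] n x by simp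
      qed
    qed
    then show ?thesis by (auto simp: P_def)
  qed
  obtain s where s: "strict_mono (s :: nat \<Rightarrow> nat)" "\<And>i. P i (id \<circ> s)"
  proof (rule subsequence_diagonalization_lemma[of P id])
    show "\<exists>k :: nat \<Rightarrow> nat. strict_mono k \<and> P i (r \<circ> k)" for i r by (rule sub)
    show "P i (r \<circ> k2)" if "P i (r \<circ> k1)" "\<And>j. N \<le> j \<Longrightarrow> \<exists>j'. j \<le> j' \<and> k2 j = k1 j'" for i r k1 k2 N
      using that by (rule PP)
  qed blast
  \<comment> \<open>The pointwise limit provides a single function for all radii; on each ball it
    agrees with the uniform limit found there.\<close>
  define f where "f z = lim (\<lambda>k. F (s k) z)" for z
  have lim_i: "uniform_limit (cball 0 (\<rho> i)) (\<lambda>k. F (s k)) f sequentially" for i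
  proof -
    obtain g where g: "uniform_limit (cball 0 (\<rho> i)) (\<lambda>k. F (s k)) g sequentially"
      using s(2)[of i] by (auto simp: P_def)
    have "f x = g x" if "x \<in> cball 0 (\<rho> i)" for x
      unfolding f_def using tendsto_uniform_limitI[OF g that] by (rule limI)
    then show ?thesis using g by (subst uniform_limit_cong'[where i = g]) auto
  qed
  have lim: "uniform_limit (cball 0 t) (\<lambda>k. F (s k)) f sequentially" if "t < 1" for t
  proof -
    obtain i :: nat where i: "1 / (1 - t) < real i" using reals_Archimedean2 by blast
    then have "1 / (real i + 2) \<le> 1 - t" using that by (simp add: field_simps)
    then have "t \<le> \<rho> i" by (simp add: \<rho>_def)
    then show ?thesis by (intro uniform_limit_on_subset[OF lim_i[of i]]) auto
  qed
  have hvf: "f holomorphic_vec_on ball 0 1"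
  proof (rule holomorphic_vec_uniform_limit[OF open_ball hv])
    fix z :: "complex ^ 'n" assume z: "z \<in> ball 0 1"
    define d where "d = (1 - norm z) / 2"
    have sub: "cball z d \<subseteq> cball 0 ((1 + norm z) / 2)"
    proof
      fix u assume "u \<in> cball z d"
      then show "u \<in> cball 0 ((1 + norm z) / 2)"
        using norm_triangle_ineq2[of u z] by (simp add: d_def dist_norm norm_minus_commute field_simps)
    qed
    have "(1 + norm z) / 2 < 1" using z by simp
    then show "\<exists>d>0. cball z d \<subseteq> ball 0 1 \<and> uniform_limit (cball z d) (\<lambda>k. F (s k)) f sequentially"
      using z sub uniform_limit_on_subset[OF lim sub] by (intro exI[of _ d]) (auto simp: d_def subset_iff)
  qed
  have "hardy_mean p f \<le> ennreal L"
    unfolding hardy_mean_modp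
  proof (rule SUP_least)
    fix r :: real assume r: "r \<in> {0<..<1}"
    note [measurable] = measurable_modp[OF hv] measurable_modp[OF hvf]
    have conv: "(\<lambda>k. modp p (F (s k)) (r *\<^sub>R \<zeta>)) \<longlonglongrightarrow> modp p f (r *\<^sub>R \<zeta>)" if "\<zeta> \<in> sphere 0 1" for \<zeta>
    proof -
      have B: "r *\<^sub>R \<zeta> \<in> ball 0 1" and C: "r *\<^sub>R \<zeta> \<in> cball 0 r" using that r by auto
      have "(\<lambda>k. F (s k) (r *\<^sub>R \<zeta>)) \<longlonglongrightarrow> f (r *\<^sub>R \<zeta>)"
        using lim[of r] r by (intro tendsto_uniform_limitI[OF _ C]) auto
      then have "(\<lambda>k. cmod (F (s k) (r *\<^sub>R \<zeta>)) powr p) \<longlonglongrightarrow> cmod (f (r *\<^sub>R \<zeta>)) powr p"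
        using p by (intro tendsto_powr' tendsto_norm tendsto_const) auto
      then show ?thesis unfolding modp_in_ball[OF B] by (rule tendsto_ennrealI)
    qed
    \<comment> \<open>Fatou's lemma on a fixed sphere of radius \<open>r < 1\<close>, where the
      sequence converges pointwise.\<close>
    have "(\<integral>\<^sup>+\<zeta>. modp p f (r *\<^sub>R \<zeta>) \<partial>sphere_measure) = (\<integral>\<^sup>+\<zeta>. liminf (\<lambda>k. modp p (F (s k)) (r *\<^sub>R \<zeta>)) \<partial>sphere_measure)"
      using conv by (intro nn_integral_cong lim_imp_Liminf[symmetric]) (auto simp: space_sphere_measure)
    also have "\<dots> \<le> liminf (\<lambda>k. \<integral>\<^sup>+\<zeta>. modp p (F (s k)) (r *\<^sub>R \<zeta>) \<partial>sphere_measure)"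
      by (intro nn_integral_liminf measurable_sphere_measureI) measurable
    also have "\<dots> \<le> limsup (\<lambda>k. \<integral>\<^sup>+\<zeta>. modp p (F (s k)) (r *\<^sub>R \<zeta>) \<partial>sphere_measure)"
      by (rule Liminf_le_Limsup) simp
    also have "\<dots> \<le> ennreal L"
      using r by (intro Limsup_bounded always_eventually allI order_trans[OF hardy_mean_upper L(1)]) auto
    finally show "(\<integral>\<^sup>+\<zeta>. modp p f (r *\<^sub>R \<zeta>) \<partial>sphere_measure) \<le> ennreal L" .
  qed
  then show ?thesis using that s(1) hvf lim by blast
qed

section \<open>Compactness from the little-o condition\<close>

lemma J_op_diff:
  assumes f: "f holomorphic_vec_on ball 0 1" and h: "h holomorphic_vec_on ball 0 1"
    and g: "g holomorphic_vec_on ball 0 1" and z: "z \<in> ball 0 1"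
  shows "J_op g (\<lambda>z. f z - h z) z = J_op g f z - J_op g h z"
proof -
  have "(\<lambda>t. e (t *\<^sub>R z) * radial_quot g z t) integrable_on {0..1}" if e: "e holomorphic_vec_on ball 0 1" for e
  proof -
    have "continuous_on {0..1} (\<lambda>t. e (t *\<^sub>R z) * radial_quot g z t)"
            by (rule continuous_on_J_slice[OF e g z])
    then show ?thesis by (intro integrable_continuous_interval) simp
  qed
  then show ?thesis
    unfolding J_op_eq left_diff_distrib using f h by (intro Henstock_Kurzweil_Integration.integral_diff) auto
qed

lemma little_lipschitz_bound:
  fixes g :: "complex ^ 'n \<Rightarrow> complex"
  assumes "g \<in> little_lipschitz \<alpha>" "0 < M"
  obtains \<rho> where "1 / 2 \<le> \<rho>" "\<rho> < 1"
    "\<And>z. \<rho> < norm z \<Longrightarrow> norm z < 1 \<Longrightarrow> (1 - (norm z)\<^sup>2) powr (1 - \<alpha>) * cmod (radial_deriv g z) \<le> M"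
proof -
  have "eventually (\<lambda>z. dist ((1 - (norm z)\<^sup>2) powr (1 - \<alpha>) * cmod (radial_deriv g z)) 0 < M) (filtercomap norm (at_left 1))"
    using assms unfolding little_lipschitz_def by (auto dest: tendstoD)
  then obtain Q where Q: "eventually Q (at_left (1 :: real))"
    "\<And>z. Q (norm z) \<Longrightarrow> dist ((1 - (norm z)\<^sup>2) powr (1 - \<alpha>) * cmod (radial_deriv g z)) 0 < M"
    unfolding eventually_filtercomap by blast
  obtain b where b: "b < 1" "\<And>y. b < y \<Longrightarrow> y < 1 \<Longrightarrow> Q y"
    using Q(1) unfolding eventually_at_left_field by blast
  show ?thesis
  proof (rule that[of "max b (1 / 2)"])
    fix z :: "complex ^ 'n" assume "max b (1 / 2) < norm z" "norm z < 1"
    then have "dist ((1 - (norm z)\<^sup>2) powr (1 - \<alpha>) * cmod (radial_deriv g z)) 0 < M"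
      by (intro Q(2) b(2)) auto
    then show "(1 - (norm z)\<^sup>2) powr (1 - \<alpha>) * cmod (radial_deriv g z) \<le> M"
      by (simp add: dist_real_def)
  qed (use b in auto)
qed

lemma hardy_mean_eq_norm:
  assumes "0 < p" "hardy_mean p f < \<infinity>"
  shows "hardy_mean p f = ennreal (hardy_norm p f powr p)"
  using assms by (simp add: hardy_norm_def powr_powr)

lemma hardy_norm_nonneg: "0 \<le> hardy_norm p f"
  by (simp add: hardy_norm_def)

text \<open>The limit in the target space is \<open>J_op g f\<close> for a Montel limit
  \<open>f\<close>. The estimate is applied to the differences \<open>D k\<close>, whose means stay
  below \<open>L'\<close> while they tend to 0 uniformly on each smaller ball.\<close>

theorem J_op_compact:
  fixes g :: "complex ^ 'n \<Rightarrow> complex" and p q \<alpha> :: real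
  assumes pq: "0 < p" "p < q" and g: "g holomorphic_vec_on ball 0 1"
    and \<alpha>: "\<alpha> = real CARD('n) * (1 / p - 1 / q)" "\<alpha> < 1" and ll: "g \<in> little_lipschitz \<alpha>"
  shows "compact_hardy_operator p q (J_op g)"
proof -
  have q: "0 < q" using pq by simp
  have J_hardy: "J_op g f \<in> hardy q" if f: "f \<in> hardy p" for f
  proof -
    have hv: "f holomorphic_vec_on ball 0 1" and fin: "hardy_mean p f < \<infinity>" using f by (auto simp: hardy_def)
    define L where "L = hardy_norm p f powr p + 1"
    have L: "0 < L" by (simp add: L_def add_nonneg_pos)
    have fL: "hardy_mean p f \<le> ennreal L"
      unfolding hardy_mean_eq_norm[OF pq(1) fin] L_def by (intro ennreal_leI) simp
    obtain X where X: "\<And>(f :: complex ^ 'n \<Rightarrow> complex) g M \<rho> S B.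
      f holomorphic_vec_on ball 0 1 \<Longrightarrow> g holomorphic_vec_on ball 0 1 \<Longrightarrow> hardy_mean p f \<le> ennreal L \<Longrightarrow>
      0 < M \<Longrightarrow> 1 / 2 \<le> \<rho> \<Longrightarrow>
      (\<And>z. \<rho> < norm z \<Longrightarrow> norm z < 1 \<Longrightarrow> (1 - (norm z)\<^sup>2) powr (1 - \<alpha>) * cmod (radial_deriv g z) \<le> M) \<Longrightarrow>
      0 \<le> S \<Longrightarrow> (\<And>z. norm z < 1 \<Longrightarrow> norm z \<le> \<rho> \<Longrightarrow> cmod (f z) \<le> S) \<Longrightarrow>
      0 \<le> B \<Longrightarrow> (\<And>z t. z \<in> ball 0 1 \<Longrightarrow> 0 \<le> t \<Longrightarrow> t * norm z \<le> \<rho> \<Longrightarrow> cmod (radial_quot g z t) \<le> B) \<Longrightarrow>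
      hardy_mean q (J_op g f) \<le> ennreal (2 powr q * (S * B) powr q + M powr q * X)"
      using J_op_hardy_bound[OF pq \<alpha> L] by metis
    obtain \<rho> where \<rho>: "1 / 2 \<le> \<rho>" "\<rho> < 1"
      "\<And>z. \<rho> < norm z \<Longrightarrow> norm z < 1 \<Longrightarrow> (1 - (norm z)\<^sup>2) powr (1 - \<alpha>) * cmod (radial_deriv g z) \<le> 1"
      using little_lipschitz_bound[OF ll zero_less_one] by metis
    obtain B where B: "0 \<le> B" "\<And>z t. z \<in> ball 0 1 \<Longrightarrow> 0 \<le> t \<Longrightarrow> t * norm z \<le> \<rho> \<Longrightarrow> cmod (radial_quot g z t) \<le> B"
      using radial_quot_le[OF g \<rho>(2)] by metis
    have "hardy_mean q (J_op g f) \<le> ennreal (2 powr q *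
        ((3 * real CARD('n) * 4 ^ CARD('n) * L) powr (1 / p) * (1 - \<rho>) powr (- (CARD('n) / p)) * B) powr q + 1 powr q * X)"
      using L by (intro X[OF hv g fL zero_less_one \<rho>(1,3) _ _ B] hardy_locally_bounded[OF hv pq(1) fL _ \<rho>(2)]) auto
    then show ?thesis
      using holomorphic_vec_J_op[OF hv g] by (auto simp: hardy_def intro: le_less_trans)
  qed
  moreover have "\<exists>s h. strict_mono s \<and> h \<in> hardy q \<and> (\<lambda>k. hardy_norm q (\<lambda>z. J_op g (F (s k)) z - h z)) \<longlonglongrightarrow> 0"
    if F: "\<And>k. F k \<in> hardy p" and C: "\<And>k. hardy_norm p (F k) \<le> C" for F :: "nat \<Rightarrow> complex ^ 'n \<Rightarrow> complex" and C
  proof -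
    have hv: "F k holomorphic_vec_on ball 0 1" and fin: "hardy_mean p (F k) < \<infinity>" for k
      using F by (auto simp: hardy_def)
    define L where "L = \<bar>C\<bar> powr p + 1"
    have L: "0 < L" by (simp add: L_def add_nonneg_pos)
    have FL: "hardy_mean p (F k) \<le> ennreal L" for k
    proof -
      have "hardy_norm p (F k) powr p \<le> \<bar>C\<bar> powr p"
        using C[of k] pq hardy_norm_nonneg[of p "F k"] by (intro powr_mono2) auto
      then show ?thesis unfolding hardy_mean_eq_norm[OF pq(1) fin] L_def by (intro ennreal_leI) simp
    qed
    obtain s f where s: "strict_mono (s :: nat \<Rightarrow> nat)" and f: "f holomorphic_vec_on ball 0 1" "hardy_mean p f \<le> ennreal L"
      and lim: "\<And>\<rho>. \<rho> < 1 \<Longrightarrow> uniform_limit (cball 0 \<rho>) (\<lambda>k. F (s k)) f sequentially"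
      using hardy_montel[of F p L, OF hv pq(1) FL] L by (metis less_imp_le)
    have f_hardy: "f \<in> hardy p" using f by (auto simp: hardy_def intro: le_less_trans)
    define D where "D k z = F (s k) z - f z" for k z
    have hvD: "D k holomorphic_vec_on ball 0 1" for k
      unfolding D_def by (intro holomorphic_vec_diff hv f)
    define L' where "L' = 2 powr p * (L + L)"
    have L': "0 < L'" using L by (simp add: L'_def)
    have DL: "hardy_mean p (D k) \<le> ennreal L'" for k
    proof -
      have "hardy_mean p (D k) \<le> ennreal (2 powr p) * (hardy_mean p (F (s k)) + hardy_mean p f)"
        unfolding D_def by (intro hardy_mean_diff_le hv f pq)
      also have "\<dots> \<le> ennreal (2 powr p) * (ennreal L + ennreal L)"
        by (intro mult_left_mono add_mono FL f) auto
      also have "ennreal L + ennreal L = ennreal (L + L)"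
        using L by (intro ennreal_plus[symmetric]) auto
      also have "ennreal (2 powr p) * ennreal (L + L) = ennreal L'"
        unfolding L'_def using L by (intro ennreal_mult[symmetric]) auto
      finally show ?thesis .
    qed
    obtain X where X0: "0 \<le> X" and X: "\<And>(f :: complex ^ 'n \<Rightarrow> complex) g M \<rho> S B.
      f holomorphic_vec_on ball 0 1 \<Longrightarrow> g holomorphic_vec_on ball 0 1 \<Longrightarrow> hardy_mean p f \<le> ennreal L' \<Longrightarrow>
      0 < M \<Longrightarrow> 1 / 2 \<le> \<rho> \<Longrightarrow>
      (\<And>z. \<rho> < norm z \<Longrightarrow> norm z < 1 \<Longrightarrow> (1 - (norm z)\<^sup>2) powr (1 - \<alpha>) * cmod (radial_deriv g z) \<le> M) \<Longrightarrow>
      0 \<le> S \<Longrightarrow> (\<And>z. norm z < 1 \<Longrightarrow> norm z \<le> \<rho> \<Longrightarrow> cmod (f z) \<le> S) \<Longrightarrow>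
      0 \<le> B \<Longrightarrow> (\<And>z t. z \<in> ball 0 1 \<Longrightarrow> 0 \<le> t \<Longrightarrow> t * norm z \<le> \<rho> \<Longrightarrow> cmod (radial_quot g z t) \<le> B) \<Longrightarrow>
      hardy_mean q (J_op g f) \<le> ennreal (2 powr q * (S * B) powr q + M powr q * X)"
      using J_op_hardy_bound[OF pq \<alpha> L'] by metis
    define N where "N k = hardy_norm q (\<lambda>z. J_op g (F (s k)) z - J_op g f z)" for k
    have small: "eventually (\<lambda>k. N k \<le> e) sequentially" if e: "0 < e" for e
    proof -
      \<comment> \<open>Solves \<open>2 * (X + 1) * M powr q = e powr q\<close>; the summand 1
        guards against \<open>X = 0\<close>.\<close>
      define M where "M = e / (2 * (X + 1)) powr (1 / q)"
      have M: "0 < M" using e X0 by (simp add: M_def)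
      have MX: "M powr q * X \<le> e powr q / 2"
      proof -
        have "M powr q = e powr q / ((2 * (X + 1)) powr (1 / q)) powr q"
          unfolding M_def by (rule powr_divide)
        also have "((2 * (X + 1)) powr (1 / q)) powr q = 2 * (X + 1)"
          using q X0 by (simp add: powr_powr)
        finally have "M powr q * X = e powr q / 2 * (X / (X + 1))" by simp
        also have "\<dots> \<le> e powr q / 2 * 1" using X0 by (intro mult_left_mono) auto
        finally show ?thesis by simp
      qed
      obtain \<rho> where \<rho>: "1 / 2 \<le> \<rho>" "\<rho> < 1"
        "\<And>z. \<rho> < norm z \<Longrightarrow> norm z < 1 \<Longrightarrow> (1 - (norm z)\<^sup>2) powr (1 - \<alpha>) * cmod (radial_deriv g z) \<le> M"
        using little_lipschitz_bound[OF ll M] by metis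
      obtain B where B: "0 \<le> B" "\<And>z t. z \<in> ball 0 1 \<Longrightarrow> 0 \<le> t \<Longrightarrow> t * norm z \<le> \<rho> \<Longrightarrow> cmod (radial_quot g z t) \<le> B"
        using radial_quot_le[OF g \<rho>(2)] by metis
      \<comment> \<open>Chosen once \<open>\<rho>\<close> and \<open>B\<close> are known, to bring
        the inner contribution below \<open>e powr q / 4\<close>; \<open>B + 1\<close> guards
        against \<open>B = 0\<close>.\<close>
      define S where "S = e / 4 powr (1 / q) / (B + 1) / 2"
      have S: "0 < S" using e B by (simp add: S_def)
      have SB: "2 powr q * (S * B) powr q \<le> e powr q / 2"
      proof -
        have "2 * (e / c / d / 2 * B) = e / c * (B / d)" for c d :: real by simp
        then have "2 * (S * B) = e / 4 powr (1 / q) * (B / (B + 1))" unfolding S_def .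
        also have "\<dots> \<le> e / 4 powr (1 / q) * 1" using B e by (intro mult_left_mono) auto
        finally have "(2 * (S * B)) powr q \<le> (e / 4 powr (1 / q)) powr q"
          using S B q by (intro powr_mono2) auto
        also have "\<dots> = e powr q / (4 powr (1 / q)) powr q" by (rule powr_divide)
        also have "(4 powr (1 / q)) powr q = (4 :: real)" using q by (simp add: powr_powr)
        finally have "(2 * (S * B)) powr q \<le> e powr q / 4" .
        also have "\<dots> \<le> e powr q / 2" by simp
        finally show ?thesis by (simp only: powr_mult)
      qed
      have "eventually (\<lambda>k. \<forall>z\<in>cball 0 \<rho>. dist (F (s k) z) (f z) < S) sequentially"
        using lim[OF \<rho>(2)] S unfolding uniform_limit_iff by blast
      then show ?thesis
      proof (rule eventually_mono)
        fix k assume k: "\<forall>z\<in>cball 0 \<rho>. dist (F (s k) z) (f z) < S"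
        have "hardy_mean q (J_op g (D k)) \<le> ennreal (2 powr q * (S * B) powr q + M powr q * X)"
        proof (rule X[OF hvD g DL M \<rho>(1,3) _ _ B])
          show "0 \<le> S" using S by simp
          show "cmod (D k z) \<le> S" if "norm z \<le> \<rho>" for z
            using k that by (auto simp: D_def dist_norm less_imp_le)
        qed
        also have "\<dots> \<le> ennreal (e powr q)" using SB MX by (intro ennreal_leI) simp
        finally have "hardy_mean q (\<lambda>z. J_op g (F (s k)) z - J_op g f z) \<le> ennreal (e powr q)"
          using hardy_mean_cong[of "J_op g (D k)" "\<lambda>z. J_op g (F (s k)) z - J_op g f z" q]
            J_op_diff[OF hv f(1) g] by (simp add: D_def[abs_def])
        then have "enn2real (hardy_mean q (\<lambda>z. J_op g (F (s k)) z - J_op g f z)) \<le> e powr q"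
          by (rule enn2real_leI[rotated]) simp
        then have "N k \<le> (e powr q) powr (1 / q)"
          unfolding N_def hardy_norm_def using q by (intro powr_mono2) auto
        then show "N k \<le> e" using q e by (simp add: powr_powr)
      qed
    qed
    have "N \<longlonglongrightarrow> 0"
    proof (rule tendstoI)
      fix e :: real assume "0 < e"
      then have "eventually (\<lambda>k. N k \<le> e / 2) sequentially" by (intro small) simp
      then show "eventually (\<lambda>k. dist (N k) 0 < e) sequentially"
        using \<open>0 < e\<close> by (auto elim!: eventually_mono simp: N_def abs_of_nonneg[OF hardy_norm_nonneg])
    qed
    then show ?thesis
      using s J_hardy[OF f_hardy] unfolding N_def by (intro exI[of _ s] exI[of _ "J_op g f"]) auto
  qed
  ultimately show ?thesis unfolding compact_hardy_operator_def by blast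
qed

subsection \<open>Necessity\<close>

lemma hardy_pointwise_norm:
  fixes f :: "complex ^ 'n \<Rightarrow> complex"
  assumes f: "f \<in> hardy p" and p: "0 < p" and z: "z \<in> ball 0 1"
  shows "cmod (f z) \<le> (3 * real CARD('n) * 4 ^ CARD('n)) powr (1 / p) * hardy_norm p f * (1 - norm z) powr (- (CARD('n) / p))"
proof -
  have hv: "f holomorphic_vec_on ball 0 1" and fin: "hardy_mean p f < \<infinity>" using f by (auto simp: hardy_def)
  have "cmod (f z) \<le> (3 * real CARD('n) * 4 ^ CARD('n) * hardy_norm p f powr p) powr (1 / p) * (1 - norm z) powr (- (CARD('n) / p))"
    using hardy_mean_eq_norm[OF p fin] by (intro hardy_pointwise_real hv p z) auto
  also have "(3 * real CARD('n) * 4 ^ CARD('n) * hardy_norm p f powr p) powr (1 / p) =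
      (3 * real CARD('n) * 4 ^ CARD('n)) powr (1 / p) * (hardy_norm p f powr p) powr (1 / p)"
    by (rule powr_mult)
  also have "(hardy_norm p f powr p) powr (1 / p) = hardy_norm p f"
    using p hardy_norm_nonneg[of p f] by (simp add: powr_powr)
  finally show ?thesis .
qed

lemma hardy_diff:
  assumes "f \<in> hardy p" "g \<in> hardy p" "0 < p"
  shows "(\<lambda>z. f z - g z) \<in> hardy p"
proof -
  have "hardy_mean p (\<lambda>z. f z - g z) \<le> ennreal (2 powr p) * (hardy_mean p f + hardy_mean p g)"
    using assms by (intro hardy_mean_diff_le) (auto simp: hardy_def)
  also have "\<dots> < \<infinity>"
    using assms by (auto simp: hardy_def ennreal_mult_less_top)
  finally show ?thesis using assms by (auto simp: hardy_def intro: holomorphic_vec_diff)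
qed

text \<open>Cauchy's estimate at \<open>w = 1\<close> for the slice
  \<open>w \<mapsto> f (w *s a)\<close>, on the disc of radius \<open>s = (1 - norm a) / 2\<close>;
  there \<open>norm (w *s a) \<le> norm a + s\<close>.\<close>

lemma radial_deriv_cauchy:
  fixes f :: "complex ^ 'n \<Rightarrow> complex"
  assumes f: "f holomorphic_vec_on ball 0 1" and a: "a \<in> ball 0 1"
    and B: "\<And>z. norm z \<le> (1 + norm a) / 2 \<Longrightarrow> cmod (f z) \<le> B"
  shows "cmod (radial_deriv f a) \<le> 2 / (1 - norm a) * B"
proof -
  define s where "s = (1 - norm a) / 2"
  have s: "0 < s" using a by (simp add: s_def)
  have in_B: "norm (w *s a) \<le> (1 + norm a) / 2" if "w \<in> cball 1 s" for w :: complex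
  proof -
    have "cmod w \<le> 1 + s" using that norm_triangle_ineq2[of w 1] by (simp add: dist_norm norm_minus_commute)
    then have "cmod w * norm a \<le> (1 + s) * norm a" by (rule mult_right_mono) simp
    also have "\<dots> \<le> norm a + s * 1"
      using s a mult_left_mono[of "norm a" 1 s] by (simp add: distrib_right)
    finally show ?thesis by (simp add: s_def field_simps)
  qed
  have hol: "(\<lambda>w. f (0 + w *s a)) holomorphic_on cball 1 s"
  proof (rule holomorphic_vec_line_holomorphic[OF f open_ball])
    fix w :: complex assume "w \<in> cball 1 s"
    then show "0 + w *s a \<in> ball 0 1" using in_B[of w] a by simp
  qed
  then have hol: "(\<lambda>w. f (w *s a)) holomorphic_on cball 1 s" by simp
  have "cmod ((deriv ^^ 1) (\<lambda>w. f (w *s a)) 1) \<le> fact 1 * B / s ^ 1"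
  proof (rule Cauchy_inequality)
    show "(\<lambda>w. f (w *s a)) holomorphic_on ball 1 s"
      by (rule holomorphic_on_subset[OF hol ball_subset_cball])
    show "continuous_on (cball 1 s) (\<lambda>w. f (w *s a))"
      by (rule holomorphic_on_imp_continuous_on[OF hol])
    show "cmod (f (w *s a)) \<le> B" if "cmod (1 - w) = s" for w
      using that by (intro B in_B) (simp add: dist_norm)
  qed fact
  moreover have "deriv (\<lambda>w. f (w *s a)) 1 = radial_deriv f a"
    by (rule DERIV_imp_deriv[OF radial_deriv_slice[OF f open_ball a]])
  ultimately show ?thesis by (simp add: s_def mult.commute)
qed

text \<open>An integer power \<open>N\<close> of the kernel needs no branch of a complex power. The
  factor in front normalizes: with \<open>e = N - n / p\<close> the Hardy means stay bounded as
  \<open>a\<close> approaches the sphere.\<close>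

definition hardy_test :: "nat \<Rightarrow> real \<Rightarrow> complex ^ 'n \<Rightarrow> complex ^ 'n \<Rightarrow> complex" where
  "hardy_test N e a z = of_real ((1 - (norm a)\<^sup>2) powr e) / (1 - cinner z a) ^ N"

lemma cinner_ball:
  assumes "z \<in> ball 0 1" "a \<in> ball 0 1"
  shows "1 - norm z \<le> cmod (1 - cinner z a)" "1 - cinner z a \<noteq> 0"
proof -
  have "cmod (cinner z a) \<le> norm z * norm a" by (rule cmod_cinner_le)
  also have "\<dots> \<le> norm z * 1" using assms by (intro mult_left_mono) auto
  finally show 1: "1 - norm z \<le> cmod (1 - cinner z a)"
    using norm_triangle_ineq2[of 1 "cinner z a"] by simp
  have "0 < 1 - norm z" using assms by simp
  with 1 show "1 - cinner z a \<noteq> 0" by force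
qed

lemma holomorphic_vec_hardy_test:
  assumes a: "a \<in> ball 0 1"
  shows "hardy_test N e a holomorphic_vec_on ball 0 1"
proof -
  have h: "(\<lambda>z. 1 - cinner z a) holomorphic_vec_on ball 0 1"
    unfolding cinner_def by (intro holomorphic_vec_diff holomorphic_vec_const holomorphic_vec_sum holomorphic_vec_mult holomorphic_vec_component)
  have "(\<lambda>w. of_real ((1 - (norm a)\<^sup>2) powr e) / w ^ N) holomorphic_on (- {0})"
    by (intro holomorphic_intros) auto
  moreover have "(\<lambda>z. 1 - cinner z a) ` ball 0 1 \<subseteq> - {0}"
    by (rule image_subsetI) (simp only: Compl_iff singleton_iff cinner_ball(2)[OF _ a] not_False_eq_True)
  ultimately have "(\<lambda>z. of_real ((1 - (norm a)\<^sup>2) powr e) / (1 - cinner z a) ^ N) holomorphic_vec_on ball 0 1"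
    using holomorphic_vec_compose_holomorphic[OF h _ open_Compl[OF closed_singleton]] by fast
  then show ?thesis by (simp only: hardy_test_def[abs_def])
qed

text \<open>The kernel integral with exponent \<open>N * p\<close> gives
  \<open>1 - r * norm a\<close> to the power \<open>n - N * p\<close>, and the normalizing factor
  compensates because \<open>1 - (norm a)\<^sup>2 \<le> 2 * (1 - norm a) \<le> 2 * (1 - r * norm
  a)\<close>.\<close>

lemma hardy_test_bounded:
  fixes p :: real
  assumes p: "0 < p" and N: "real CARD('n) < real N * p"
  obtains C where "0 < C" "\<And>a :: complex ^ 'n. a \<in> ball 0 1 \<Longrightarrow>
    hardy_mean p (hardy_test N (real N - CARD('n) / p) a) \<le> ennreal C"
proof -
  let ?n = "real CARD('n)" let ?M = "real N * p"
  obtain C where C: "0 < C" "\<And>b :: complex ^ 'n. b \<in> ball 0 1 \<Longrightarrow>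
    (\<integral>\<^sup>+\<zeta>. ennreal (cmod (1 - cinner \<zeta> b) powr (- ?M)) \<partial>sphere_measure) \<le> ennreal (C * (1 - norm b) powr (?n - ?M))"
    using szego_kernel_integral[OF N] by metis
  show ?thesis
  proof (rule that[of "C * 2 powr (?M - ?n)"])
    show "0 < C * 2 powr (?M - ?n)" using C by simp
    fix a :: "complex ^ 'n" assume a: "a \<in> ball 0 1"
    define A where "A = 1 - (norm a)\<^sup>2"
    have na: "0 \<le> norm a" "norm a < 1" using a by auto
    have A: "0 < A" "A \<le> 2 * (1 - norm a)"
    proof -
      show "0 < A" using na by (simp add: A_def power_less_one_iff)
      have "A = (1 - norm a) * (1 + norm a)" by (simp add: A_def power2_eq_square algebra_simps)
      also have "\<dots> \<le> (1 - norm a) * 2" using na by (intro mult_left_mono) auto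
      finally show "A \<le> 2 * (1 - norm a)" by simp
    qed
    show "hardy_mean p (hardy_test N (real N - ?n / p) a) \<le> ennreal (C * 2 powr (?M - ?n))"
      unfolding hardy_mean_def
    proof (rule SUP_least)
      fix r :: real assume r: "r \<in> {0<..<1}"
      have rb: "r *\<^sub>R a \<in> ball 0 1" using r a scaleR_in_ball[of a 1 r] by simp
      have pw: "ennreal (cmod (hardy_test N (real N - ?n / p) a (r *\<^sub>R \<zeta>)) powr p) =
          ennreal (A powr (?M - ?n)) * ennreal (cmod (1 - cinner \<zeta> (r *\<^sub>R a)) powr (- ?M))"
        if \<zeta>: "\<zeta> \<in> sphere 0 1" for \<zeta>
      proof -
        \<comment> \<open>The dilation is moved from the variable to the pole, so that the integral
          over the unit sphere applies with pole \<open>r *\<^sub>R a\<close>.\<close>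
        have eq: "cinner (r *\<^sub>R \<zeta>) a = cinner \<zeta> (r *\<^sub>R a)"
          by (simp add: scaleR_eq_smult cinner_smult_left cinner_smult_right)
        have "r *\<^sub>R \<zeta> \<in> ball 0 1" using \<zeta> r by simp
        then have nz: "1 - cinner (r *\<^sub>R \<zeta>) a \<noteq> 0" using cinner_ball(2) a by blast
        define x where "x = cmod (1 - cinner (r *\<^sub>R \<zeta>) a)"
        have x: "0 < x" using nz by (simp add: x_def)
        have "cmod (hardy_test N (real N - ?n / p) a (r *\<^sub>R \<zeta>)) = A powr (real N - ?n / p) / x ^ N"
          by (simp add: hardy_test_def norm_divide norm_power x_def A_def)
        also have "\<dots> powr p = (A powr (real N - ?n / p)) powr p / (x ^ N) powr p"
          by (rule powr_divide)
        also have "(A powr (real N - ?n / p)) powr p = A powr (?M - ?n)"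
          using p by (simp add: powr_powr left_diff_distrib)
        also have "(x ^ N) powr p = x powr ?M"
          using x by (simp add: powr_realpow[symmetric] powr_powr)
        also have "A powr (?M - ?n) / x powr ?M = A powr (?M - ?n) * x powr (- ?M)"
          by (simp add: powr_minus divide_inverse)
        finally show ?thesis unfolding x_def eq by (simp add: ennreal_mult)
      qed
      have "(\<integral>\<^sup>+\<zeta>. ennreal (cmod (hardy_test N (real N - ?n / p) a (r *\<^sub>R \<zeta>)) powr p) \<partial>sphere_measure) =
        (\<integral>\<^sup>+\<zeta>. ennreal (A powr (?M - ?n)) * ennreal (cmod (1 - cinner \<zeta> (r *\<^sub>R a)) powr (- ?M)) \<partial>sphere_measure)"
        by (intro nn_integral_cong pw) (simp add: space_sphere_measure)
      also have "\<dots> = ennreal (A powr (?M - ?n)) * (\<integral>\<^sup>+\<zeta>. ennreal (cmod (1 - cinner \<zeta> (r *\<^sub>R a)) powr (- ?M)) \<partial>sphere_measure)"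
        unfolding cinner_def by (intro nn_integral_cmult measurable_sphere_measureI) measurable
      also have "\<dots> \<le> ennreal (A powr (?M - ?n)) * ennreal (C * (1 - norm (r *\<^sub>R a)) powr (?n - ?M))"
        by (intro mult_left_mono C(2) rb) simp
      also have "\<dots> = ennreal (A powr (?M - ?n) * (C * (1 - norm (r *\<^sub>R a)) powr (?n - ?M)))"
        using C by (intro ennreal_mult[symmetric]) auto
      also have "\<dots> \<le> ennreal (C * 2 powr (?M - ?n))"
      proof (rule ennreal_leI)
        define d where "d = 1 - norm (r *\<^sub>R a)"
        have d: "0 < d" "1 - norm a \<le> d" using rb r na by (auto simp: d_def mult_left_le_one_le)
        have "A powr (?M - ?n) \<le> (2 * d) powr (?M - ?n)"
          using A d N by (intro powr_mono2) auto
        then have "A powr (?M - ?n) * (C * d powr (?n - ?M)) \<le> (2 * d) powr (?M - ?n) * (C * d powr (?n - ?M))"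
          using C by (intro mult_right_mono) auto
        also have "\<dots> = C * 2 powr (?M - ?n) * (d powr (?M - ?n) * d powr (?n - ?M))"
          unfolding powr_mult by (simp only: mult_ac)
        also have "d powr (?M - ?n) * d powr (?n - ?M) = 1" using d by (simp add: powr_add[symmetric])
        finally show "A powr (?M - ?n) * (C * (1 - norm (r *\<^sub>R a)) powr (?n - ?M)) \<le> C * 2 powr (?M - ?n)"
          by (simp add: d_def)
      qed
      finally show "(\<integral>\<^sup>+\<zeta>. ennreal (cmod (hardy_test N (real N - ?n / p) a (r *\<^sub>R \<zeta>)) powr p) \<partial>sphere_measure) \<le> \<dots>" .
    qed
  qed
qed

text \<open>Stated for all \<alpha>, so that it serves both cases. If the weighted radial derivative
  stays above \<open>\<epsilon>\<close> at points \<open>a k\<close> tending to the sphere, test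
  functions with these poles form a bounded sequence whose images tend to 0 along a subsequence, and
  evaluation at the poles contradicts this.\<close>

theorem compact_J_op_imp_small:
  fixes g :: "complex ^ 'n \<Rightarrow> complex" and p q \<alpha> :: real
  assumes pq: "0 < p" "p < q" and g: "g holomorphic_vec_on ball 0 1"
    and \<alpha>: "\<alpha> = real CARD('n) * (1 / p - 1 / q)"
    and compact: "compact_hardy_operator p q (J_op g)" and \<epsilon>: "0 < \<epsilon>"
  obtains \<rho> where "\<rho> < 1"
    "\<And>z. \<rho> < norm z \<Longrightarrow> norm z < 1 \<Longrightarrow> (1 - (norm z)\<^sup>2) powr (1 - \<alpha>) * cmod (radial_deriv g z) < \<epsilon>"
proof (rule ccontr)
  note result = that
  assume no: "\<not> thesis"
  have neg: "\<exists>z. \<rho> < norm z \<and> norm z < 1 \<and> \<epsilon> \<le> (1 - (norm z)\<^sup>2) powr (1 - \<alpha>) * cmod (radial_deriv g z)"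
    if \<rho>: "\<rho> < 1" for \<rho>
  proof (rule ccontr)
    assume none: "\<not> (\<exists>z. \<rho> < norm z \<and> norm z < 1 \<and> \<epsilon> \<le> (1 - (norm z)\<^sup>2) powr (1 - \<alpha>) * cmod (radial_deriv g z))"
    have thesis by (rule result[OF \<rho>]) (use none in \<open>auto simp: not_le\<close>)
    with no show False ..
  qed
  have q: "0 < q" using pq by simp
  let ?n = "real CARD('n)"
  have "\<exists>z. 1 - 1 / (real k + 2) < norm z \<and> norm z < 1 \<and> \<epsilon> \<le> (1 - (norm z)\<^sup>2) powr (1 - \<alpha>) * cmod (radial_deriv g z)" for k
    by (rule neg) simp
  then obtain a where a: "\<And>k. 1 - 1 / (real k + 2) < norm (a k)" "\<And>k. norm (a k) < 1"
    "\<And>k. \<epsilon> \<le> (1 - (norm (a k))\<^sup>2) powr (1 - \<alpha>) * cmod (radial_deriv g (a k))"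
    by metis
  have aB: "a k \<in> ball 0 1" for k using a(2)[of k] by simp
  \<comment> \<open>\<open>N\<close> above \<open>n / p\<close> makes the kernel integral estimate
    applicable and the exponent \<open>e\<close> positive, so the test functions tend to 0 at
    interior points.\<close>
  obtain N :: nat where "?n / p < real N" using reals_Archimedean2 by blast
  then have N: "?n < real N * p" "?n / p < real N" using pq by (auto simp: field_simps)
  define e where "e = real N - ?n / p"
  have e: "0 < e" using N by (simp add: e_def)
  define F where "F k = hardy_test N e (a k)" for k
  obtain C where C: "0 < C" "\<And>k. hardy_mean p (F k) \<le> ennreal C"
    using hardy_test_bounded[OF pq(1) N(1)] aB unfolding F_def e_def by metis
  have hvF: "F k holomorphic_vec_on ball 0 1" for k unfolding F_def by (rule holomorphic_vec_hardy_test[OF aB])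
  have F_hardy: "F k \<in> hardy p" for k
    using hvF C(2)[of k] by (auto simp: hardy_def intro: le_less_trans)
  have "hardy_norm p (F k) \<le> C powr (1 / p)" for k
    unfolding hardy_norm_def using C pq by (intro powr_mono2 enn2real_leI) auto
  then obtain s h where s: "strict_mono (s :: nat \<Rightarrow> nat)" and h: "h \<in> hardy q"
    and conv: "(\<lambda>k. hardy_norm q (\<lambda>z. J_op g (F (s k)) z - h z)) \<longlonglongrightarrow> 0"
    using compact F_hardy unfolding compact_hardy_operator_def by blast
  have J_hardy: "J_op g (F k) \<in> hardy q" for k
    using compact F_hardy unfolding compact_hardy_operator_def by blast
  define A where "A k = 1 - (norm (a k))\<^sup>2" for k
  have A: "0 < A k" "A k \<le> 2 * (1 - norm (a k))" "A k \<le> 2 / (real k + 2)" for k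
  proof -
    show "0 < A k" using a(2)[of k] by (simp add: A_def power_less_one_iff)
    have "A k = (1 - norm (a k)) * (1 + norm (a k))" by (simp add: A_def power2_eq_square algebra_simps)
    also have "\<dots> \<le> (1 - norm (a k)) * 2" using a(2)[of k] by (intro mult_left_mono) auto
    finally show "A k \<le> 2 * (1 - norm (a k))" by simp
    then show "A k \<le> 2 / (real k + 2)" using a(1)[of k] by simp
  qed
  have "A \<longlonglongrightarrow> 0"
  proof (rule tendsto_sandwich[of "\<lambda>_. 0" _ _ "\<lambda>k. 2 / (real k + 2)"])
    show "(\<lambda>k. 2 / (real k + 2)) \<longlonglongrightarrow> 0"
      using LIMSEQ_ignore_initial_segment[OF lim_const_over_n[of "2 :: real"], of 2] by (simp add: add.commute)
  qed (auto intro!: always_eventually simp: less_imp_le[OF A(1)] A(3))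
  then have A_e: "(\<lambda>k. A k powr e) \<longlonglongrightarrow> 0"
    using tendsto_powr'[of A 0 sequentially "\<lambda>_. e" e] e A(1) by (auto intro: always_eventually less_imp_le)
  \<comment> \<open>Compactness only provides some limit \<open>h\<close>. Convergence in the target
    norm forces pointwise convergence in the ball, where the images tend to 0 because
    \<open>A k powr e\<close> does; so \<open>h\<close> vanishes there.\<close>
  have h0: "h z = 0" if z: "z \<in> ball 0 1" for z
  proof -
    obtain B where B: "0 \<le> B" "\<And>w t. w \<in> ball 0 1 \<Longrightarrow> 0 \<le> t \<Longrightarrow> t * norm w \<le> norm z \<Longrightarrow> cmod (radial_quot g w t) \<le> B"
      using radial_quot_le[OF g, of "norm z"] z by auto
    have J_le: "cmod (J_op g (F k) z) \<le> A k powr e / (1 - norm z) ^ N * B" for k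
    proof -
      have "cmod (integral {0..1} (\<lambda>t. F k (t *\<^sub>R z) * radial_quot g z t)) \<le>
        integral {0..1} (\<lambda>t :: real. A k powr e / (1 - norm z) ^ N * B)"
      proof (rule integral_norm_bound_integral)
        have "continuous_on {0..1} (\<lambda>t. F k (t *\<^sub>R z) * radial_quot g z t)"
            by (rule continuous_on_J_slice[OF hvF g z])
        then show "(\<lambda>t. F k (t *\<^sub>R z) * radial_quot g z t) integrable_on {0..1}"
          by (intro integrable_continuous_interval) simp
        fix t :: real assume t: "t \<in> {0..1}"
        have tz: "t * norm z \<le> norm z" using t by (simp add: mult_left_le_one_le)
        have "1 - norm z \<le> cmod (1 - cinner (t *\<^sub>R z) (a k))"
          using cinner_ball(1)[OF scaleR_in_ball[OF z] aB, of t k] t tz by simp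
        then have "(1 - norm z) ^ N \<le> cmod (1 - cinner (t *\<^sub>R z) (a k)) ^ N"
          using z by (intro power_mono) auto
        then have "cmod (F k (t *\<^sub>R z)) \<le> A k powr e / (1 - norm z) ^ N"
          using z unfolding F_def hardy_test_def A_def norm_divide norm_power
          by (intro frac_le) auto
        then show "cmod (F k (t *\<^sub>R z) * radial_quot g z t) \<le> A k powr e / (1 - norm z) ^ N * B"
          unfolding norm_mult using B(2)[OF z _ tz] t z by (intro mult_mono) auto
      qed auto
      then show ?thesis by (simp add: J_op_eq)
    qed
    have "(\<lambda>k. A k powr e / (1 - norm z) ^ N * B) \<longlonglongrightarrow> 0 / (1 - norm z) ^ N * B"
      using A_e z by (intro tendsto_intros) auto
    then have "(\<lambda>k. A k powr e / (1 - norm z) ^ N * B) \<longlonglongrightarrow> 0" by simp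
    then have "(\<lambda>k. J_op g (F k) z) \<longlonglongrightarrow> 0"
      by (rule Lim_null_comparison[OF always_eventually[OF allI[OF J_le]]])
    then have lim1: "(\<lambda>k. J_op g (F (s k)) z) \<longlonglongrightarrow> 0"
      using LIMSEQ_subseq_LIMSEQ[OF _ s] by (auto simp: o_def)
    define c where "c = (3 * ?n * 4 ^ CARD('n)) powr (1 / q)"
    have le: "cmod (J_op g (F (s k)) z - h z) \<le> c * hardy_norm q (\<lambda>z. J_op g (F (s k)) z - h z) * (1 - norm z) powr (- (?n / q))" for k
      unfolding c_def by (rule hardy_pointwise_norm[OF hardy_diff[OF J_hardy h q] q z])
    have "(\<lambda>k. c * hardy_norm q (\<lambda>z. J_op g (F (s k)) z - h z) * (1 - norm z) powr (- (?n / q))) \<longlonglongrightarrow> c * 0 * (1 - norm z) powr (- (?n / q))"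
      by (intro tendsto_mult conv tendsto_const)
    then have "(\<lambda>k. c * hardy_norm q (\<lambda>z. J_op g (F (s k)) z - h z) * (1 - norm z) powr (- (?n / q))) \<longlonglongrightarrow> 0"
      by simp
    then have "(\<lambda>k. J_op g (F (s k)) z - h z) \<longlonglongrightarrow> 0"
      by (rule Lim_null_comparison[OF always_eventually[OF allI[OF le]]])
    from tendsto_diff[OF lim1 this] have "(\<lambda>k. h z) \<longlonglongrightarrow> 0" by simp
    then show ?thesis by (simp add: LIMSEQ_const_iff)
  qed
  define \<nu> where "\<nu> k = hardy_norm q (J_op g (F (s k)))" for k
  have "hardy_norm q (\<lambda>z. J_op g (F (s k)) z - h z) = \<nu> k" for k
    unfolding hardy_norm_def \<nu>_def by (subst hardy_mean_cong[where g = "J_op g (F (s k))"]) (auto simp: h0)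
  then have \<nu>: "\<nu> \<longlonglongrightarrow> 0" using conv by simp
  define c where "c = (3 * ?n * 4 ^ CARD('n)) powr (1 / q)"
  define c' where "c' = 2 * c * 2 powr (?n / q) * 2 powr (1 + ?n / q)"
  \<comment> \<open>At its pole the test function has modulus \<open>A powr (- (?n / p))\<close>,
    while Cauchy's estimate and pointwise growth bound the radial derivative of its image by a
    multiple of \<open>\<nu> k * d powr (- (1 + ?n / q))\<close>. Since
    \<open>1 - \<alpha> = (1 + ?n / q) - ?n / p\<close> and \<open>A \<le> 2 * d\<close>, all powers
    of the distance cancel.\<close>
  have main: "\<epsilon> \<le> c' * \<nu> k" for k
  proof -
    define b where "b = a (s k)"
    define d where "d = 1 - norm b"
    have d: "0 < d" using a(2) by (simp add: d_def b_def)
    have bB: "b \<in> ball 0 1" unfolding b_def by (rule aB)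
    have \<nu>0: "0 \<le> \<nu> k" by (simp add: \<nu>_def hardy_norm_nonneg)
    have Ad: "0 < A (s k)" "A (s k) \<le> 2 * d" using A[of "s k"] by (auto simp: d_def b_def)
    have "cmod (radial_deriv (J_op g (F (s k))) b) \<le> 2 / d * (c * \<nu> k * (d / 2) powr (- (?n / q)))"
      unfolding d_def
    proof (rule radial_deriv_cauchy[OF holomorphic_vec_J_op[OF hvF g] bB])
      fix z :: "complex ^ 'n" assume z: "norm z \<le> (1 + norm b) / 2"
      have dz: "d / 2 \<le> 1 - norm z" using z by (simp add: d_def field_simps)
      then have "z \<in> ball 0 1" using d by simp
      then have "cmod (J_op g (F (s k)) z) \<le> c * \<nu> k * (1 - norm z) powr (- (?n / q))"
        unfolding c_def \<nu>_def by (intro hardy_pointwise_norm J_hardy q)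
      also have "\<dots> \<le> c * \<nu> k * (d / 2) powr (- (?n / q))"
        using dz d q \<nu>0 by (intro mult_left_mono powr_mono2') (auto simp: c_def)
      finally show "cmod (J_op g (F (s k)) z) \<le> c * \<nu> k * ((1 - norm b) / 2) powr (- (?n / q))" by (simp add: d_def)
    qed
    also have "(d / 2) powr (- (?n / q)) = d powr (- (?n / q)) * 2 powr (?n / q)"
      unfolding powr_divide by (simp add: powr_minus divide_inverse)
    also have "2 / d = 2 * d powr (- 1)" using d by (simp add: powr_minus divide_inverse)
    also have "2 * d powr (- 1) * (c * \<nu> k * (d powr (- (?n / q)) * 2 powr (?n / q))) =
        2 * c * 2 powr (?n / q) * \<nu> k * (d powr (- 1) * d powr (- (?n / q)))" by simp
    also have "d powr (- 1) * d powr (- (?n / q)) = d powr (- (1 + ?n / q))"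
      unfolding powr_add[symmetric] by simp
    finally have 1: "cmod (radial_deriv (J_op g (F (s k))) b) \<le> 2 * c * 2 powr (?n / q) * \<nu> k * d powr (- (1 + ?n / q))" .
    have "cmod (F (s k) b) = A (s k) powr (- (?n / p))"
    proof -
      have "1 - cinner b b = of_real (A (s k))"
        by (simp add: cinner_self A_def b_def)
      then have cm: "cmod (1 - cinner b b) = A (s k)"
        using Ad(1) by (simp only: norm_of_real abs_of_pos)
      have "cmod (F (s k) b) = A (s k) powr e / cmod (1 - cinner b b) ^ N"
        unfolding F_def hardy_test_def norm_divide norm_power by (simp add: A_def b_def)
      also have "\<dots> = A (s k) powr e / A (s k) ^ N" unfolding cm ..
      also have "\<dots> = A (s k) powr (- (?n / p))"
        using Ad(1) by (simp add: e_def powr_diff powr_realpow powr_minus field_simps)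
      finally show ?thesis .
    qed
    then have "A (s k) powr (- (?n / p)) * cmod (radial_deriv g b) = cmod (radial_deriv (J_op g (F (s k))) b)"
      unfolding radial_deriv_J_op[OF hvF g bB] norm_mult by simp
    also note 1
    finally have 2: "A (s k) powr (1 + ?n / q) * (A (s k) powr (- (?n / p)) * cmod (radial_deriv g b)) \<le>
        A (s k) powr (1 + ?n / q) * (2 * c * 2 powr (?n / q) * \<nu> k * d powr (- (1 + ?n / q)))"
      by (rule mult_left_mono) simp
    have "\<epsilon> \<le> A (s k) powr (1 - \<alpha>) * cmod (radial_deriv g b)"
      using a(3)[of "s k"] by (simp add: A_def b_def)
    also have "1 - \<alpha> = (1 + ?n / q) + - (?n / p)" unfolding \<alpha> by (simp add: algebra_simps)
    also have "A (s k) powr ((1 + ?n / q) + - (?n / p)) * cmod (radial_deriv g b) =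
        A (s k) powr (1 + ?n / q) * (A (s k) powr (- (?n / p)) * cmod (radial_deriv g b))"
      by (simp only: powr_add mult.assoc)
    also note 2
    also have "A (s k) powr (1 + ?n / q) * (2 * c * 2 powr (?n / q) * \<nu> k * d powr (- (1 + ?n / q))) \<le>
        (2 * d) powr (1 + ?n / q) * (2 * c * 2 powr (?n / q) * \<nu> k * d powr (- (1 + ?n / q)))"
      using Ad q \<nu>0 by (intro mult_right_mono powr_mono2) (auto simp: c_def)
    also have "\<dots> = c' * \<nu> k * (d powr (1 + ?n / q) * d powr (- (1 + ?n / q)))"
      unfolding powr_mult c'_def by (simp only: mult_ac)
    also have "d powr (1 + ?n / q) * d powr (- (1 + ?n / q)) = 1"
      using d by (simp add: powr_add[symmetric])
    finally show ?thesis by simp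
  qed
  have "(\<lambda>k. c' * \<nu> k) \<longlonglongrightarrow> c' * 0" by (intro tendsto_mult tendsto_const \<nu>)
  then have "\<epsilon> \<le> c' * 0" by (rule LIMSEQ_le_const) (use main in blast)
  then show False using \<epsilon> by simp
qed

lemma zero_on_ball_in_hardy:
  fixes f :: "complex ^ 'n \<Rightarrow> complex"
  assumes "\<And>z. z \<in> ball 0 1 \<Longrightarrow> f z = 0"
  shows "f \<in> hardy q" "hardy_mean q f = 0"
proof -
  have "hardy_mean q f = hardy_mean q (\<lambda>z :: complex ^ 'n. 0)" using assms by (rule hardy_mean_cong)
  also have "\<dots> = 0" by (simp add: hardy_mean_def)
  finally show "hardy_mean q f = 0" .
  moreover have "f holomorphic_vec_on ball 0 1"
    using holomorphic_vec_const[of 0] by (subst holomorphic_vec_cong[where g = "\<lambda>_. 0"]) (auto simp: assms)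
  ultimately show "f \<in> hardy q" by (simp add: hardy_def)
qed

theorem theorem6p3:
  fixes g :: "complex ^ 'n \<Rightarrow> complex" and p q \<alpha> :: real
  assumes "0 < p" and "p < q"
    and "g holomorphic_vec_on ball 0 1"
    and "\<alpha> = real CARD('n) * (1 / p - 1 / q)"
  shows "(\<alpha> < 1 \<longrightarrow> (compact_hardy_operator p q (J_op g) \<longleftrightarrow> g \<in> little_lipschitz \<alpha>)) \<and>
    (\<alpha> = 1 \<longrightarrow> (compact_hardy_operator p q (J_op g) \<longleftrightarrow>
       (\<forall>f \<in> hardy p. \<forall>z \<in> ball 0 1. J_op g f z = 0)))"
proof (intro conjI impI)
  assume "\<alpha> < 1"
  show "compact_hardy_operator p q (J_op g) \<longleftrightarrow> g \<in> little_lipschitz \<alpha>"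
  proof
    assume "g \<in> little_lipschitz \<alpha>"
    then show "compact_hardy_operator p q (J_op g)"
      using \<open>\<alpha> < 1\<close> assms by (intro J_op_compact)
  next
    assume c: "compact_hardy_operator p q (J_op g)"
    have "((\<lambda>z. (1 - (norm z)\<^sup>2) powr (1 - \<alpha>) * cmod (radial_deriv g z)) \<longlongrightarrow> 0) (filtercomap norm (at_left 1))"
    proof (rule tendstoI)
      fix \<epsilon> :: real assume "0 < \<epsilon>"
      then obtain \<rho> where \<rho>: "\<rho> < 1"
        "\<And>z. \<rho> < norm z \<Longrightarrow> norm z < 1 \<Longrightarrow> (1 - (norm z)\<^sup>2) powr (1 - \<alpha>) * cmod (radial_deriv g z) < \<epsilon>"
        using compact_J_op_imp_small[OF assms c] by metis
      have "eventually (\<lambda>x. \<rho> < x \<and> x < 1) (at_left (1 :: real))"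
        unfolding eventually_at_left_field using \<rho>(1) by (intro exI[of _ \<rho>]) auto
      then show "eventually (\<lambda>z. dist ((1 - (norm z)\<^sup>2) powr (1 - \<alpha>) * cmod (radial_deriv g z)) 0 < \<epsilon>) (filtercomap norm (at_left 1))"
        unfolding eventually_filtercomap using \<rho>(2) by (intro exI conjI) (auto simp: dist_real_def)
    qed
    then show "g \<in> little_lipschitz \<alpha>"
      using assms(3) by (simp add: little_lipschitz_def)
  qed
next
  assume \<alpha>1: "\<alpha> = 1"
  show "compact_hardy_operator p q (J_op g) \<longleftrightarrow> (\<forall>f \<in> hardy p. \<forall>z \<in> ball 0 1. J_op g f z = 0)"
  proof
    assume c: "compact_hardy_operator p q (J_op g)"
    \<comment> \<open>For \<alpha> = 1 the weight is 1 in the ball, so the radial derivative itself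
      is small near the sphere, and the maximum principle on slices carries this inside.\<close>
    have R0: "radial_deriv g z = 0" if z: "z \<in> ball 0 1" for z
    proof (cases "z = 0")
      case False
      have "cmod (radial_deriv g z) \<le> \<epsilon>" if \<epsilon>: "0 < \<epsilon>" for \<epsilon>
      proof -
        obtain \<rho> where \<rho>: "\<rho> < 1"
          "\<And>z. \<rho> < norm z \<Longrightarrow> norm z < 1 \<Longrightarrow> (1 - (norm z)\<^sup>2) powr (1 - \<alpha>) * cmod (radial_deriv g z) < \<epsilon>"
          using compact_J_op_imp_small[OF assms c \<epsilon>] by metis
        \<comment> \<open>A radius beyond \<open>norm z\<close> at which the bound
          \<open>\<epsilon>\<close> holds: \<open>z\<close> is then inside the slice disc whose rim
          has norm \<open>t\<close>.\<close>
        obtain t where t: "max \<rho> (norm z) < t" "t < 1" using dense[of "max \<rho> (norm z)" 1] \<rho>(1) z by auto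
        define r where "r = t / norm z"
        have r: "1 < r" "r * norm z = t" using False t by (auto simp: r_def field_simps)
        have in_B: "w *s z \<in> ball 0 1" if "w \<in> cball 0 r" for w
        proof -
          have "cmod w * norm z \<le> r * norm z" using that by (intro mult_right_mono) auto
          then show ?thesis using r t by simp
        qed
        have "(\<lambda>w. radial_deriv g (0 + w *s z)) holomorphic_on cball 0 r"
          using in_B by (intro holomorphic_vec_line_holomorphic[OF holomorphic_vec_radial_deriv[OF assms(3) open_ball] open_ball]) simp
        then have hol: "(\<lambda>w. radial_deriv g (w *s z)) holomorphic_on cball 0 r" by simp
        have "cmod (radial_deriv g (1 *s z)) \<le> \<epsilon>"
        proof (rule maximum_modulus_frontier[where f = "\<lambda>w. radial_deriv g (w *s z)" and S = "cball 0 r" and \<xi> = 1])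
          show "(\<lambda>w. radial_deriv g (w *s z)) holomorphic_on interior (cball 0 r)"
            by (rule holomorphic_on_subset[OF hol interior_subset])
          show "continuous_on (closure (cball 0 r)) (\<lambda>w. radial_deriv g (w *s z))"
            using holomorphic_on_imp_continuous_on[OF hol] by simp
          fix w :: complex assume "w \<in> frontier (cball 0 r)"
          then have "norm (w *s z) = t" using r by simp
          then have n: "\<rho> < norm (w *s z)" "norm (w *s z) < 1" using t by auto
          \<comment> \<open>\<open>x powr 0\<close> is 1 only for nonzero \<open>x\<close>, so the
            weight simplifies only after positivity of its base is known.\<close>
          then have "0 < 1 - (norm (w *s z))\<^sup>2" by (simp add: power_less_one_iff del: norm_vector_smult_complex)
          then show "cmod (radial_deriv g (w *s z)) \<le> \<epsilon>"
            using \<rho>(2)[OF n] \<alpha>1 by simp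
        qed (use r in auto)
        then show ?thesis by simp
      qed
      then have "cmod (radial_deriv g z) \<le> 0" by (rule field_le_epsilon[of _ 0, simplified])
      then show ?thesis by simp
    qed (simp add: radial_deriv_def)
    show "\<forall>f \<in> hardy p. \<forall>z \<in> ball 0 1. J_op g f z = 0"
    proof (intro ballI)
      fix f :: "complex ^ 'n \<Rightarrow> complex" and z :: "complex ^ 'n" assume z: "z \<in> ball 0 1"
      have "J_op g f z = integral {0..1} (\<lambda>t :: real. 0)"
        unfolding J_op_def
        by (intro Henstock_Kurzweil_Integration.integral_cong) (use R0 scaleR_in_ball[OF z] in simp)
      then show "J_op g f z = 0" by simp
    qed
  next
    assume J0: "\<forall>f \<in> hardy p. \<forall>z \<in> ball 0 1. J_op g f z = 0"
    show "compact_hardy_operator p q (J_op g)"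
      unfolding compact_hardy_operator_def
    proof (intro conjI ballI allI impI)
      show "J_op g f \<in> hardy q" if "f \<in> hardy p" for f
        using J0 that by (intro zero_on_ball_in_hardy) auto
      fix F :: "nat \<Rightarrow> complex ^ 'n \<Rightarrow> complex"
      assume F: "(\<forall>k. F k \<in> hardy p) \<and> (\<exists>C. \<forall>k. hardy_norm p (F k) \<le> C)"
      \<comment> \<open>All images vanish on the ball, so the full sequence converges to the zero
        function.\<close>
      have "hardy_norm q (\<lambda>z. J_op g (F k) z - 0) = 0" for k
        unfolding hardy_norm_def using J0 F by (subst zero_on_ball_in_hardy(2)) auto
      then show "\<exists>s h. strict_mono s \<and> h \<in> hardy q \<and> (\<lambda>k. hardy_norm q (\<lambda>z. J_op g (F (s k)) z - h z)) \<longlonglongrightarrow> 0"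
        by (intro exI[of _ id] exI[of _ "\<lambda>_. 0"]) (auto simp: strict_mono_id intro: zero_on_ball_in_hardy)
    qed
  qed
qed

end
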